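(* Let $p=p_n$ with $p/n\to\infty$ as $n\to\infty$, and put $\delta(k)=(1-k/p)\,n$. Then for some sufficiently small $\varepsilon>0$, $$\liminf_{n\to\infty}\ \inf_{\phi\in\mathcal{T}_n}\Big\{\mathbb{P}_{\mu_0}(\phi=1)+\sup_{\mu_k\in H_1:\ \delta(k)\ge\varepsilon}\mathbb{P}_{\mu_k}(\phi=0)\Big\}\ \ge\ \frac14 ,$$ where the supremum is over all alternatives $\mu_k=\mathrm{Unif}(\mathcal{H}\cap\mathbb{S}^{p-1})$ with $k\in\{1,\dots,p-1\}$, $\mathcal{H}$ a $k$-dimensional linear subspace of $\mathbb{R}^p$, and $\delta(k)\ge\varepsilon$.
   Context: $\mathbb{S}^{p-1}=\{x\in\mathbb{R}^p:\|x\|_2=1\}$ and $\mu_0$ is the uniform distribution on it; $\mathrm{Unif}(\mathcal{H}\cap\mathbb{S}^{p-1})$ is the uniform (rotation-invariant) distribution on the unit sphere of $\mathcal{H}$. $\mathcal{T}_n$ is the set of all tests $\phi=\phi(X_1,\dots,X_n):(\mathbb{S}^{p-1})^n\to\{0,1\}$ (measurable functions of a sample of size $n$). $\mathbb{P}_\mu(\phi=\cdot)$ is computed with $X_1,\dots,X_n$ i.i.d. from $\mu$. $H_1$ denotes the class of all distributions $\mathrm{Unif}(\mathcal{H}\cap\mathbb{S}^{p-1})$ with $\mathcal{H}$ a linear subspace of dimension $k\in\{1,\dots,p-1\}$. *)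

theory Defs
  imports "HOL-Probability.Probability" "HOL-Library.Function_Algebras"
begin

text \<open>
  The dimension \<open>p\<close> varies with the sample size, so \<open>\<real>\<^sup>p\<close> is realised as the set of real sequences
  supported on \<open>{..<p}\<close>. The pointwise vector space structure below makes the library notions
  \<^term>\<open>subspace\<close>, \<^term>\<open>dim\<close> and \<^term>\<open>linear\<close> available for these sequences.
\<close>

instantiation "fun" :: (type, real_vector) real_vector
begin

definition scaleR_fun :: "real \<Rightarrow> ('a \<Rightarrow> 'b) \<Rightarrow> 'a \<Rightarrow> 'b"
  where "scaleR_fun c f = (\<lambda>x. c *\<^sub>R f x)"

instance
  by standard (simp_all add: scaleR_fun_def plus_fun_def fun_eq_iff algebra_simps)

end

definition euclid :: "nat \<Rightarrow> (nat \<Rightarrow> real) set"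
  where "euclid p = {x. \<forall>i\<ge>p. x i = 0}"

definition unit_sphere :: "nat \<Rightarrow> (nat \<Rightarrow> real) set"
  where "unit_sphere p = {x \<in> euclid p. L2_set x {..<p} = 1}"

text \<open>
  The topology on \<^typ>\<open>nat \<Rightarrow> real\<close> is the product topology. On \<^term>\<open>euclid p\<close> it induces the
  Euclidean topology, so the following is the unit sphere of \<open>\<real>\<^sup>p\<close> with its usual Borel sets.
\<close>

definition sphere_space :: "nat \<Rightarrow> (nat \<Rightarrow> real) measure"
  where "sphere_space p = restrict_space borel (unit_sphere p)"

text \<open>
  Orthogonal maps of \<open>H\<close>, reflections included: in dimension one the only nontrivial one is
  \<open>-id\<close>, which is needed to single out the uniform distribution on the two unit vectors. Only
  the restriction of \<open>T\<close> to \<open>H\<close> matters.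
\<close>

definition rotation_of :: "nat \<Rightarrow> (nat \<Rightarrow> real) set \<Rightarrow> ((nat \<Rightarrow> real) \<Rightarrow> (nat \<Rightarrow> real)) \<Rightarrow> bool"
  where "rotation_of p H T \<longleftrightarrow>
    linear T \<and> T ` H = H \<and> (\<forall>x\<in>H. L2_set (T x) {..<p} = L2_set x {..<p})"

definition is_unif_sphere :: "nat \<Rightarrow> (nat \<Rightarrow> real) set \<Rightarrow> (nat \<Rightarrow> real) measure \<Rightarrow> bool"
  where "is_unif_sphere p H \<mu> \<longleftrightarrow>
    prob_space \<mu> \<and> sets \<mu> = sets (sphere_space p) \<and>
    emeasure \<mu> (H \<inter> unit_sphere p) = 1 \<and>
    (\<forall>T A. rotation_of p H T \<longrightarrow> A \<in> sets \<mu> \<longrightarrow> A \<subseteq> H \<longrightarrow> emeasure \<mu> (T ` A) = emeasure \<mu> A)"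

text \<open>
  For a subspace \<open>H\<close> of \<^term>\<open>euclid p\<close> of positive dimension, the orthogonal maps of \<open>H\<close> act
  transitively on its unit sphere, so there is exactly one rotation-invariant distribution.
\<close>

definition unif_sphere :: "nat \<Rightarrow> (nat \<Rightarrow> real) set \<Rightarrow> (nat \<Rightarrow> real) measure"
  where "unif_sphere p H = (THE \<mu>. is_unif_sphere p H \<mu>)"

definition null_dist :: "nat \<Rightarrow> (nat \<Rightarrow> real) measure"
  where "null_dist p = unif_sphere p (euclid p)"

definition delta :: "nat \<Rightarrow> nat \<Rightarrow> nat \<Rightarrow> real"
  where "delta n p k = (1 - real k / real p) * real n"

definition alternatives :: "nat \<Rightarrow> nat \<Rightarrow> real \<Rightarrow> (nat \<Rightarrow> real) measure set"
  where "alternatives n p \<epsilon> =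
    {unif_sphere p H | H k. k \<in> {1..p - 1} \<and> subspace H \<and> H \<subseteq> euclid p \<and> dim H = k \<and>
       delta n p k \<ge> \<epsilon>}"

definition tests :: "nat \<Rightarrow> nat \<Rightarrow> ((nat \<Rightarrow> nat \<Rightarrow> real) \<Rightarrow> nat) set"
  where "tests n p = measurable (Pi\<^sub>M {..<n} (\<lambda>_. sphere_space p)) (count_space {0, 1})"

definition test_prob ::
    "nat \<Rightarrow> (nat \<Rightarrow> real) measure \<Rightarrow> ((nat \<Rightarrow> nat \<Rightarrow> real) \<Rightarrow> nat) \<Rightarrow> nat \<Rightarrow> ennreal"
  where "test_prob n \<mu> \<phi> b =
    emeasure (Pi\<^sub>M {..<n} (\<lambda>_. \<mu>)) {X \<in> space (Pi\<^sub>M {..<n} (\<lambda>_. \<mu>)). \<phi> X = b}"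

end

theory Submission
  imports Defs
begin

text \<open>
  Take a codimension \<open>2 * r\<close> with \<open>r * n / p\<close> close to \<open>1/8\<close> and average the error at \<open>\<phi> = 0\<close> over a
  uniformly random subspace, which bounds the supremum from below. Under the random rotation both
  samples become mixtures invariant under the orthogonal group, so only the triangular factor of the
  QR decomposition of the sample carries information. Its \<open>i\<close>-th column consists of the first \<open>i\<close>
  coordinates \<open>x\<close> of a uniform unit vector and is independent of the other columns; lowering the
  dimension from \<open>p\<close> to \<open>p - 2 * r\<close> multiplies its density by a constant times
  \<open>(1 - \<bar>x\<bar>\<^sup>2)\<^sup>-\<^sup>r\<close>. The \<open>\<chi>\<^sup>2\<close>-divergence of the product of these laws is a ratio of Beta
  functions, bounded by \<open>exp (8 * (r * n / p)\<^sup>2) - 1 \<le> 1/2\<close>, and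
  \<open>\<bar>W - 1\<bar> \<le> (W - 1)\<^sup>2 + 1/4\<close> turns this into the bound \<open>1/4\<close>.

  The uniform law on the sphere is built one coordinate at a time from Beta densities. Its moments show
  that its Laplace transform is radial, and Laplace transforms determine measures on the compact
  sphere by Stone--Weierstrass; this yields rotation invariance and uniqueness.
\<close>

text \<open>A single subspace is useless against the null hypothesis: the sample lies in it almost
  surely under the alternative and almost never under the null. Averaging removes this singularity,
  because \<open>n\<close> is far below \<open>p - 2 * r\<close>, and what survives is a smooth
  change of density. The codimension is taken even so that the exponent \<open>r\<close> is a
  natural number: density ratios are then ordinary powers, and the Beta ratios are finite products
  coming from the recurrence of the Beta function, so no Gamma asymptotics occur. Squaring the
  density ratio replaces \<open>r\<close> by \<open>2 * r\<close>, which is why room for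
  \<open>4 * r\<close> lost dimensions is demanded. In the second moment the first-order effect of
  the shift cancels; each coordinate of each column contributes a term of order
  \<open>(r / p)^2\<close>, and \<open>n\<close> columns with up to \<open>n\<close> coordinates
  give \<open>(r * n / p)^2\<close>. The growth of \<open>p / n\<close> makes
  \<open>p / (8 * n)\<close> large, so rounding it to an integer \<open>r\<close> costs little.
  Tests are averaged rather than measures, so no Haar measure on a group of maps has to be
  formed.\<close>

section \<open>The Beta law of a single coordinate\<close>

text \<open>The law of one coordinate of a uniform unit vector in \<open>\<real>\<^sup>q\<close> is obtained for \<open>a = (q - 1) / 2\<close>.\<close>

definition coord_law :: "real \<Rightarrow> real measure" where
  "coord_law a = density lborel
     (\<lambda>s. ennreal (indicator {-1<..<1} s * (1 - s\<^sup>2) powr (a - 1) / Beta (1/2) a))"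

lemma Beta_pos: "0 < x \<Longrightarrow> 0 < y \<Longrightarrow> 0 < (Beta x y :: real)"
  by (simp add: Beta_def Gamma_real_pos)

lemma sets_coord_law [measurable_cong, simp]: "sets (coord_law a) = sets borel"
  by (simp add: coord_law_def)

lemma space_coord_law [simp]: "space (coord_law a) = UNIV"
  by (simp add: coord_law_def)

text \<open>The substitution \<open>r = s^2\<close> turns the Beta integral into twice an integral
  over the positive half interval; as the integrand is even, the doubling is the integral over the
  symmetric interval.\<close>

lemma nn_integral_beta_square:
  assumes b: "b > 0"
  shows "(\<integral>\<^sup>+ s. ennreal (indicator {-1<..<1} s * (s ^ (2 * i) * (1 - s\<^sup>2) powr (b - 1))) \<partial>lborel)
    = ennreal (Beta (real i + 1/2) b)"
proof -
  define f where "f r = r powr (real i + 1/2 - 1) * (1 - r) powr (b - 1)" for r :: real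
  define F where "F s = ennreal (indicator {0<..<1} s * (s ^ (2 * i) * (1 - s\<^sup>2) powr (b - 1)))" for s :: real
  have [measurable]: "f \<in> borel_measurable borel" "F \<in> borel_measurable borel"
    unfolding f_def F_def by measurable
  have hi: "(f has_integral Beta (real i + 1/2) b) {0..1}"
    unfolding f_def by (rule has_integral_Beta_real) (use b in auto)
  have "ennreal (Beta (real i + 1/2) b) = (\<integral>\<^sup>+ r. ennreal (indicator {0..1} r * f r) \<partial>lborel)"
    by (rule nn_integral_has_integral_lebesgue[symmetric, OF _ hi]) (auto simp: f_def)
  also have "\<dots> = (\<integral>\<^sup>+ r. ennreal (f r * indicator {0\<^sup>2..1\<^sup>2} r) \<partial>lborel)"
    by (intro nn_integral_cong) (auto simp: mult.commute)
  also have "\<dots> = (\<integral>\<^sup>+ s. ennreal (f (s\<^sup>2) * (2 * s) * indicator {0..1} s) \<partial>lborel)"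
    by (rule nn_integral_substitution)
       (auto intro!: derivative_eq_intros continuous_intros simp: set_borel_measurable_def)
  also have "\<dots> = (\<integral>\<^sup>+ s. 2 * F s \<partial>lborel)"
  proof (rule nn_integral_cong_AE)
    have "AE s in lborel. s \<noteq> (0::real)" "AE s in lborel. s \<noteq> (1::real)"
      by (rule AE_lborel_singleton)+
    then show "AE s in lborel. ennreal (f (s\<^sup>2) * (2 * s) * indicator {0..1} s) = 2 * F s"
    proof eventually_elim
      case (elim s)
      show ?case
      proof (cases "0 < s \<and> s < 1")
        case True
        have "(s\<^sup>2) powr (real i + 1/2 - 1) * s = s ^ (2 * i)"
        proof -
          have "(s\<^sup>2) powr (real i + 1/2 - 1) * s = s powr (2 * (real i + 1/2 - 1)) * s powr 1"
            using True by (simp add: powr_powr flip: powr_numeral)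
          also have "\<dots> = s powr (real (2 * i))" unfolding powr_add[symmetric] by (simp add: algebra_simps)
          also have "\<dots> = s ^ (2 * i)" using True by (subst powr_realpow) auto
          finally show ?thesis .
        qed
        then have "f (s\<^sup>2) * (2 * s) = 2 * (s ^ (2 * i) * (1 - s\<^sup>2) powr (b - 1))"
          unfolding f_def by (simp add: mult.assoc mult.commute mult.left_commute)
        then have "ennreal (f (s\<^sup>2) * (2 * s)) = ennreal 2 * ennreal (s ^ (2 * i) * (1 - s\<^sup>2) powr (b - 1))"
          by (metis ennreal_mult' zero_le_numeral)
        then show ?thesis using True by (auto simp: F_def)
      next
        case False
        then show ?thesis using elim by (auto simp: F_def split: split_indicator)
      qed
    qed
  qed
  also have "\<dots> = (\<integral>\<^sup>+ s. F s \<partial>lborel) + (\<integral>\<^sup>+ s. F s \<partial>lborel)"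
    by (subst nn_integral_cmult) (auto simp: mult_2)
  also have "(\<integral>\<^sup>+ s. F s \<partial>lborel) + (\<integral>\<^sup>+ s. F s \<partial>lborel) =
      (\<integral>\<^sup>+ s. F s \<partial>lborel) + (\<integral>\<^sup>+ s. F (- s) \<partial>lborel)"
    using nn_integral_real_affine[of F "-1" 0] by simp
  also have "\<dots> = (\<integral>\<^sup>+ s. F s + F (- s) \<partial>lborel)"
    by (rule nn_integral_add[symmetric]) auto
  also have "\<dots> = (\<integral>\<^sup>+ s. ennreal (indicator {-1<..<1} s * (s ^ (2 * i) * (1 - s\<^sup>2) powr (b - 1))) \<partial>lborel)"
  proof (rule nn_integral_cong_AE)
    have "AE s in lborel. s \<noteq> (0::real)" by (rule AE_lborel_singleton)
    then show "AE s in lborel. F s + F (- s) = ennreal (indicator {-1<..<1} s * (s ^ (2 * i) * (1 - s\<^sup>2) powr (b - 1)))"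
      by eventually_elim (auto simp: F_def split: split_indicator)
  qed
  finally show ?thesis ..
qed

lemma nn_integral_coord_law:
  assumes [measurable]: "h \<in> borel_measurable borel"
  shows "(\<integral>\<^sup>+ s. h s \<partial>coord_law a) =
    (\<integral>\<^sup>+ s. ennreal (indicator {-1<..<1} s * (1 - s\<^sup>2) powr (a - 1) / Beta (1/2) a) * h s \<partial>lborel)"
  unfolding coord_law_def by (subst nn_integral_density) auto

lemma nn_integral_coord_law_even:
  assumes a: "a > 0"
  shows "(\<integral>\<^sup>+ s. ennreal (s ^ (2 * i) * (1 - s\<^sup>2) ^ j) \<partial>coord_law a)
    = ennreal (Beta (real i + 1/2) (a + real j) / Beta (1/2) a)"
proof -
  have B: "0 < Beta (1/2) a" using a by (intro Beta_pos) auto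
  have "(\<integral>\<^sup>+ s. ennreal (s ^ (2 * i) * (1 - s\<^sup>2) ^ j) \<partial>coord_law a) =
    (\<integral>\<^sup>+ s. ennreal (1 / Beta (1/2) a) * ennreal (indicator {-1<..<1} s * (s ^ (2 * i) * (1 - s\<^sup>2) powr (a + j - 1))) \<partial>lborel)"
    unfolding nn_integral_coord_law[of "\<lambda>s. ennreal (s ^ (2 * i) * (1 - s\<^sup>2) ^ j)", simplified]
  proof (rule nn_integral_cong)
    fix s :: real
    show "ennreal (indicator {-1<..<1} s * (1 - s\<^sup>2) powr (a - 1) / Beta (1/2) a) * ennreal (s ^ (2 * i) * (1 - s\<^sup>2) ^ j)
      = ennreal (1 / Beta (1/2) a) * ennreal (indicator {-1<..<1} s * (s ^ (2 * i) * (1 - s\<^sup>2) powr (a + j - 1)))"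
    proof (cases "s \<in> {-1<..<1}")
      case True
      then have p: "0 < 1 - s\<^sup>2" by (simp add: abs_square_less_1 abs_less_iff)
      have "(1 - s\<^sup>2) powr (a - 1) * (1 - s\<^sup>2) ^ j = (1 - s\<^sup>2) powr (a + j - 1)"
        using p by (simp add: powr_realpow[symmetric] powr_add[symmetric] algebra_simps)
      then have "(1 - s\<^sup>2) powr (a - 1) / Beta (1/2) a * (s ^ (2 * i) * (1 - s\<^sup>2) ^ j) =
         1 / Beta (1/2) a * (s ^ (2 * i) * (1 - s\<^sup>2) powr (a + j - 1))"
        by (simp add: field_simps)
      then show ?thesis using True B p by (simp add: ennreal_mult'[symmetric])
    qed simp
  qed
  also have "\<dots> = ennreal (1 / Beta (1/2) a) * ennreal (Beta (real i + 1/2) (a + j))"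
    using a by (subst nn_integral_cmult) (auto simp: nn_integral_beta_square)
  also have "\<dots> = ennreal (Beta (real i + 1/2) (a + real j) / Beta (1/2) a)"
    using B by (subst ennreal_mult'[symmetric]) (auto simp: field_simps)
  finally show ?thesis .
qed

lemma prob_space_coord_law: "a > 0 \<Longrightarrow> prob_space (coord_law a)"
  using nn_integral_coord_law_even[of a 0 0] Beta_pos[of "1/2" a]
  by (intro prob_spaceI) simp

lemma AE_coord_law:
  shows "AE s in coord_law a. s \<in> {-1<..<1}"
  unfolding coord_law_def by (subst AE_density) (auto split: split_indicator)

text \<open>\<open>coord_law 1\<close> is the uniform law on \<open>{-1<..<1}\<close>, and its sign
  serves as the fair coin of the zero-dimensional sphere. The value \<open>sgn 0 = 0\<close>, which
  is no unit vector, has to be excluded.\<close>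

lemma AE_coord_law_nonzero:
  shows "AE s in coord_law a. s \<noteq> 0"
  unfolding coord_law_def using AE_lborel_singleton[of "0::real"] by (subst AE_density) (auto elim: eventually_mono)

lemma nn_integral_coord_law_uminus:
  assumes [measurable]: "h \<in> borel_measurable borel"
  shows "(\<integral>\<^sup>+ s. h (- s) \<partial>coord_law a) = (\<integral>\<^sup>+ s. h s \<partial>coord_law a)"
proof -
  have *: "indicator {-1<..<1} (- s) = (indicator {-1<..<1} s :: real)" for s :: real
    by (auto split: split_indicator)
  show ?thesis
    unfolding nn_integral_coord_law[OF assms] nn_integral_coord_law[of "\<lambda>s. h (- s)", simplified]
    by (subst (2) nn_integral_real_affine[of _ "-1" 0]) (auto simp: *)
qed

lemma distr_coord_law_uminus: "distr (coord_law a) borel uminus = coord_law a"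
proof (rule measure_eqI)
  fix A assume "A \<in> sets (distr (coord_law a) borel uminus)"
  then have [measurable]: "A \<in> sets borel" by simp
  show "emeasure (distr (coord_law a) borel uminus) A = emeasure (coord_law a) A"
    using nn_integral_coord_law_uminus[of "indicator A" a]
      nn_integral_distr[of uminus "coord_law a" borel "indicator A", symmetric]
    by (simp )
qed simp

text \<open>The shift from \<open>a\<close> to \<open>a - r\<close> corresponds to removing \<open>2 * r\<close> dimensions.\<close>

lemma nn_integral_coord_law_tilt:
  assumes a: "a > real r" and [measurable]: "h \<in> borel_measurable borel"
  shows "(\<integral>\<^sup>+ s. h s \<partial>coord_law (a - r)) =
    (\<integral>\<^sup>+ s. h s * ennreal (Beta (1/2) a / Beta (1/2) (a - r) * inverse (1 - s\<^sup>2) ^ r) \<partial>coord_law a)"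
proof -
  have B: "0 < Beta (1/2) a" "0 < Beta (1/2) (a - r)" using a by (auto intro!: Beta_pos)
  show ?thesis
    unfolding nn_integral_coord_law[OF assms(2)]
  proof (subst nn_integral_coord_law, measurable, rule nn_integral_cong)
    fix s :: real
    show "ennreal (indicator {-1<..<1} s * (1 - s\<^sup>2) powr (a - r - 1) / Beta (1/2) (a - r)) * h s =
      ennreal (indicator {-1<..<1} s * (1 - s\<^sup>2) powr (a - 1) / Beta (1/2) a) *
         (h s * ennreal (Beta (1/2) a / Beta (1/2) (a - r) * inverse (1 - s\<^sup>2) ^ r))"
    proof (cases "s \<in> {-1<..<1}")
      case True
      then have p: "0 < 1 - s\<^sup>2" by (simp add: abs_square_less_1 abs_less_iff)
      have "(1 - s\<^sup>2) powr (a - 1) = (1 - s\<^sup>2) powr (a - r - 1) * (1 - s\<^sup>2) ^ r"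
        using p by (simp add: powr_realpow[symmetric] powr_add[symmetric] algebra_simps)
      then have "(1 - s\<^sup>2) powr (a - 1) / Beta (1/2) a * (Beta (1/2) a / Beta (1/2) (a - r) * inverse (1 - s\<^sup>2) ^ r)
         = (1 - s\<^sup>2) powr (a - r - 1) / Beta (1/2) (a - r)"
        using p B by (simp add: field_simps)
      then have "ennreal ((1 - s\<^sup>2) powr (a - r - 1) / Beta (1/2) (a - r)) =
         ennreal ((1 - s\<^sup>2) powr (a - 1) / Beta (1/2) a) *
          ennreal (Beta (1/2) a / Beta (1/2) (a - r) * inverse (1 - s\<^sup>2) ^ r)"
        using p B by (subst ennreal_mult'[symmetric]) auto
      then show ?thesis using True by (simp add: mult_ac)
    qed simp
  qed
qed

section \<open>Replacing the factors of a product measure\<close>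

text \<open>Likelihood ratios multiply over independent factors. The maps \<open>g\<close> and
  \<open>g'\<close> let one statement serve for pushing a rotation into the integrand, for
  reflecting all columns of a sample, and for changing the dimension of the sphere with the weights
  \<open>w\<close>.\<close>

lemma nn_integral_PiM_swap:
  fixes h :: "('i \<Rightarrow> 'c) \<Rightarrow> ennreal"
  assumes I: "finite I"
    and M: "\<And>i. prob_space (M i)" and N: "\<And>i. prob_space (N i)"
    and g: "\<And>i. g i \<in> M i \<rightarrow>\<^sub>M K i" and g': "\<And>i. g' i \<in> N i \<rightarrow>\<^sub>M K i"
    and w: "\<And>i. w i \<in> borel_measurable (N i)"
    and eq: "\<And>i u. i \<in> I \<Longrightarrow> u \<in> borel_measurable (K i) \<Longrightarrow>
       (\<integral>\<^sup>+ x. u (g i x) \<partial>M i) = (\<integral>\<^sup>+ x. u (g' i x) * w i x \<partial>N i)"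
    and h: "h \<in> borel_measurable (Pi\<^sub>M I K)"
  shows "(\<integral>\<^sup>+ x. h (\<lambda>i\<in>I. g i (x i)) \<partial>Pi\<^sub>M I M) =
     (\<integral>\<^sup>+ x. h (\<lambda>i\<in>I. g' i (x i)) * (\<Prod>i\<in>I. w i (x i)) \<partial>Pi\<^sub>M I N)"
  using I eq h
proof (induction I arbitrary: h rule: finite_induct)
  case empty
  then show ?case by (simp add: PiM_empty nn_integral_count_space_finite)
next
  case (insert i I)
  note [measurable] = g g' w insert.prems(2)
  interpret M: product_sigma_finite M
    by (rule product_sigma_finite.intro) (simp add: M prob_space_imp_sigma_finite)
  interpret N: product_sigma_finite N
    by (rule product_sigma_finite.intro) (simp add: N prob_space_imp_sigma_finite)
  interpret Ni: prob_space "N i" by (rule N)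
  interpret Mi: prob_space "M i" by (rule M)
  have upd: "(\<lambda>j\<in>insert i I. f j ((x(i := y)) j)) = (\<lambda>j\<in>I. f j (x j))(i := f i y)" for f :: "'i \<Rightarrow> 'z \<Rightarrow> 'c" and x y
    using insert.hyps by (auto simp: fun_eq_iff)
  have [measurable]: "(\<lambda>(z, c). h (z(i := c))) \<in> borel_measurable (Pi\<^sub>M I K \<Otimes>\<^sub>M K i)"
    by measurable
  have m1: "(\<lambda>x. \<integral>\<^sup>+ y. h (x(i := g' i y)) * w i y \<partial>N i) \<in> borel_measurable (Pi\<^sub>M I K)"
    by measurable
  have "(\<integral>\<^sup>+ x. h (\<lambda>j\<in>insert i I. g j (x j)) \<partial>Pi\<^sub>M (insert i I) M)
    = (\<integral>\<^sup>+ x. \<integral>\<^sup>+ y. h ((\<lambda>j\<in>I. g j (x j))(i := g i y)) \<partial>M i \<partial>Pi\<^sub>M I M)"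
    unfolding upd[symmetric] using insert.hyps
    by (intro M.product_nn_integral_insert) measurable
  also have "\<dots> = (\<integral>\<^sup>+ x. \<integral>\<^sup>+ y. h ((\<lambda>j\<in>I. g j (x j))(i := g' i y)) * w i y \<partial>N i \<partial>Pi\<^sub>M I M)"
  proof (rule nn_integral_cong)
    fix x assume x: "x \<in> space (Pi\<^sub>M I M)"
    have [measurable]: "(\<lambda>j\<in>I. g j (x j)) \<in> space (Pi\<^sub>M I K)"
      using x by (auto simp: space_PiM PiE_iff intro: measurable_space[OF g])
    have "(\<lambda>c. h ((\<lambda>j\<in>I. g j (x j))(i := c))) \<in> borel_measurable (K i)"
      by measurable
    from insert.prems(1)[OF _ this]
    show "(\<integral>\<^sup>+ y. h ((\<lambda>j\<in>I. g j (x j))(i := g i y)) \<partial>M i) = (\<integral>\<^sup>+ y. h ((\<lambda>j\<in>I. g j (x j))(i := g' i y)) * w i y \<partial>N i)"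
      by simp
  qed
  \<comment> \<open>The induction hypothesis is applied to the function in which coordinate
    \<open>i\<close> is already integrated out under the new law.\<close>
  also have "\<dots> = (\<integral>\<^sup>+ x. (\<integral>\<^sup>+ y. h ((\<lambda>j\<in>I. g' j (x j))(i := g' i y)) * w i y \<partial>N i) * (\<Prod>j\<in>I. w j (x j)) \<partial>Pi\<^sub>M I N)"
    using insert.IH[of "\<lambda>x. \<integral>\<^sup>+ y. h (x(i := g' i y)) * w i y \<partial>N i", OF _ m1] insert.prems(1)
    by (metis (no_types, lifting) insertI2)
  also have "\<dots> = (\<integral>\<^sup>+ x. \<integral>\<^sup>+ y. h ((\<lambda>j\<in>I. g' j (x j))(i := g' i y)) * (w i y * (\<Prod>j\<in>I. w j (x j))) \<partial>N i \<partial>Pi\<^sub>M I N)"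
  proof (rule nn_integral_cong)
    fix x assume x: "x \<in> space (Pi\<^sub>M I N)"
    have [measurable]: "(\<lambda>j\<in>I. g' j (x j)) \<in> space (Pi\<^sub>M I K)"
      using x by (auto simp: space_PiM PiE_iff intro: measurable_space[OF g'])
    show "(\<integral>\<^sup>+ y. h ((\<lambda>j\<in>I. g' j (x j))(i := g' i y)) * w i y \<partial>N i) * (\<Prod>j\<in>I. w j (x j)) =
      (\<integral>\<^sup>+ y. h ((\<lambda>j\<in>I. g' j (x j))(i := g' i y)) * (w i y * (\<Prod>j\<in>I. w j (x j))) \<partial>N i)"
      by (subst nn_integral_multc[symmetric]) (auto simp: mult.assoc)
  qed
  also have "\<dots> = (\<integral>\<^sup>+ x. h (\<lambda>j\<in>insert i I. g' j (x j)) * (\<Prod>j\<in>insert i I. w j (x j)) \<partial>Pi\<^sub>M (insert i I) N)"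
  proof (subst N.product_nn_integral_insert)
    show "(\<integral>\<^sup>+ x. \<integral>\<^sup>+ y. h ((\<lambda>j\<in>I. g' j (x j))(i := g' i y)) * (w i y * (\<Prod>j\<in>I. w j (x j))) \<partial>N i \<partial>Pi\<^sub>M I N) =
      (\<integral>\<^sup>+ x. \<integral>\<^sup>+ y. h (\<lambda>j\<in>insert i I. g' j ((x(i := y)) j)) * (\<Prod>j\<in>insert i I. w j ((x(i := y)) j)) \<partial>N i \<partial>Pi\<^sub>M I N)"
    proof (intro nn_integral_cong)
      fix x y
      have "(\<Prod>j\<in>insert i I. w j ((x(i := y)) j)) = w i y * (\<Prod>j\<in>I. w j (x j))"
        using insert.hyps by (subst prod.insert) (auto intro!: arg_cong2[where f="(*)"] prod.cong)
      then show "h ((\<lambda>j\<in>I. g' j (x j))(i := g' i y)) * (w i y * (\<Prod>j\<in>I. w j (x j))) =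
        h (\<lambda>j\<in>insert i I. g' j ((x(i := y)) j)) * (\<Prod>j\<in>insert i I. w j ((x(i := y)) j))"
        unfolding upd by simp
    qed
  qed (use insert.hyps in auto)
  finally show ?case .
qed

section \<open>The uniform law on the sphere, built by slicing\<close>

definition dot :: "nat \<Rightarrow> (nat \<Rightarrow> real) \<Rightarrow> (nat \<Rightarrow> real) \<Rightarrow> real" where
  "dot p x y = (\<Sum>i<p. x i * y i)"

text \<open>Slicing the sphere by its leading coordinate: the remaining coordinates have length
  \<open>sqrt (1 - s^2)\<close>, and \<open>y\<close> is their direction.\<close>

definition attach :: "real \<Rightarrow> (nat \<Rightarrow> real) \<Rightarrow> nat \<Rightarrow> real" where
  "attach s y = case_nat s (\<lambda>j. sqrt (1 - s\<^sup>2) * y j)"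

text \<open>The index is the dimension of the sphere: \<open>sphere_unif d\<close> lives in \<^term>\<open>euclid (Suc d)\<close>.\<close>

primrec sphere_unif :: "nat \<Rightarrow> (nat \<Rightarrow> real) measure" where
  "sphere_unif 0 = distr (coord_law 1) borel (\<lambda>s. case_nat (sgn s) (\<lambda>_. 0))"
| "sphere_unif (Suc d) = distr (coord_law ((real d + 1) / 2) \<Otimes>\<^sub>M sphere_unif d) borel (\<lambda>(s, y). attach s y)"

lemma measurable_fun_iff:
  fixes f :: "'a \<Rightarrow> 'i::countable \<Rightarrow> 'b::second_countable_topology"
  shows "f \<in> borel_measurable M \<longleftrightarrow> (\<forall>i. (\<lambda>x. f x i) \<in> borel_measurable M)"
  using measurable_coordinatewise_then_product measurable_product_then_coordinatewise by metis

lemma measurable_dot [measurable (raw)]: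
  assumes [measurable]: "f \<in> borel_measurable M" "g \<in> borel_measurable M"
  shows "(\<lambda>x. dot p (f x) (g x)) \<in> borel_measurable M"
proof -
  note assms[THEN measurable_product_then_coordinatewise, measurable]
  show ?thesis unfolding dot_def by measurable
qed

lemma measurable_attach [measurable (raw)]:
  assumes [measurable]: "f \<in> borel_measurable M" "g \<in> borel_measurable M"
  shows "(\<lambda>x. attach (f x) (g x)) \<in> borel_measurable M"
  unfolding attach_def
proof (subst measurable_fun_iff, safe)
  note assms(2)[THEN measurable_product_then_coordinatewise, measurable]
  fix i show "(\<lambda>x. case i of 0 \<Rightarrow> f x | Suc j \<Rightarrow> sqrt (1 - (f x)\<^sup>2) * g x j) \<in> borel_measurable M"
    by (cases i) auto
qed

lemma measurable_sgn [measurable]: "sgn \<in> borel_measurable (borel :: real measure)"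
  by (simp add: sgn_real_def[abs_def])

lemma measurable_sgn_case [measurable]:
  "(\<lambda>s::real. case_nat (sgn s) (\<lambda>_. 0::real)) \<in> borel_measurable borel"
proof (subst measurable_fun_iff, safe)
  fix i show "(\<lambda>s. case i of 0 \<Rightarrow> sgn s | Suc j \<Rightarrow> (0::real)) \<in> borel_measurable borel"
    by (cases i) auto
qed

lemma sets_sphere_unif [measurable_cong, simp]: "sets (sphere_unif d) = sets borel"
  by (cases d) auto

lemma space_sphere_unif [simp]: "space (sphere_unif d) = UNIV"
  by (cases d) auto

lemma prob_space_sphere_unif: "prob_space (sphere_unif d)"
proof (induction d)
  case 0
  interpret prob_space "coord_law 1" by (rule prob_space_coord_law) simp
  show ?case unfolding sphere_unif.simps by (rule prob_space_distr) simp
next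
  case (Suc d)
  interpret a: prob_space "coord_law ((real d + 1) / 2)" by (rule prob_space_coord_law) simp
  interpret s: prob_space "sphere_unif d" by fact
  interpret pair_prob_space "coord_law ((real d + 1) / 2)" "sphere_unif d" ..
  show ?case unfolding sphere_unif.simps by (rule prob_space_distr) simp
qed

lemma nn_integral_sphere_unif_Suc:
  assumes [measurable]: "h \<in> borel_measurable borel"
  shows "(\<integral>\<^sup>+ x. h x \<partial>sphere_unif (Suc d)) = (\<integral>\<^sup>+ s. \<integral>\<^sup>+ y. h (attach s y) \<partial>sphere_unif d \<partial>coord_law ((real d + 1) / 2))"
proof -
  interpret s: prob_space "sphere_unif d" by (rule prob_space_sphere_unif)
  show ?thesis
    by (subst sphere_unif.simps, subst nn_integral_distr)
       (auto simp: s.nn_integral_fst[symmetric])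
qed

lemma dot_self_nonneg [simp]: "dot p x x \<ge> 0"
  by (simp add: dot_def sum_nonneg)

lemma dot_commute: "dot p x y = dot p y x"
  by (simp add: dot_def mult.commute)

lemma L2_set_dot: "L2_set x {..<p} = sqrt (dot p x x)"
  by (simp add: L2_set_def dot_def power2_eq_square)

lemma mem_unit_sphere: "x \<in> unit_sphere p \<longleftrightarrow> x \<in> euclid p \<and> dot p x x = 1"
  by (simp add: unit_sphere_def L2_set_dot)

lemma dot_attach: "dot (Suc p) t (attach s y) = t 0 * s + sqrt (1 - s\<^sup>2) * dot p (\<lambda>i. t (Suc i)) y"
  by (simp add: dot_def attach_def sum.lessThan_Suc_shift sum_distrib_left algebra_simps del: sum.lessThan_Suc)

lemma dot_attach_self:
  "s \<in> {-1<..<1} \<Longrightarrow> dot (Suc p) (attach s y) (attach s y) = s\<^sup>2 + (1 - s\<^sup>2) * dot p y y"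
proof -
  assume "s \<in> {-1<..<1}"
  then have "0 \<le> 1 - s\<^sup>2" by (simp add: abs_square_le_1 abs_le_iff)
  then show ?thesis
    by (simp add: dot_attach) (simp add: attach_def dot_def sum_distrib_left power2_eq_square mult_ac flip: real_sqrt_mult)
qed

text \<open>All \<open>sphere_unif d\<close> are Borel measures on the full sequence space, so that
  spheres of different dimensions share one type; the sphere itself is recovered only almost
  everywhere.\<close>

lemma AE_sphere_unif: "AE x in sphere_unif d. x \<in> unit_sphere (Suc d)"
proof (induction d)
  case 0
  have [measurable]: "Measurable.pred borel (\<lambda>x. \<forall>i\<ge>1::nat. x i = (0::real))" by measurable
  show ?case unfolding mem_unit_sphere euclid_def mem_Collect_eq sphere_unif.simps One_nat_def[symmetric]
  proof (subst AE_distr_iff)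
    show "AE s in coord_law 1. (\<forall>i\<ge>1. (case i of 0 \<Rightarrow> sgn s | Suc j \<Rightarrow> 0) = 0) \<and>
      dot 1 (case_nat (sgn s) (\<lambda>_. 0)) (case_nat (sgn s) (\<lambda>_. 0)) = 1"
      using AE_coord_law_nonzero[of 1]
      by eventually_elim (auto simp: dot_def sgn_real_def split: nat.splits)
  qed auto
next
  case (Suc d)
  have a: "prob_space (coord_law ((real d + 1) / 2))" by (rule prob_space_coord_law) simp
  interpret s: prob_space "sphere_unif d" by (rule prob_space_sphere_unif)
  interpret a: prob_space "coord_law ((real d + 1) / 2)" by fact
  interpret pair_prob_space "coord_law ((real d + 1) / 2)" "sphere_unif d" ..
  have [measurable]: "Measurable.pred borel (\<lambda>x. \<forall>i\<ge>p. x i = (0::real))" for p :: nat by measurable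
  let ?P = "\<lambda>x::nat\<Rightarrow>real. (\<forall>i\<ge>Suc (Suc d). x i = 0) \<and> dot (Suc (Suc d)) x x = 1"
  have P: "Measurable.pred borel ?P" by measurable
  have P': "Measurable.pred (coord_law ((real d + 1) / 2) \<Otimes>\<^sub>M sphere_unif d) (\<lambda>z. ?P (attach (fst z) (snd z)))"
    by (rule measurable_compose[OF _ P]) simp
  have "AE z in coord_law ((real d + 1) / 2) \<Otimes>\<^sub>M sphere_unif d. ?P (attach (fst z) (snd z))"
  proof (rule AE_pair_measure)
    show "AE s in coord_law ((real d + 1) / 2). AE y in sphere_unif d. ?P (attach (fst (s, y)) (snd (s, y)))"
      using AE_coord_law
    proof eventually_elim
      case (elim s)
      show ?case using Suc.IH[unfolded mem_unit_sphere euclid_def mem_Collect_eq]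
      proof eventually_elim
        case (elim y)
        with \<open>s \<in> _\<close> show ?case by (auto simp: dot_attach_self) (auto simp: attach_def split: nat.splits)
      qed
    qed
  qed (rule P'[unfolded pred_def])
  then show ?case unfolding mem_unit_sphere euclid_def mem_Collect_eq sphere_unif.simps split_beta
    by (subst AE_distr_iff) (use P in \<open>auto simp: pred_def\<close>)
qed

lemma unit_sphere_le_1:
  assumes "x \<in> unit_sphere p" shows "\<bar>x i\<bar> \<le> 1"
proof (cases "i < p")
  case True
  have "x i * x i \<le> dot p x x" unfolding dot_def using True by (intro member_le_sum) auto
  then show ?thesis using assms by (simp add: mem_unit_sphere abs_square_le_1[symmetric] power2_eq_square)
qed (use assms in \<open>auto simp: mem_unit_sphere euclid_def\<close>)

lemma dot_unit_sphere_bound: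
  assumes "x \<in> unit_sphere q" shows "\<bar>dot p t x\<bar> \<le> (\<Sum>i<p. \<bar>t i\<bar>)"
proof -
  have "\<bar>dot p t x\<bar> \<le> (\<Sum>i<p. \<bar>t i\<bar> * \<bar>x i\<bar>)"
    unfolding dot_def by (intro order.trans[OF sum_abs]) (simp add: abs_mult)
  also have "\<dots> \<le> (\<Sum>i<p. \<bar>t i\<bar>)"
    using unit_sphere_le_1[OF assms] by (intro sum_mono mult_left_le) auto
  finally show ?thesis .
qed

subsection \<open>Moments\<close>

lemma integral_coord_law_odd:
  assumes "odd i"
  shows "(LINT s|coord_law a. s ^ i * sqrt (1 - s\<^sup>2) ^ m) = 0"
proof -
  let ?f = "\<lambda>s::real. s ^ i * sqrt (1 - s\<^sup>2) ^ m"
  have "integral\<^sup>L (coord_law a) ?f = integral\<^sup>L (distr (coord_law a) borel uminus) ?f"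
    by (simp add: distr_coord_law_uminus)
  also have "\<dots> = (LINT s|coord_law a. - ?f s)"
    using assms by (subst integral_distr) (auto simp: power_minus_odd)
  finally show ?thesis by simp
qed

text \<open>Integer shifts of the Beta parameters leave only rising factorials, so the moment
  recursion over the dimension becomes pure algebra.\<close>

lemma Beta_shift_ratio:
  fixes a :: real
  assumes a: "a > 0"
  shows "Beta (real u + 1/2) (a + real v) / Beta (1/2) a =
    pochhammer (1/2) u * pochhammer a v / pochhammer (a + 1/2) (u + v)"
proof -
  have 1: "pochhammer (1/2::real) u = Gamma (1/2 + u) / Gamma (1/2)"
    by (rule pochhammer_Gamma) (auto elim!: nonpos_Ints_cases)
  have 2: "pochhammer a v = Gamma (a + v) / Gamma a"
    by (rule pochhammer_Gamma) (use a in \<open>auto elim!: nonpos_Ints_cases\<close>)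
  have 3: "pochhammer (a + 1/2) (u + v) = Gamma (a + 1/2 + real (u + v)) / Gamma (a + 1/2)"
    by (rule pochhammer_Gamma) (use a in \<open>auto elim!: nonpos_Ints_cases\<close>)
  have g: "Gamma (1/2::real) > 0" "Gamma a > 0" "Gamma (a + 1/2) > 0" "Gamma (a + 1/2 + real (u + v)) > 0"
    using a by (auto intro!: Gamma_real_pos)
  show ?thesis
    unfolding 1 2 3 Beta_def using g by (simp add: field_simps)
qed

lemma integral_coord_law_even:
  assumes a: "a > 0"
  shows "(LINT s|coord_law a. s ^ (2 * u) * sqrt (1 - s\<^sup>2) ^ (2 * v)) =
    pochhammer (1/2) u * pochhammer a v / pochhammer (a + 1/2) (u + v)"
proof -
  have "(LINT s|coord_law a. s ^ (2 * u) * sqrt (1 - s\<^sup>2) ^ (2 * v)) = (LINT s|coord_law a. s ^ (2 * u) * (1 - s\<^sup>2) ^ v)"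
  proof (rule integral_cong_AE)
    show "AE s in coord_law a. s ^ (2 * u) * sqrt (1 - s\<^sup>2) ^ (2 * v) = s ^ (2 * u) * (1 - s\<^sup>2) ^ v"
      using AE_coord_law by eventually_elim (simp add: power_mult abs_square_le_1 abs_le_iff)
  qed auto
  also have "\<dots> = enn2real (\<integral>\<^sup>+ s. ennreal (s ^ (2 * u) * (1 - s\<^sup>2) ^ v) \<partial>coord_law a)"
  proof (rule integral_eq_nn_integral)
    show "AE s in coord_law a. 0 \<le> s ^ (2 * u) * (1 - s\<^sup>2) ^ v"
      using AE_coord_law by eventually_elim (simp add: abs_square_le_1 abs_le_iff)
  qed auto
  also have "\<dots> = Beta (real u + 1/2) (a + real v) / Beta (1/2) a"
  proof -
    have "0 < Beta (real u + 1/2) (a + real v)" "0 < Beta (1/2) a"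
      using a by (auto intro!: Beta_pos)
    then show ?thesis using a by (subst nn_integral_coord_law_even) auto
  qed
  finally show ?thesis using Beta_shift_ratio[OF a] by simp
qed

text \<open>Everything becomes a factorial through
  \<open>pochhammer (1/2) k = fact (2 * k) / (2 ^ (2 * k) * fact k)\<close>. The identity turns the
  even terms of a binomial expansion of order \<open>2 * j\<close> into the expansion of order
  \<open>j\<close> of a sum of two squares.\<close>

lemma binomial_pochhammer_half:
  assumes "u \<le> j"
  shows "real ((2 * j) choose (2 * u)) * (pochhammer (1/2) u * pochhammer (1/2) (j - u)) =
    pochhammer (1/2) j * real (j choose u)"
proof -
  obtain v where j: "j = u + v" using assms le_Suc_ex by blast
  have p: "pochhammer (1/2::real) k = fact (2 * k) / (2 ^ (2 * k) * fact k)" for k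
    using fact_double[of k, where 'a=real] by (simp add: field_simps)
  have "real ((2 * j) choose (2 * u)) = fact (2 * j) / (fact (2 * u) * fact (2 * v))"
    unfolding j by (subst binomial_fact) (auto simp: algebra_simps)
  moreover have "real (j choose u) = fact j / (fact u * fact v)"
    unfolding j by (subst binomial_fact) auto
  ultimately show ?thesis unfolding p unfolding j by (simp add: field_simps power_add)
qed

lemma sum_atMost_even:
  fixes f :: "nat \<Rightarrow> real"
  assumes "\<And>i. odd i \<Longrightarrow> f i = 0"
  shows "(\<Sum>i\<le>2 * j. f i) = (\<Sum>u\<le>j. f (2 * u))"
  by (induction j) (use assms in auto)

text \<open>The \<open>l\<close>-th moment of one coordinate of a uniform unit vector in dimension
  \<open>d + 1\<close>.\<close>

definition moment :: "nat \<Rightarrow> nat \<Rightarrow> real" where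
  "moment d l = (if odd l then 0 else pochhammer (1/2) (l div 2) / pochhammer ((real d + 1) / 2) (l div 2))"

lemma integrable_sphere_unif_bounded:
  fixes f :: "(nat \<Rightarrow> real) \<Rightarrow> real"
  assumes [measurable]: "f \<in> borel_measurable borel" and B: "\<And>x. x \<in> unit_sphere (Suc d) \<Longrightarrow> \<bar>f x\<bar> \<le> B"
  shows "integrable (sphere_unif d) f"
proof -
  interpret prob_space "sphere_unif d" by (rule prob_space_sphere_unif)
  show ?thesis
    by (rule integrable_const_bound[where B=B]) (use AE_sphere_unif[of d] B in \<open>auto elim!: eventually_mono\<close>)
qed

lemma integrable_sphere_unif_dot_power: "integrable (sphere_unif d) (\<lambda>x. dot p t x ^ l)"
  by (rule integrable_sphere_unif_bounded[where B="(\<Sum>i<p. \<bar>t i\<bar>) ^ l"])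
     (auto simp: power_abs intro!: power_mono dot_unit_sphere_bound)

text \<open>Slicing off the leading coordinate and expanding binomially reduces to the smaller
  sphere. Odd terms vanish by symmetry and the even ones reassemble into a power of the squared
  length of \<open>t\<close>. That the direction of \<open>t\<close> drops out is the algebraic core
  of rotation invariance, since the slicing construction singles out an ordering of the
  axes.\<close>

lemma integral_sphere_unif_moment:
  "(LINT x|sphere_unif d. dot (Suc d) t x ^ l) = moment d l * dot (Suc d) t t ^ (l div 2)"
proof (induction d arbitrary: t l)
  case 0
  have "(LINT x|sphere_unif 0. dot (Suc 0) t x ^ l) = (LINT s|coord_law 1. (t 0 * sgn s) ^ l)"
    unfolding sphere_unif.simps by (subst integral_distr) (auto simp: dot_def)
  also have "\<dots> = moment 0 l * dot (Suc 0) t t ^ (l div 2)"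
  proof (cases "odd l")
    case True
    have "(LINT s|coord_law 1. (t 0 * sgn s) ^ l) = integral\<^sup>L (distr (coord_law 1) borel uminus) (\<lambda>s. (t 0 * sgn s) ^ l)"
      by (simp add: distr_coord_law_uminus)
    also have "\<dots> = (LINT s|coord_law 1. - ((t 0 * sgn s) ^ l))"
      using True by (subst integral_distr) (auto simp: power_minus_odd sgn_minus)
    finally show ?thesis using True by (simp add: moment_def)
  next
    case False
    interpret prob_space "coord_law 1" by (rule prob_space_coord_law) simp
    have "(LINT s|coord_law 1. (t 0 * sgn s) ^ l) = (LINT s|coord_law 1. t 0 ^ l)"
    proof (rule integral_cong_AE)
      show "AE s in coord_law 1. (t 0 * sgn s) ^ l = t 0 ^ l"
        using AE_coord_law_nonzero[of 1]
        by eventually_elim (use False in \<open>auto simp: power_mult_distrib sgn_real_def\<close>)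
    qed auto
    also have "\<dots> = t 0 ^ l" by (simp add: prob_space[simplified])
    also have "\<dots> = moment 0 l * dot (Suc 0) t t ^ (l div 2)"
      using False pochhammer_pos[of "1/2::real"] by (auto simp: moment_def dot_def less_imp_neq[symmetric] power_mult_distrib mult_2 power_add elim!: evenE)
    finally show ?thesis .
  qed
  finally show ?case .
next
  case (Suc d)
  define a where "a = (real d + 1) / 2"
  have a: "a > 0" by (simp add: a_def)
  interpret s: prob_space "sphere_unif d" by (rule prob_space_sphere_unif)
  interpret a: prob_space "coord_law a" by (rule prob_space_coord_law) fact
  interpret pp: pair_prob_space "coord_law a" "sphere_unif d" ..
  define t' where "t' = (\<lambda>i. t (Suc i))"
  define A where "A i m = (LINT s|coord_law a. s ^ i * sqrt (1 - s\<^sup>2) ^ m)" for i m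
  have int_coord_law: "integrable (coord_law a) (\<lambda>s. s ^ i * sqrt (1 - s\<^sup>2) ^ m)" for i m
  proof (rule a.integrable_const_bound[where B=1])
    show "AE s in coord_law a. norm (s ^ i * sqrt (1 - s\<^sup>2) ^ m) \<le> 1"
      using AE_coord_law
    proof eventually_elim
      case (elim s)
      then have "\<bar>s\<bar> \<le> 1" "sqrt (1 - s\<^sup>2) \<le> 1" "0 \<le> sqrt (1 - s\<^sup>2)"
        by (auto simp: abs_le_iff abs_square_le_1)
      then show ?case by (auto simp: abs_mult power_abs intro!: mult_le_one power_le_one)
    qed
  qed auto
  have prod_int: "integrable (coord_law a \<Otimes>\<^sub>M sphere_unif d) (\<lambda>z. (fst z ^ i * sqrt (1 - (fst z)\<^sup>2) ^ m) * dot (Suc d) t' (snd z) ^ k)" for i m k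
  proof (rule pp.Fubini_integrable)
    show "integrable (coord_law a) (\<lambda>s. LINT y|sphere_unif d. norm ((fst (s, y) ^ i * sqrt (1 - (fst (s, y))\<^sup>2) ^ m) * dot (Suc d) t' (snd (s, y)) ^ k))"
      using integrable_norm[OF int_coord_law[of i m]] by (simp add: abs_mult)
    show "AE s in coord_law a. integrable (sphere_unif d) (\<lambda>y. (fst (s, y) ^ i * sqrt (1 - (fst (s, y))\<^sup>2) ^ m) * dot (Suc d) t' (snd (s, y)) ^ k)"
      by (simp add: integrable_sphere_unif_dot_power)
  qed measurable
  have "(LINT x|sphere_unif (Suc d). dot (Suc (Suc d)) t x ^ l) =
    (LINT z|(coord_law a \<Otimes>\<^sub>M sphere_unif d). (t 0 * fst z + sqrt (1 - (fst z)\<^sup>2) * dot (Suc d) t' (snd z)) ^ l)"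
    unfolding sphere_unif.simps by (subst integral_distr) (auto simp: dot_attach a_def t'_def split_beta)
  also have "\<dots> = (LINT z|(coord_law a \<Otimes>\<^sub>M sphere_unif d). (\<Sum>i\<le>l. (real (l choose i) * t 0 ^ i) *
      ((fst z ^ i * sqrt (1 - (fst z)\<^sup>2) ^ (l - i)) * dot (Suc d) t' (snd z) ^ (l - i))))"
    by (intro Bochner_Integration.integral_cong)
       (auto simp: binomial_ring power_mult_distrib algebra_simps intro!: sum.cong)
  also have "\<dots> = (\<Sum>i\<le>l. (real (l choose i) * t 0 ^ i) * (A i (l - i) * (moment d (l - i) * dot (Suc d) t' t' ^ ((l - i) div 2))))"
  proof (subst Bochner_Integration.integral_sum)
    fix i show "integrable (coord_law a \<Otimes>\<^sub>M sphere_unif d) (\<lambda>z. (real (l choose i) * t 0 ^ i) *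
      ((fst z ^ i * sqrt (1 - (fst z)\<^sup>2) ^ (l - i)) * dot (Suc d) t' (snd z) ^ (l - i)))"
      by (rule integrable_mult_right[OF prod_int])
  next
    have "(LINT z|(coord_law a \<Otimes>\<^sub>M sphere_unif d). (fst z ^ i * sqrt (1 - (fst z)\<^sup>2) ^ m) * dot (Suc d) t' (snd z) ^ k)
      = A i m * (moment d k * dot (Suc d) t' t' ^ (k div 2))" for i m k
      by (subst pp.integral_fst'[symmetric, OF prod_int]) (simp add: A_def Suc.IH)
    then show "(\<Sum>i\<le>l. LINT z|(coord_law a \<Otimes>\<^sub>M sphere_unif d). (real (l choose i) * t 0 ^ i) *
      ((fst z ^ i * sqrt (1 - (fst z)\<^sup>2) ^ (l - i)) * dot (Suc d) t' (snd z) ^ (l - i))) =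
       (\<Sum>i\<le>l. (real (l choose i) * t 0 ^ i) * (A i (l - i) * (moment d (l - i) * dot (Suc d) t' t' ^ ((l - i) div 2))))"
      by simp
  qed
  also have "\<dots> = moment (Suc d) l * dot (Suc (Suc d)) t t ^ (l div 2)"
  proof (cases "odd l")
    case True
    \<comment> \<open>For odd \<open>l\<close> one of \<open>i\<close> and \<open>l - i\<close> is
      odd, so either the coordinate law or the smaller sphere contributes zero.\<close>
    have "A i (l - i) * (moment d (l - i) * dot (Suc d) t' t' ^ ((l - i) div 2)) = 0" if "i \<le> l" for i
      using True that integral_coord_law_odd[of i a "l - i"] by (cases "odd i") (auto simp: A_def moment_def)
    then have "(\<Sum>i\<le>l. (real (l choose i) * t 0 ^ i) * (A i (l - i) * (moment d (l - i) * dot (Suc d) t' t' ^ ((l - i) div 2)))) = 0"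
      by (intro sum.neutral) (metis atMost_iff mult_zero_right)
    moreover have "moment (Suc d) l = 0" using True by (simp add: moment_def)
    ultimately show ?thesis by simp
  next
    case False
    then obtain j where l: "l = 2 * j" by (auto elim: evenE)
    have dt: "dot (Suc (Suc d)) t t = t 0 * t 0 + dot (Suc d) t' t'"
      by (simp add: dot_def sum.lessThan_Suc_shift t'_def del: sum.lessThan_Suc)
    have a2: "a + 1/2 = (real (Suc d) + 1) / 2" by (simp add: a_def field_simps)
    have ap: "pochhammer a k > 0" for k using a by (rule pochhammer_pos)
    have "(\<Sum>i\<le>l. (real (l choose i) * t 0 ^ i) * (A i (l - i) * (moment d (l - i) * dot (Suc d) t' t' ^ ((l - i) div 2))))
      = (\<Sum>u\<le>j. (real ((2 * j) choose (2 * u)) * t 0 ^ (2 * u)) *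
         (A (2 * u) (2 * j - 2 * u) * (moment d (2 * j - 2 * u) * dot (Suc d) t' t' ^ ((2 * j - 2 * u) div 2))))"
      unfolding l by (rule sum_atMost_even) (use integral_coord_law_odd in \<open>auto simp: A_def\<close>)
    also have "\<dots> = (\<Sum>u\<le>j. moment (Suc d) l * (real (j choose u) * (t 0 * t 0) ^ u * dot (Suc d) t' t' ^ (j - u)))"
    proof (rule sum.cong[OF refl])
      fix u assume "u \<in> {..j}"
      then have u: "u \<le> j" by simp
      have *: "2 * j - 2 * u = 2 * (j - u)" by simp
      have A: "A (2 * u) (2 * j - 2 * u) = pochhammer (1/2) u * pochhammer a (j - u) / pochhammer (a + 1/2) j"
        unfolding A_def * integral_coord_law_even[OF a] using u by simp
      have m: "moment d (2 * j - 2 * u) = pochhammer (1/2) (j - u) / pochhammer a (j - u)"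
        unfolding * moment_def a_def by simp
      have m2: "moment (Suc d) l = pochhammer (1/2) j / pochhammer (a + 1/2) j"
        unfolding l moment_def a2 by simp
      have "(real ((2 * j) choose (2 * u)) * t 0 ^ (2 * u)) *
         (A (2 * u) (2 * j - 2 * u) * (moment d (2 * j - 2 * u) * dot (Suc d) t' t' ^ ((2 * j - 2 * u) div 2))) =
        (real ((2 * j) choose (2 * u)) * (pochhammer (1/2) u * pochhammer (1/2) (j - u))) / pochhammer (a + 1/2) j
          * (t 0 ^ (2 * u)) * dot (Suc d) t' t' ^ (j - u)"
      proof -
        have h: "(2 * j - 2 * u) div 2 = j - u" unfolding * by simp
        \<comment> \<open>The factor \<open>pochhammer a (j - u)\<close> from the coordinate law
          cancels the denominator of \<open>moment d\<close>; the parameter \<open>a\<close> of the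
          slice must match the dimension exactly for this.\<close>
        show ?thesis unfolding A m h using ap[of "j - u"] by (simp add: mult_ac)
      qed
      also have "\<dots> = moment (Suc d) l * (real (j choose u) * (t 0 * t 0) ^ u * dot (Suc d) t' t' ^ (j - u))"
        unfolding binomial_pochhammer_half[OF u] m2 by (simp add: power_mult power2_eq_square)
      finally show "(real ((2 * j) choose (2 * u)) * t 0 ^ (2 * u)) *
         (A (2 * u) (2 * j - 2 * u) * (moment d (2 * j - 2 * u) * dot (Suc d) t' t' ^ ((2 * j - 2 * u) div 2))) =
         moment (Suc d) l * (real (j choose u) * (t 0 * t 0) ^ u * dot (Suc d) t' t' ^ (j - u))" .
    qed
    also have "\<dots> = moment (Suc d) l * dot (Suc (Suc d)) t t ^ (l div 2)"
      unfolding dt l by (simp add: binomial_ring sum_distrib_left)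
    finally show ?thesis .
  qed
  finally show ?case .
qed

text \<open>The bound \<open>B\<close> gives the summable majorant \<open>B ^ l / fact l\<close>, so
  sum and integral may be exchanged. This is how moments determine the Laplace transform.\<close>

lemma (in prob_space) integral_exp_sums:
  fixes f :: "'a \<Rightarrow> real"
  assumes [measurable]: "f \<in> borel_measurable M" and B: "AE x in M. \<bar>f x\<bar> \<le> B"
  shows "(\<lambda>l. (LINT x|M. f x ^ l) / fact l) sums (LINT x|M. exp (f x))"
proof -
  have int: "integrable M (\<lambda>x. f x ^ l /\<^sub>R fact l)" for l
  proof (rule integrable_const_bound[where B="B ^ l /\<^sub>R fact l"])
    show "AE x in M. norm (f x ^ l /\<^sub>R fact l) \<le> B ^ l /\<^sub>R fact l"
      using B by eventually_elim (auto simp: abs_mult power_abs intro!: mult_left_mono power_mono)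
  qed auto
  have "(\<lambda>l. LINT x|M. f x ^ l /\<^sub>R fact l) sums (LINT x|M. (\<Sum>l. f x ^ l /\<^sub>R fact l))"
  proof (rule sums_integral[OF int])
    show "AE x in M. summable (\<lambda>l. norm (f x ^ l /\<^sub>R fact l))"
      by (rule AE_I2) (rule summable_norm_exp)
    show "summable (\<lambda>l. LINT x|M. norm (f x ^ l /\<^sub>R fact l))"
    proof (rule summable_comparison_test[OF _ summable_exp_generic[of B]], intro exI allI impI)
      fix l :: nat
      have "(LINT x|M. norm (f x ^ l /\<^sub>R fact l)) \<le> (LINT x|M. B ^ l /\<^sub>R fact l)"
      proof (rule integral_mono_AE[OF integrable_norm[OF int]])
        show "AE x in M. norm (f x ^ l /\<^sub>R fact l) \<le> B ^ l /\<^sub>R fact l"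
          using B by eventually_elim (auto simp: abs_mult power_abs intro!: mult_left_mono power_mono)
      qed simp
      then show "norm (LINT x|M. norm (f x ^ l /\<^sub>R fact l)) \<le> B ^ l /\<^sub>R fact l"
        by (simp add: prob_space)
    qed
  qed
  then show ?thesis by (simp add: exp_def field_simps)
qed

lemma dot_truncate: "dot p t x = dot q t x" if "x \<in> euclid q" "q \<le> p"
proof -
  have "dot p t x = (\<Sum>i<q. t i * x i)" unfolding dot_def
    by (rule sum.mono_neutral_right) (use that in \<open>auto simp: euclid_def\<close>)
  then show ?thesis by (simp add: dot_def)
qed

lemma unit_sphere_mono: "q \<le> p \<Longrightarrow> unit_sphere q \<subseteq> unit_sphere p"
proof
  fix x assume "q \<le> p" "x \<in> unit_sphere q"
  then show "x \<in> unit_sphere p"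
    using dot_truncate[of x q p x] by (auto simp: mem_unit_sphere euclid_def)
qed

text \<open>All moments of the linear form given by \<open>t\<close> depend on \<open>t\<close> only
  through its length, hence so does the exponential series built from them.\<close>

lemma laplace_sphere_unif_radial:
  assumes "dot (Suc d) t t = dot (Suc d) t' t'"
  shows "(LINT x|sphere_unif d. exp (dot (Suc d) t x)) = (LINT x|sphere_unif d. exp (dot (Suc d) t' x))"
proof -
  interpret prob_space "sphere_unif d" by (rule prob_space_sphere_unif)
  have "(\<lambda>l. (LINT x|sphere_unif d. dot (Suc d) t x ^ l) / fact l) sums (LINT x|sphere_unif d. exp (dot (Suc d) t x))" for t
    by (rule integral_exp_sums[where B="\<Sum>i<Suc d. \<bar>t i\<bar>"])
       (use AE_sphere_unif[of d] dot_unit_sphere_bound in \<open>auto elim!: eventually_mono simp del: sum.lessThan_Suc\<close>)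
  from this[of t] this[of t'] show ?thesis
    unfolding integral_sphere_unif_moment assms by (rule sums_unique2)
qed

subsection \<open>Laplace transforms on the sphere\<close>

lemma continuous_on_dot [continuous_intros]: "continuous_on S (\<lambda>x. dot p t x)"
  unfolding dot_def
  by (intro continuous_intros continuous_on_subset[OF continuous_on_product_coordinates]) auto

lemma dot_add_left: "dot p (\<lambda>i. x i + y i) z = dot p x z + dot p y z"
  by (simp add: dot_def sum.distrib algebra_simps)

lemma dot_diff_left: "dot p (\<lambda>i. x i - y i) z = dot p x z - dot p y z"
  by (simp add: dot_def sum_subtractf algebra_simps)

lemma dot_scale_left: "dot p (\<lambda>i. c * x i) z = c * dot p x z"
  by (simp add: dot_def sum_distrib_left algebra_simps)

lemma dot_add_right: "dot p z (\<lambda>i. x i + y i) = dot p z x + dot p z y"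
  using dot_add_left dot_commute by metis

lemma dot_diff_right: "dot p z (\<lambda>i. x i - y i) = dot p z x - dot p z y"
  using dot_diff_left dot_commute by metis

lemma dot_scale_right: "dot p z (\<lambda>i. c * x i) = c * dot p z x"
  using dot_scale_left dot_commute by metis

lemmas dot_linear = dot_add_left dot_diff_left dot_scale_left dot_add_right dot_diff_right dot_scale_right

lemma euclid_eqI: "x \<in> euclid p \<Longrightarrow> y \<in> euclid p \<Longrightarrow> (\<And>i. i < p \<Longrightarrow> x i = y i) \<Longrightarrow> x = y"
proof (rule ext)
  fix i assume "x \<in> euclid p" "y \<in> euclid p" "\<And>i. i < p \<Longrightarrow> x i = y i"
  then show "x i = y i" by (cases "i < p") (simp_all add: euclid_def)
qed

lemma closed_euclid: "closed (euclid p)"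
proof -
  have "euclid p = (\<Inter>i\<in>{p..}. {x. x i = 0})"
    by (auto simp: euclid_def)
  moreover have "closed {x :: nat \<Rightarrow> real. x i = 0}" for i
    by (rule closed_Collect_eq) (auto intro!: continuous_intros)
  ultimately show ?thesis by auto
qed

lemma euclid_borel [measurable]: "euclid p \<in> sets borel"
  using closed_euclid by (rule borel_closed)

text \<open>Tychonoff: in the product topology the sphere is a closed subset of a cube.\<close>

lemma compact_unit_sphere: "compact (unit_sphere p)"
proof (rule compact_Int_closed[of "PiE UNIV (\<lambda>_. {-1..1::real})" "unit_sphere p", THEN arg_cong[of _ _ compact, THEN iffD1, rotated]])
  show "compact (PiE UNIV (\<lambda>_::nat. {-1..1::real}))"
    using compactin_PiE[of "\<lambda>_. euclidean" UNIV "\<lambda>_::nat. {-1..1::real}"]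
    by (simp add: euclidean_product_topology)
  have "closed {x :: nat \<Rightarrow> real. dot p x x = 1}"
    unfolding dot_def by (rule closed_Collect_eq) (auto intro!: continuous_intros)
  moreover have "unit_sphere p = euclid p \<inter> {x. dot p x x = 1}"
    by (auto simp: mem_unit_sphere)
  ultimately show "closed (unit_sphere p)" using closed_euclid[of p] by auto
  show "PiE UNIV (\<lambda>_. {-1..1}) \<inter> unit_sphere p = unit_sphere p"
    using unit_sphere_le_1[of _ p] by (force simp: abs_le_iff)
qed

lemma unit_sphere_borel [measurable]: "unit_sphere p \<in> sets borel"
  using compact_unit_sphere by (intro borel_compact)

text \<open>Linear combinations of exponentials, coded as lists so that sums and products of such
  functions become operations on lists; they form the algebra to which Stone-Weierstrass is
  applied.\<close>

definition exp_sum :: "nat \<Rightarrow> (real \<times> (nat \<Rightarrow> real)) list \<Rightarrow> (nat \<Rightarrow> real) \<Rightarrow> real" where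
  "exp_sum p l x = (\<Sum>(c, t)\<leftarrow>l. c * exp (dot p t x))"

lemma exp_sum_Nil [simp]: "exp_sum p [] x = 0"
  and exp_sum_Cons [simp]: "exp_sum p ((c, t) # l) x = c * exp (dot p t x) + exp_sum p l x"
  by (auto simp: exp_sum_def)

lemma exp_sum_append: "exp_sum p (l @ l') x = exp_sum p l x + exp_sum p l' x"
  by (simp add: exp_sum_def)

lemma exp_sum_scale:
  "exp_sum p (map (\<lambda>(c', t'). (c * c', \<lambda>i. t i + t' i)) l) x = c * exp (dot p t x) * exp_sum p l x"
  by (induction l) (auto simp: dot_linear exp_add algebra_simps)

lemma exp_sum_mult: "\<exists>m. exp_sum p m = (\<lambda>x. exp_sum p l x * exp_sum p l' x)"
proof (induction l)
  case Nil
  show ?case by (rule exI[of _ "[]"]) auto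
next
  case (Cons a l)
  obtain c t where a: "a = (c, t)" by fastforce
  from Cons obtain m where m: "exp_sum p m = (\<lambda>x. exp_sum p l x * exp_sum p l' x)" by auto
  show ?case
    by (rule exI[of _ "map (\<lambda>(c', t'). (c * c', \<lambda>i. t i + t' i)) l' @ m"])
       (auto simp: exp_sum_append exp_sum_scale m a fun_eq_iff distrib_right)
qed

lemma continuous_on_exp_sum: "continuous_on S (exp_sum p l)"
proof (induction l)
  case (Cons a l)
  then show ?case by (cases a) (auto intro!: continuous_intros)
qed (simp add: exp_sum_def)

lemma exp_sum_dense:
  assumes "continuous_on (unit_sphere p) f" "e > 0"
  shows "\<exists>l. \<forall>x\<in>unit_sphere p. \<bar>f x - exp_sum p l x\<bar> < e"
proof -
  have "\<exists>g. (\<exists>l. g = exp_sum p l) \<and> (\<forall>x\<in>unit_sphere p. \<bar>f x - g x\<bar> < e)"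
  proof (rule Stone_Weierstrass_HOL[of "unit_sphere p" "\<lambda>g. \<exists>l. g = exp_sum p l"])
    show "\<exists>l. (\<lambda>x. c) = exp_sum p l" for c
      by (rule exI[of _ "[(c, \<lambda>_. 0)]"]) (auto simp: dot_def)
    show "\<exists>l. (\<lambda>x. f x + g x) = exp_sum p l" if "(\<exists>l. f = exp_sum p l) \<and> (\<exists>l. g = exp_sum p l)" for f g
    proof -
      from that obtain l l' where "f = exp_sum p l" "g = exp_sum p l'" by blast
      then show ?thesis by (intro exI[of _ "l @ l'"]) (simp add: fun_eq_iff exp_sum_append)
    qed
    show "\<exists>l. (\<lambda>x. f x * g x) = exp_sum p l" if "(\<exists>l. f = exp_sum p l) \<and> (\<exists>l. g = exp_sum p l)" for f g
      using that exp_sum_mult by metis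
    show "\<exists>f. (\<exists>l. f = exp_sum p l) \<and> f x \<noteq> f y"
      if xy: "x \<in> unit_sphere p \<and> y \<in> unit_sphere p \<and> x \<noteq> y" for x y
    proof -
      from xy obtain i where i: "i < p" "x i \<noteq> y i"
        using euclid_eqI by (metis mem_unit_sphere)
      \<comment> \<open>The exponential of the coordinate in which \<open>x\<close> and
        \<open>y\<close> differ separates the two points.\<close>
      define t where "t j = (if j = i then 1 else 0 :: real)" for j
      have "dot p t z = z i" for z using i by (simp add: dot_def t_def sum.delta if_distrib[of "\<lambda>u. u * _"] cong: if_cong)
      then have "exp_sum p [(1, t)] x \<noteq> exp_sum p [(1, t)] y" using i by simp
      then show ?thesis by blast
    qed
  qed (use assms continuous_on_exp_sum compact_unit_sphere in auto)
  then show ?thesis by blast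
qed

lemma integrable_unit_sphere:
  fixes M :: "(nat \<Rightarrow> real) measure"
  assumes pM: "prob_space M" and M: "sets M = sets borel" and s: "AE x in M. x \<in> unit_sphere p"
    and f: "f \<in> borel_measurable borel" "continuous_on (unit_sphere p) (f :: (nat \<Rightarrow> real) \<Rightarrow> real)"
  shows "integrable M f"
proof -
  interpret prob_space M by (rule pM)
  have "bounded (f ` unit_sphere p)"
    by (intro compact_imp_bounded compact_continuous_image f compact_unit_sphere)
  then obtain B where B: "\<And>x. x \<in> unit_sphere p \<Longrightarrow> norm (f x) \<le> B"
    by (auto simp: bounded_iff)
  show ?thesis
  proof (rule integrable_const_bound[where B=B])
    show "AE x in M. norm (f x) \<le> B" using s by eventually_elim (rule B)
    show "f \<in> borel_measurable M" using f(1) by (simp add: measurable_cong_sets[OF M])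
  qed
qed

text \<open>Equality of integrals passes from exponentials to their linear combinations, by density
  to continuous functions, by approximation to indicators of closed sets, and from this
  intersection-stable generator to all Borel sets.\<close>

lemma measure_eqI_laplace:
  fixes M N :: "(nat \<Rightarrow> real) measure"
  assumes pM: "prob_space M" and pN: "prob_space N"
    and sM: "sets M = sets borel" and sN: "sets N = sets borel"
    and M: "AE x in M. x \<in> unit_sphere p" and N: "AE x in N. x \<in> unit_sphere p"
    and eq: "\<And>t. (LINT x|M. exp (dot p t x)) = (LINT x|N. exp (dot p t x))"
  shows "M = N"
proof -
  interpret M: prob_space M by fact
  interpret N: prob_space N by fact
  note [measurable_cong] = sM sN
  note iM = integrable_unit_sphere[OF pM sM M] and iN = integrable_unit_sphere[OF pN sN N]
  have exp_m [measurable]: "exp_sum p l \<in> borel_measurable borel" for l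
    by (intro borel_measurable_continuous_onI continuous_on_exp_sum)
  have 1: "integral\<^sup>L M (exp_sum p l) = integral\<^sup>L N (exp_sum p l)" for l
  proof (induction l)
    case (Cons a l)
    obtain c t where a: "a = (c, t)" by fastforce
    have i: "integrable M (\<lambda>x. c * exp (dot p t x))" "integrable N (\<lambda>x. c * exp (dot p t x))"
      by (auto intro!: iM iN continuous_intros)
    have j: "integrable M (exp_sum p l)" "integrable N (exp_sum p l)"
      by (auto intro!: iM iN continuous_on_exp_sum)
    have "exp_sum p (a # l) = (\<lambda>x. c * exp (dot p t x) + exp_sum p l x)" by (auto simp: a)
    then show ?case using i j Cons.IH by (simp add: eq)
  qed (simp add: exp_sum_def)
  have 2: "integral\<^sup>L M f = integral\<^sup>L N f"
    if f: "continuous_on UNIV f" for f :: "(nat \<Rightarrow> real) \<Rightarrow> real"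
  proof -
    have fK: "continuous_on (unit_sphere p) f" using f continuous_on_subset by blast
    have [measurable]: "f \<in> borel_measurable borel" using f by (rule borel_measurable_continuous_onI)
    have "\<bar>integral\<^sup>L M f - integral\<^sup>L N f\<bar> \<le> 0 + e" if "e > 0" for e
    proof -
      obtain l where l: "\<And>x. x \<in> unit_sphere p \<Longrightarrow> \<bar>f x - exp_sum p l x\<bar> < e / 2"
        using exp_sum_dense[OF fK, of "e/2"] \<open>e > 0\<close> by auto
      have i: "integrable M f" "integrable N f" "integrable M (exp_sum p l)" "integrable N (exp_sum p l)"
        by (auto intro!: iM iN continuous_on_exp_sum fK)
      have "\<bar>integral\<^sup>L M f - integral\<^sup>L M (exp_sum p l)\<bar> \<le> (LINT x|M. e / 2)"
      proof (subst Bochner_Integration.integral_diff[symmetric, OF i(1,3)], rule integral_abs_bound[THEN order.trans], rule integral_mono_AE)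
        show "AE x in M. \<bar>f x - exp_sum p l x\<bar> \<le> e / 2"
          using M by eventually_elim (use l less_imp_le in blast)
      qed (use i in auto)
      moreover have "\<bar>integral\<^sup>L N f - integral\<^sup>L N (exp_sum p l)\<bar> \<le> (LINT x|N. e / 2)"
      proof (subst Bochner_Integration.integral_diff[symmetric, OF i(2,4)], rule integral_abs_bound[THEN order.trans], rule integral_mono_AE)
        show "AE x in N. \<bar>f x - exp_sum p l x\<bar> \<le> e / 2"
          using N by eventually_elim (use l less_imp_le in blast)
      qed (use i in auto)
      ultimately show ?thesis using 1[of l] by (simp add: M.prob_space N.prob_space) (smt (verit))
    qed
    then show ?thesis by (meson abs_le_zero_iff eq_iff_diff_eq_0 field_le_epsilon)
  qed
  have 3: "emeasure M C = emeasure N C" if C: "closed C" for C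
  proof (cases "C = {}")
    case False
    \<comment> \<open>Continuous functions bounded by \<open>1\<close> that equal \<open>1\<close>
      on \<open>C\<close> and are eventually \<open>0\<close> at every point off the closed set
      \<open>C\<close>; dominated convergence gives the measure of \<open>C\<close>.\<close>
    define f where "f k x = max 0 (1 - real k * infdist x C)" for k x
    have fc: "continuous_on UNIV (f k)" for k
      unfolding f_def by (intro continuous_intros)
    have [measurable]: "f k \<in> borel_measurable borel" for k
      by (rule borel_measurable_continuous_onI[OF fc])
    have [measurable]: "C \<in> sets borel" using C by (rule borel_closed)
    have lim: "(\<lambda>k. f k x) \<longlonglongrightarrow> indicator C x" for x
    proof (cases "x \<in> C")
      case True then show ?thesis by (simp add: f_def)
    next
      case nx: False
      then have pos: "infdist x C > 0"
        using in_closed_iff_infdist_zero[OF C False] infdist_nonneg[of x C] by (simp add: less_le)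
      obtain k0 :: nat where k0: "1 / infdist x C < k0" using reals_Archimedean2 by blast
      have "f k x = 0" if "k \<ge> k0" for k
      proof -
        have "1 / infdist x C < real k" using k0 that by linarith
        then have "1 < real k * infdist x C" using pos by (simp add: field_simps)
        then show ?thesis by (simp add: f_def)
      qed
      then have "eventually (\<lambda>k. f k x = 0) sequentially" by (auto simp: eventually_sequentially)
      then show ?thesis using nx by (simp add: tendsto_eventually)
    qed
    have b: "norm (f k x) \<le> 1" for k x using infdist_nonneg[of x C] by (auto simp: f_def)
    have "(\<lambda>k. integral\<^sup>L M (f k)) \<longlonglongrightarrow> integral\<^sup>L M (indicator C)"
      by (rule integral_dominated_convergence[where w="\<lambda>_. 1"]) (use lim b in auto)
    moreover have "(\<lambda>k. integral\<^sup>L N (f k)) \<longlonglongrightarrow> integral\<^sup>L N (indicator C)"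
      by (rule integral_dominated_convergence[where w="\<lambda>_. 1"]) (use lim b in auto)
    ultimately have "measure M C = measure N C"
      using 2[OF fc] LIMSEQ_unique by fastforce
    then show ?thesis by (simp add: M.emeasure_eq_measure N.emeasure_eq_measure)
  qed simp
  show ?thesis
  proof (rule measure_eqI_generator_eq[of "Collect closed" UNIV M N "\<lambda>_. UNIV"])
    show "Int_stable (Collect (closed :: (nat \<Rightarrow> real) set \<Rightarrow> bool))" by (auto simp: Int_stable_def)
    show "sets M = sigma_sets UNIV (Collect closed)" "sets N = sigma_sets UNIV (Collect closed)"
      unfolding sM sN borel_eq_closed by (auto simp: sets_measure_of)
  qed (use 3 in auto)
qed

subsection \<open>Reflections and orthogonal maps\<close>

text \<open>The reflection in the hyperplane orthogonal to \<open>v\<close>. Division by zero makes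
  it the identity when \<open>dot p v v = 0\<close>, so two vectors that happen to coincide need no
  separate treatment when they are to be exchanged.\<close>

definition reflect :: "nat \<Rightarrow> (nat \<Rightarrow> real) \<Rightarrow> (nat \<Rightarrow> real) \<Rightarrow> nat \<Rightarrow> real" where
  "reflect p v x = (\<lambda>i. x i - (2 * dot p v x / dot p v v) * v i)"

lemma measurable_reflect [measurable (raw)]:
  assumes [measurable]: "f \<in> borel_measurable M" "g \<in> borel_measurable M"
  shows "(\<lambda>x. reflect p (f x) (g x)) \<in> borel_measurable M"
proof -
  note assms[THEN measurable_product_then_coordinatewise, measurable]
  show ?thesis unfolding reflect_def by (subst measurable_fun_iff) auto
qed

lemma dot_shear:
  "dot p (\<lambda>i. x i - c * v i) (\<lambda>i. y i - d * v i) = dot p x y - d * dot p v x - c * dot p v y + c * d * dot p v v"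
  by (simp add: dot_linear dot_commute[of p x v] algebra_simps)

lemma dot_reflect_reflect: "dot p (reflect p v x) (reflect p v y) = dot p x y"
proof (cases "dot p v v = 0")
  case False
  then show ?thesis
    unfolding reflect_def dot_shear by (simp add: field_simps)
qed (simp add: reflect_def)

lemma dot_reflect: "dot p v (reflect p v x) = - dot p v x" if "dot p v v \<noteq> 0"
  unfolding reflect_def dot_diff_right dot_scale_right using that by simp

lemma reflect_reflect: "reflect p v (reflect p v x) = x"
proof (cases "dot p v v = 0")
  case False
  show ?thesis
    unfolding reflect_def[of p v "reflect p v x"] dot_reflect[OF False] by (simp add: reflect_def fun_eq_iff)
qed (simp add: reflect_def)

lemma dot_reflect_left: "dot p (reflect p v x) y = dot p x (reflect p v y)"
  using dot_reflect_reflect[of p v x "reflect p v y"] unfolding reflect_reflect by simp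

lemma reflect_euclid: "v \<in> euclid q \<Longrightarrow> x \<in> euclid q \<Longrightarrow> reflect p v x \<in> euclid q"
  by (simp add: reflect_def euclid_def)

lemma linear_reflect: "linear (reflect p v)"
proof (rule linearI)
  fix x y :: "nat \<Rightarrow> real" and c :: real
  have a: "x + y = (\<lambda>i. x i + y i)" "c *\<^sub>R x = (\<lambda>i. c * x i)"
    by (auto simp: fun_eq_iff scaleR_fun_def)
  show "reflect p v (x + y) = reflect p v x + reflect p v y"
    unfolding a by (simp add: reflect_def fun_eq_iff dot_linear add_divide_distrib algebra_simps)
  show "reflect p v (c *\<^sub>R x) = c *\<^sub>R reflect p v x"
    unfolding a by (simp add: reflect_def fun_eq_iff dot_linear scaleR_fun_def algebra_simps)
qed

lemma dot_self_eq_0: "dot p v v = 0 \<Longrightarrow> i < p \<Longrightarrow> v i = 0"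
  by (simp add: dot_def sum_nonneg_eq_0_iff)

text \<open>Vectors of equal length are mirror images in their bisecting hyperplane: the squared
  length of \<open>a - b\<close> is twice the inner product of \<open>a - b\<close> with
  \<open>a\<close>, so the reflection subtracts exactly \<open>a - b\<close> from
  \<open>a\<close>.\<close>

lemma reflect_swap:
  assumes "dot p a a = dot p b b" "a \<in> euclid p" "b \<in> euclid p"
  shows "reflect p (\<lambda>i. a i - b i) a = b"
proof (cases "dot p (\<lambda>i. a i - b i) (\<lambda>i. a i - b i) = 0")
  case True
  have "a = b"
    by (rule euclid_eqI[OF assms(2,3)]) (use dot_self_eq_0[OF True] in auto)
  then show ?thesis by (simp add: reflect_def dot_def)
next
  case False
  have 1: "dot p (\<lambda>i. a i - b i) (\<lambda>i. a i - b i) = 2 * dot p (\<lambda>i. a i - b i) a"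
    using assms(1) by (simp add: dot_linear dot_commute[of p b a])
  show ?thesis unfolding reflect_def using False unfolding 1 by (simp add: fun_eq_iff)
qed

text \<open>In contrast to \<open>rotation_of\<close>, the map is controlled on the whole sequence
  space: bijective and measurable in both directions, so that images of Borel sets are Borel and
  maps can be composed and inverted freely.\<close>

definition orth_map :: "nat \<Rightarrow> ((nat \<Rightarrow> real) \<Rightarrow> nat \<Rightarrow> real) \<Rightarrow> bool" where
  "orth_map p T \<longleftrightarrow> linear T \<and> bij T \<and> T \<in> borel_measurable borel \<and> inv T \<in> borel_measurable borel \<and>
     T ` euclid p = euclid p \<and> (\<forall>x y. dot p (T x) (T y) = dot p x y)"

lemma isomI:
  assumes "linear T" "\<And>x. S (T x) = x" "\<And>x. T (S x) = x" "T \<in> borel_measurable borel" "S \<in> borel_measurable borel"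
    "\<And>x. x \<in> euclid p \<Longrightarrow> T x \<in> euclid p" "\<And>x. x \<in> euclid p \<Longrightarrow> S x \<in> euclid p"
    "\<And>x y. dot p (T x) (T y) = dot p x y"
  shows "orth_map p T" "inv T = S"
proof -
  show i: "inv T = S" using assms(2,3) by (metis inv_equality ext)
  have "bij T" using assms(2,3) by (metis bijI')
  moreover have "T ` euclid p = euclid p" using assms(3,6,7) by (auto simp: image_iff) metis
  ultimately show "orth_map p T" using assms i by (auto simp: orth_map_def)
qed

lemma linear_inv_bij:
  fixes T :: "'a::real_vector \<Rightarrow> 'b::real_vector"
  assumes "linear T" "bij T" shows "linear (inv T)"
proof (rule linearI)
  fix x y :: 'b and c :: real
  have *: "T (inv T z) = z" "inv T (T w) = w" for z w
    using assms(2) by (simp_all add: bij_is_surj bij_is_inj surj_f_inv_f)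
  have "T (inv T x + inv T y) = x + y"
    unfolding linear_add[OF assms(1)] * ..
  then show "inv T (x + y) = inv T x + inv T y" by (metis *(2))
  have "T (c *\<^sub>R inv T x) = c *\<^sub>R x"
    unfolding linear_scale[OF assms(1)] * ..
  then show "inv T (c *\<^sub>R x) = c *\<^sub>R inv T x" by (metis *(2))
qed

lemma orth_map_inv:
  assumes "orth_map p T" shows "orth_map p (inv T)"
proof (rule isomI(1)[where S=T])
  have b: "bij T" using assms by (auto simp: orth_map_def)
  show "linear (inv T)" using assms by (auto simp: orth_map_def intro: linear_inv_bij)
  show 1: "T (inv T x) = x" "inv T (T x) = x" for x using b by (auto simp: bij_is_surj bij_is_inj surj_f_inv_f)
  have e: "T ` euclid p = euclid p" using assms by (auto simp: orth_map_def)
  show "T x \<in> euclid p" "inv T x \<in> euclid p" if "x \<in> euclid p" for x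
    using that e 1 by (auto simp: image_iff) (metis e 1 image_iff)
  show "dot p (inv T x) (inv T y) = dot p x y" for x y using assms 1 by (metis orth_map_def)
qed (use assms in \<open>auto simp: orth_map_def\<close>)

lemma orth_map_inv_simps [simp]:
  assumes "orth_map p T"
  shows "T (inv T x) = x" "inv T (T x) = x"
  using assms by (auto simp: orth_map_def bij_is_surj bij_is_inj surj_f_inv_f)

lemma orth_map_euclid: "orth_map p T \<Longrightarrow> x \<in> euclid p \<Longrightarrow> T x \<in> euclid p"
  by (auto simp: orth_map_def)

lemma orth_map_compose: assumes S: "orth_map p S" and T: "orth_map p T" shows "orth_map p (\<lambda>x. S (T x))"
proof (rule isomI(1)[where S="\<lambda>x. inv T (inv S x)"])
  note m = S[unfolded orth_map_def] T[unfolded orth_map_def]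
  show "linear (\<lambda>x. S (T x))" using m linear_compose[of T S] by (simp add: o_def)
  show "inv T (inv S (S (T x))) = x" "S (T (inv T (inv S x))) = x" for x using S T by simp_all
  show "S (T x) \<in> euclid p" if "x \<in> euclid p" for x
    by (intro orth_map_euclid[OF S] orth_map_euclid[OF T] that)
  show "inv T (inv S x) \<in> euclid p" if "x \<in> euclid p" for x
    by (intro orth_map_euclid[OF orth_map_inv[OF S]] orth_map_euclid[OF orth_map_inv[OF T]] that)
  show "(\<lambda>x. S (T x)) \<in> borel_measurable borel" "(\<lambda>x. inv T (inv S x)) \<in> borel_measurable borel"
    by (rule measurable_compose[of T _ borel S] measurable_compose[of "inv S" _ borel "inv T"]; use m in simp)+
  show "dot p (S (T x)) (S (T y)) = dot p x y" for x y using m by simp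
qed

lemma orth_map_reflect: "v \<in> euclid p \<Longrightarrow> orth_map p (reflect p v)"
  by (rule isomI(1)[where S="reflect p v"]) (auto simp: linear_reflect reflect_reflect reflect_euclid dot_reflect_reflect)

lemma orth_map_id: "orth_map p (\<lambda>x. x)"
  by (rule isomI(1)[where S="\<lambda>x. x"]) (auto intro: linear_ident)

lemma orth_map_unit_sphere: "orth_map p T \<Longrightarrow> x \<in> unit_sphere p \<Longrightarrow> T x \<in> unit_sphere p"
  by (auto simp: orth_map_def mem_unit_sphere)

subsection \<open>The uniform distribution on the sphere of a subspace\<close>

lemma AE_sphere_unif_euclid: "AE x in sphere_unif d. x \<in> euclid (Suc d)"
  using AE_sphere_unif by eventually_elim (simp add: mem_unit_sphere)

text \<open>Integrating the Laplace transform of \<open>M\<close> over the sphere against \<^term>\<open>sphere_unif d\<close> and exchanging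
  the two integrals replaces it by that of \<^term>\<open>sphere_unif d\<close>.\<close>

lemma sphere_unif_unique:
  fixes M :: "(nat \<Rightarrow> real) measure"
  assumes pM: "prob_space M" and sM: "sets M = sets borel"
    and M: "AE x in M. x \<in> unit_sphere (Suc d)"
    and inv: "\<And>v. v \<in> euclid (Suc d) \<Longrightarrow> distr M borel (reflect (Suc d) v) = M"
  shows "M = sphere_unif d"
proof (rule measure_eqI_laplace[OF pM prob_space_sphere_unif sM sets_sphere_unif M AE_sphere_unif])
  define q where "q = Suc d"
  note M' = M[folded q_def] and inv' = inv[folded q_def]
  interpret M: prob_space M by fact
  interpret S: prob_space "sphere_unif d" by (rule prob_space_sphere_unif)
  interpret pair_prob_space M "sphere_unif d" ..
  note [measurable_cong] = sM
  define L where "L t = (LINT x|M. exp (dot q t x))" for t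
  have L: "L t = L t'" if "t \<in> euclid q" "t' \<in> euclid q" "dot q t t = dot q t' t'" for t t'
  proof -
    \<comment> \<open>The reflection along \<open>t - t'\<close> carries \<open>t\<close> to
      \<open>t'\<close>. Since it is self-adjoint it can be moved from \<open>x\<close> to
      \<open>t\<close>, which makes \<open>L\<close> radial.\<close>
    let ?v = "\<lambda>i. t i - t' i"
    have v: "?v \<in> euclid q" using that by (simp add: euclid_def)
    have "L t = (LINT x|distr M borel (reflect q ?v). exp (dot q t x))"
      unfolding inv'[OF v] by (simp add: L_def)
    also have "\<dots> = (LINT x|M. exp (dot q t (reflect q ?v x)))"
      by (subst integral_distr) auto
    also have "\<dots> = L t'"
      unfolding dot_reflect_left[symmetric] reflect_swap[OF that(3,1,2)] L_def ..
    finally show ?thesis .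
  qed
  have main: "L t = (LINT x|sphere_unif d. exp (dot q t x))" if t: "t \<in> euclid q" for t
  proof -
    define r where "r = sqrt (dot q t t)"
    define L' where "L' t = (LINT x|sphere_unif d. exp (dot q t x))" for t
    have L': "L' t = L' t'" if "dot q t t = dot q t' t'" for t t'
      using laplace_sphere_unif_radial[of d t t'] that by (simp add: L'_def q_def)
    have r: "dot q (\<lambda>i. r * y i) (\<lambda>i. r * y i) = dot q t t" if "y \<in> unit_sphere q" for y
      using that by (simp add: dot_linear r_def mem_unit_sphere)
    have int: "integrable (M \<Otimes>\<^sub>M sphere_unif d) (\<lambda>(x, y). exp (r * dot q x y))"
    proof (rule integrable_const_bound[where B="exp (\<bar>r\<bar> * real q)"])
      show "AE z in M \<Otimes>\<^sub>M sphere_unif d. norm (case z of (x, y) \<Rightarrow> exp (r * dot q x y)) \<le> exp (\<bar>r\<bar> * real q)"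
      proof (rule AE_pair_measure)
        show "AE x in M. AE y in sphere_unif d. norm (case (x, y) of (x, y) \<Rightarrow> exp (r * dot q x y)) \<le> exp (\<bar>r\<bar> * real q)"
          using M'
        proof eventually_elim
          case x: (elim x)
          show ?case using AE_sphere_unif[of d]
          proof eventually_elim
            case y: (elim y)
            have "\<bar>dot q x y\<bar> \<le> (\<Sum>i<q. \<bar>x i\<bar>)" using y by (rule dot_unit_sphere_bound)
            also have "\<dots> \<le> real q" using sum_mono[of "{..<q}" "\<lambda>i. \<bar>x i\<bar>" "\<lambda>_. 1"] unit_sphere_le_1[OF x] by simp
            finally have "\<bar>r\<bar> * \<bar>dot q x y\<bar> \<le> \<bar>r\<bar> * real q" by (intro mult_left_mono) auto
            then show ?case by (simp add: abs_mult[symmetric])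
          qed
        qed
      qed measurable
    qed measurable
    have "L t = (LINT y|sphere_unif d. L t)" by (simp add: S.prob_space[simplified])
    \<comment> \<open>\<open>L\<close> is constant on the sphere of radius \<open>r\<close> through
      \<open>t\<close>, so averaging over that sphere changes nothing.\<close>
    also have "\<dots> = (LINT y|sphere_unif d. L (\<lambda>i. r * y i))"
    proof (rule integral_cong_AE)
      show "AE y in sphere_unif d. L t = L (\<lambda>i. r * y i)"
        using AE_sphere_unif[of d, folded q_def]
        by eventually_elim (use t r in \<open>auto intro!: L simp: mem_unit_sphere euclid_def\<close>)
      show "(\<lambda>y. L (\<lambda>i. r * y i)) \<in> borel_measurable (sphere_unif d)"
        unfolding L_def dot_scale_left by measurable
    qed simp
    also have "\<dots> = (LINT y|sphere_unif d. LINT x|M. exp (r * dot q x y))"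
      unfolding L_def by (simp add: dot_linear dot_commute)
    also have "\<dots> = (LINT x|M. LINT y|sphere_unif d. exp (r * dot q x y))"
      by (rule Fubini_integral[OF int])
    also have "\<dots> = (LINT x|M. L' (\<lambda>i. r * x i))"
      unfolding L'_def by (simp add: dot_linear)
    also have "\<dots> = (LINT x|M. L' t)"
    proof (rule integral_cong_AE)
      show "AE x in M. L' (\<lambda>i. r * x i) = L' t"
        using M' by eventually_elim (rule L'[OF r])
      show "(\<lambda>x. L' (\<lambda>i. r * x i)) \<in> borel_measurable M"
        unfolding L'_def dot_scale_left by measurable
    qed simp
    also have "\<dots> = L' t" by (simp add: M.prob_space[simplified])
    finally show ?thesis unfolding L'_def .
  qed
  fix t :: "nat \<Rightarrow> real"
  \<comment> \<open>\<open>L\<close> is known to be radial only on \<open>euclid q\<close>; cutting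
    off the entries of \<open>t\<close> that \<open>dot q\<close> ignores moves an arbitrary
    \<open>t\<close> there.\<close>
  define t' where "t' = (\<lambda>i. if i < q then t i else 0)"
  have "dot q t x = dot q t' x" for x by (simp add: dot_def t'_def)
  moreover have "t' \<in> euclid q" by (simp add: t'_def euclid_def)
  ultimately show "(LINT x|M. exp (dot (Suc d) t x)) = (LINT x|sphere_unif d. exp (dot (Suc d) t x))"
    using main[of t'] by (simp add: L_def q_def)
qed

text \<open>A linear map of sequences has no matrix in general, but its restriction to finitely many
  coordinates does; the matrix is needed to form a transpose.\<close>

lemma linear_euclid_expand:
  assumes "linear R" "x \<in> euclid q"
  shows "R x = (\<lambda>j. \<Sum>i<q. x i * R (\<lambda>l. if l = i then 1 else 0) j)"
proof -
  have "x = (\<Sum>i<q. x i *\<^sub>R (\<lambda>l. if l = i then 1 else 0))"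
  proof
    fix l
    have "(\<Sum>i<k. x i *\<^sub>R (\<lambda>l. if l = i then 1 else 0)) l = (\<Sum>i<k. if l = i then x i else 0)" for k
      by (induction k) (auto simp: scaleR_fun_def)
    then show "x l = (\<Sum>i<q. x i *\<^sub>R (\<lambda>l. if l = i then 1 else 0)) l"
      using assms(2) by (simp add: euclid_def)
  qed
  then have "R x = (\<Sum>i<q. x i *\<^sub>R R (\<lambda>l. if l = i then 1 else 0))"
    using linear_sum[OF assms(1)] linear_scale[OF assms(1)] by (metis (no_types, lifting) sum.cong)
  moreover have "(\<Sum>i<k. x i *\<^sub>R R (\<lambda>l. if l = i then 1 else 0)) = (\<lambda>j. \<Sum>i<k. x i * R (\<lambda>l. if l = i then 1 else 0) j)" for k
    by (induction k) (auto simp: scaleR_fun_def fun_eq_iff)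
  ultimately show ?thesis by simp
qed

text \<open>\<open>R\<close> may fail to be measurable off \<open>euclid (Suc d)\<close>, so it
  cannot be used to push measures forward. Its transpose \<open>S\<close>, written in coordinates,
  is measurable and inverts \<open>R\<close> on \<open>euclid (Suc d)\<close>; images under
  \<open>R\<close> are therefore preimages under \<open>S\<close>, and it suffices that
  \<open>S\<close> preserves the law.\<close>

lemma sphere_unif_rotation:
  assumes R: "linear R" "R ` euclid (Suc d) = euclid (Suc d)"
    "\<And>x. x \<in> euclid (Suc d) \<Longrightarrow> dot (Suc d) (R x) (R x) = dot (Suc d) x x"
    and A: "A \<in> sets borel" "A \<subseteq> euclid (Suc d)"
  shows "R ` A \<in> sets borel" "emeasure (sphere_unif d) (R ` A) = emeasure (sphere_unif d) A"
proof -
  define q where "q = Suc d"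
  define e where "e i = (\<lambda>l::nat. if l = i then 1 else 0 :: real)" for i :: nat
  have e: "e i \<in> euclid q" if "i < q" for i using that by (simp add: e_def euclid_def)
  have Re: "R x \<in> euclid q" if "x \<in> euclid q" for x using R(2) that by (auto simp: q_def)
  have add: "x + y = (\<lambda>i. x i + y i)" for x y :: "nat \<Rightarrow> real" by auto
  have polar: "dot q (R x) (R y) = dot q x y" if "x \<in> euclid q" "y \<in> euclid q" for x y
  proof -
    \<comment> \<open>Polarization: preserved lengths give preserved inner products.\<close>
    have "dot q (R (x + y)) (R (x + y)) = dot q (x + y) (x + y)"
      using that unfolding q_def by (intro R(3)) (auto simp: euclid_def)
    then show ?thesis
      unfolding linear_add[OF R(1)] unfolding add
      using R(3)[of x] R(3)[of y] that
      by (simp add: q_def[symmetric] dot_linear dot_commute[of q y x] dot_commute[of q "R y" "R x"])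
  qed
  define S where "S x = (\<lambda>i. if i < q then dot q (R (e i)) x else 0)" for x
  have [measurable]: "S \<in> borel_measurable borel"
    unfolding S_def by (subst measurable_fun_iff) auto
  have SR: "S (R x) = x" if "x \<in> euclid q" for x
  proof (rule euclid_eqI[of _ q])
    fix i assume i: "i < q"
    then have "S (R x) i = dot q (e i) x" using polar[OF e that] by (simp add: S_def)
    also have "\<dots> = x i" using i by (simp add: dot_def e_def if_distrib[of "\<lambda>u. u * _"] cong: if_cong)
    finally show "S (R x) i = x i" .
  qed (use that in \<open>auto simp: S_def euclid_def\<close>)
  have img: "R ` B = {x \<in> euclid q. S x \<in> B}" if B: "B \<subseteq> euclid q" for B
  proof safe
    fix x assume x: "x \<in> euclid q" "S x \<in> B"
    then obtain y where "y \<in> euclid q" "x = R y" using R(2) by (auto simp: q_def)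
    with x show "x \<in> R ` B" using SR by auto
  qed (use B Re SR in \<open>auto simp: subset_eq\<close>)
  note [measurable] = A(1)
  show "R ` A \<in> sets borel"
    unfolding img[OF A(2)[folded q_def]] by measurable
  interpret prob_space "sphere_unif d" by (rule prob_space_sphere_unif)
  have S_sphere: "S x \<in> unit_sphere q" if "x \<in> unit_sphere q" for x
  proof -
    from that have "x \<in> euclid q" by (simp add: mem_unit_sphere)
    then obtain y where y: "y \<in> euclid q" "x = R y" using R(2) by (auto simp: q_def)
    then show ?thesis using that SR polar[OF y(1) y(1)] by (simp add: mem_unit_sphere)
  qed
  have "distr (sphere_unif d) borel S = sphere_unif d"
  proof (rule measure_eqI_laplace[of _ _ q])
    show "prob_space (distr (sphere_unif d) borel S)" by (rule prob_space_distr) simp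
    show "AE x in distr (sphere_unif d) borel S. x \<in> unit_sphere q"
    proof (subst AE_distr_iff)
      show "AE x in sphere_unif d. S x \<in> unit_sphere q"
        using AE_sphere_unif[of d, folded q_def] by eventually_elim (rule S_sphere)
    qed auto
    fix t :: "nat \<Rightarrow> real"
    define t' where "t' = (\<lambda>i. if i < q then t i else 0)"
    have t': "t' \<in> euclid q" "dot q t' t' = dot q t t" by (auto simp: t'_def euclid_def dot_def)
    \<comment> \<open>The adjoint relation turns the Laplace transform of the image law at
      \<open>t\<close> into that of \<open>sphere_unif d\<close> at \<open>R t'\<close>, a vector of
      the same length.\<close>
    have "dot q t (S x) = dot q (R t') x" for x
    proof -
      have "dot q (R t') x = (\<Sum>j<q. \<Sum>i<q. t' i * R (e i) j * x j)"
        unfolding linear_euclid_expand[OF R(1) t'(1)] by (simp add: dot_def e_def sum_distrib_right)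
      also have "\<dots> = (\<Sum>i<q. \<Sum>j<q. t' i * R (e i) j * x j)" by (rule sum.swap)
      also have "\<dots> = dot q t (S x)"
        by (simp add: dot_def S_def t'_def sum_distrib_left mult.assoc)
      finally show ?thesis ..
    qed
    then have "(LINT x|distr (sphere_unif d) borel S. exp (dot q t x)) = (LINT x|sphere_unif d. exp (dot q (R t') x))"
      by (subst integral_distr) auto
    also have "\<dots> = (LINT x|sphere_unif d. exp (dot q t x))"
      unfolding q_def by (rule laplace_sphere_unif_radial) (use R(3)[of t'] t' in \<open>auto simp: q_def\<close>)
    finally show "(LINT x|distr (sphere_unif d) borel S. exp (dot q t x)) = (LINT x|sphere_unif d. exp (dot q t x))" .
  qed (use AE_sphere_unif[of d] prob_space_sphere_unif[of d] in \<open>auto simp: q_def\<close>)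
  then have "emeasure (sphere_unif d) A = emeasure (distr (sphere_unif d) borel S) A" by simp
  also have "\<dots> = emeasure (sphere_unif d) (S -` A)" by (subst emeasure_distr) auto
  also have "\<dots> = emeasure (sphere_unif d) (R ` A)"
  proof (rule emeasure_eq_AE)
    show "AE x in sphere_unif d. x \<in> S -` A \<longleftrightarrow> x \<in> R ` A"
      using AE_sphere_unif_euclid[of d, folded q_def]
      by eventually_elim (auto simp: img[OF A(2)[folded q_def]])
    show "S -` A \<in> sets (sphere_unif d)" using measurable_sets[of S borel borel A] by auto
  qed (use \<open>R ` A \<in> sets borel\<close> in auto)
  finally show "emeasure (sphere_unif d) (R ` A) = emeasure (sphere_unif d) A" ..
qed

lemma mem_sets_sphere_space: "A \<in> sets (sphere_space p) \<longleftrightarrow> A \<in> sets borel \<and> A \<subseteq> unit_sphere p"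
  unfolding sphere_space_def by (subst sets_restrict_space_iff) auto

lemma space_sphere_space: "space (sphere_space p) = unit_sphere p"
  by (simp add: sphere_space_def space_restrict_space)

context
  fixes p d T H
  assumes T: "orth_map p T" and dp: "Suc d \<le> p" and H: "H = T ` euclid (Suc d)"
begin

lemma orth_map_props: "linear T" "bij T" "T \<in> borel_measurable borel" "inv T \<in> borel_measurable borel"
  "dot p (T x) (T y) = dot p x y" "linear (inv T)"
  using T orth_map_inv[OF T] by (auto simp: orth_map_def)

lemma mem_H: "x \<in> H \<longleftrightarrow> inv T x \<in> euclid (Suc d)"
proof
  assume "inv T x \<in> euclid (Suc d)"
  then have "T (inv T x) \<in> H" unfolding H by (rule imageI)
  then show "x \<in> H" using T by simp
qed (use T in \<open>auto simp: H\<close>)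

lemma euclid_Suc_subset: "euclid (Suc d) \<subseteq> euclid p"
  using dp by (auto simp: euclid_def)

lemma H_subset: "H \<subseteq> euclid p"
  unfolding H using euclid_Suc_subset orth_map_euclid[OF T] by auto

lemma H_borel [measurable]: "H \<in> sets borel"
proof -
  have "H = inv T -` euclid (Suc d)" using mem_H by auto
  then show ?thesis using measurable_sets[OF orth_map_props(4), of "euclid (Suc d)"] by simp
qed

text \<open>The candidate for the definite description in \<open>unif_sphere\<close>. The
  push-forward is already carried by the sphere; the restriction only adapts the sigma-algebra to
  \<open>sphere_space p\<close>.\<close>

definition image_unif :: "(nat \<Rightarrow> real) measure" where
  "image_unif = restrict_space (distr (sphere_unif d) borel T) (unit_sphere p)"

lemma sets_image_unif: "sets image_unif = sets (sphere_space p)"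
  unfolding image_unif_def sphere_space_def by (intro sets_restrict_space_cong) simp

lemma AE_T_sphere: "AE x in sphere_unif d. T x \<in> H \<inter> unit_sphere p"
  using AE_sphere_unif[of d]
proof eventually_elim
  case (elim x)
  then have "x \<in> unit_sphere p" using unit_sphere_mono[OF dp] by blast
  then show ?case using elim orth_map_unit_sphere[OF T] by (auto simp: H mem_unit_sphere)
qed

lemma emeasure_image_unif:
  assumes "A \<in> sets (sphere_space p)"
  shows "emeasure image_unif A = emeasure (sphere_unif d) (T -` A)"
proof -
  note [measurable] = orth_map_props(3)
  have "emeasure image_unif A = emeasure (distr (sphere_unif d) borel T) A"
    unfolding image_unif_def by (rule emeasure_restrict_space) (use assms in \<open>auto simp: mem_sets_sphere_space\<close>)
  also have "\<dots> = emeasure (sphere_unif d) (T -` A)"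
    by (subst emeasure_distr) (use assms in \<open>auto simp: mem_sets_sphere_space\<close>)
  finally show ?thesis .
qed

lemma H_sphere_sets: "H \<inter> unit_sphere p \<in> sets (sphere_space p)"
  by (auto simp: mem_sets_sphere_space)

lemma emeasure_image_unif_H: "emeasure image_unif (H \<inter> unit_sphere p) = 1"
proof -
  interpret prob_space "sphere_unif d" by (rule prob_space_sphere_unif)
  have "T -` (H \<inter> unit_sphere p) \<in> sets (sphere_unif d)"
    using measurable_sets[OF orth_map_props(3), of "H \<inter> unit_sphere p"] by simp
  then show ?thesis
    unfolding emeasure_image_unif[OF H_sphere_sets]
    by (intro emeasure_eq_1_AE) (use AE_T_sphere in auto)
qed

lemma prob_space_image_unif: "prob_space image_unif"
proof
  have s: "space image_unif = unit_sphere p" by (simp add: image_unif_def space_restrict_space)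
  have "emeasure image_unif (H \<inter> unit_sphere p) \<le> emeasure image_unif (unit_sphere p)"
    by (rule emeasure_mono) (auto simp: sets_image_unif mem_sets_sphere_space)
  moreover have "emeasure image_unif (unit_sphere p) \<le> 1"
  proof -
    interpret prob_space "sphere_unif d" by (rule prob_space_sphere_unif)
    show ?thesis by (subst emeasure_image_unif) (auto simp: mem_sets_sphere_space emeasure_le_1)
  qed
  ultimately show "emeasure image_unif (space image_unif) = 1" using emeasure_image_unif_H s by simp
qed

text \<open>Conjugating a rotation of \<open>H\<close> by \<open>T\<close> gives a rotation of the
  coordinate subspace \<open>euclid (Suc d)\<close>, where invariance is known.\<close>

lemma is_unif_sphere_image_unif: "is_unif_sphere p H image_unif"
  unfolding is_unif_sphere_def
proof (intro conjI allI impI)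
  fix R A assume R: "rotation_of p H R" and A: "A \<in> sets image_unif" "A \<subseteq> H"
  have A': "A \<in> sets borel" "A \<subseteq> unit_sphere p" using A(1) by (auto simp: sets_image_unif mem_sets_sphere_space)
  let ?R = "\<lambda>x. inv T (R (T x))" and ?A = "T -` A"
  have lin: "linear R" and RH: "R ` H = H" and
    Rn: "\<And>x. x \<in> H \<Longrightarrow> dot p (R x) (R x) = dot p x x"
    using R by (auto simp: rotation_of_def L2_set_dot)
  have TH: "T x \<in> H" if "x \<in> euclid (Suc d)" for x using that by (simp add: H)
  have "linear ?R"
    using linear_compose[OF linear_compose[OF orth_map_props(1) lin] orth_map_props(6)] by (simp add: o_def)
  moreover have "?R ` euclid (Suc d) = euclid (Suc d)"
  proof -
    have "?R ` euclid (Suc d) = inv T ` R ` T ` euclid (Suc d)" by (simp add: image_image)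
    also have "\<dots> = inv T ` H" using RH by (simp add: H)
    also have "\<dots> = euclid (Suc d)" using T by (simp add: H image_image)
    finally show ?thesis .
  qed
  moreover have "dot (Suc d) (?R x) (?R x) = dot (Suc d) x x" if x: "x \<in> euclid (Suc d)" for x
  proof -
    have "R (T x) \<in> H" using RH TH[OF x] by auto
    then have "?R x \<in> euclid (Suc d)" using mem_H by auto
    then have "dot (Suc d) (?R x) (?R x) = dot p (?R x) (?R x)" by (rule dot_truncate[symmetric]) (rule dp)
    also have "\<dots> = dot p (R (T x)) (R (T x))" using orth_map_inv[OF T] by (simp add: orth_map_def)
    also have "\<dots> = dot p x x" using Rn[OF TH[OF x]] by (simp add: orth_map_props)
    also have "\<dots> = dot (Suc d) x x" by (rule dot_truncate[OF x dp])
    finally show ?thesis .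
  qed
  moreover have "?A \<in> sets borel" using measurable_sets[OF orth_map_props(3) A'(1)] by simp
  moreover have "?A \<subseteq> euclid (Suc d)" using A(2) mem_H T by auto
  ultimately have core: "?R ` ?A \<in> sets borel" "emeasure (sphere_unif d) (?R ` ?A) = emeasure (sphere_unif d) ?A"
    using sphere_unif_rotation[of ?R d ?A] by auto
  have img: "R ` A = inv T -` (?R ` ?A)"
  proof -
    have "?A = inv T ` A"
      by (rule bij_vimage_eq_inv_image[OF orth_map_props(2)])
    then have "?R ` ?A = inv T ` R ` A" using T by (simp add: image_image)
    moreover have "inj (inv T)" using orth_map_props(2) by (intro bij_is_inj bij_imp_bij_inv)
    ultimately show ?thesis by (simp add: inj_vimage_image_eq)
  qed
  have pre: "T -` (R ` A) = ?R ` ?A" unfolding img using T by auto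
  have RA: "R ` A \<in> sets (sphere_space p)"
  proof -
    have "R ` A \<in> sets borel" unfolding img using measurable_sets[OF orth_map_props(4) core(1)] by simp
    moreover have "R ` A \<subseteq> unit_sphere p"
    proof
      fix y assume "y \<in> R ` A"
      then obtain x where x: "x \<in> A" "y = R x" by blast
      have "y \<in> H" using RH A(2) x by blast
      then show "y \<in> unit_sphere p"
        using x A(2) subsetD[OF A'(2) x(1)] Rn[of x] H_subset by (auto simp: mem_unit_sphere)
    qed
    ultimately show ?thesis by (simp add: mem_sets_sphere_space)
  qed
  show "emeasure image_unif (R ` A) = emeasure image_unif A"
    using A(1) core(2) by (simp add: emeasure_image_unif RA sets_image_unif pre)
qed (rule prob_space_image_unif sets_image_unif emeasure_image_unif_H)+

text \<open>Pulled back along \<open>inv T\<close>, the measure lives on a coordinate sphere.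
  Reflections there are conjugate to rotations of \<open>H\<close>, so the pulled-back measure is
  reflection invariant and \<open>sphere_unif_unique\<close> identifies it.\<close>

lemma is_unif_sphere_unique:
  assumes "is_unif_sphere p H \<mu>" shows "\<mu> = image_unif"
proof -
  have \<mu>: "prob_space \<mu>" "sets \<mu> = sets (sphere_space p)" "emeasure \<mu> (H \<inter> unit_sphere p) = 1"
    and inv: "\<And>R A. rotation_of p H R \<Longrightarrow> A \<in> sets \<mu> \<Longrightarrow> A \<subseteq> H \<Longrightarrow> emeasure \<mu> (R ` A) = emeasure \<mu> A"
    using assms by (auto simp: is_unif_sphere_def)
  interpret prob_space \<mu> by fact
  have sp: "space \<mu> = unit_sphere p" using \<mu>(2) space_sphere_space sets_eq_imp_space_eq by metis
  have AEH: "AE x in \<mu>. x \<in> H \<inter> unit_sphere p"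
    using \<mu>(3) H_sphere_sets \<mu>(2) by (intro AE_prob_1) (simp add: emeasure_eq_measure)
  have meas: "f \<in> borel_measurable \<mu>" if "f \<in> borel_measurable borel" for f :: "_ \<Rightarrow> nat \<Rightarrow> real"
    unfolding measurable_cong_sets[OF \<mu>(2) refl] sphere_space_def using that by (rule measurable_restrict_space1)
  note Tm [measurable] = meas[OF orth_map_props(4)]
  define N where "N = distr \<mu> borel (inv T)"
  have N: "N = sphere_unif d"
  proof (rule sphere_unif_unique)
    show "prob_space N" unfolding N_def by (rule prob_space_distr) simp
    show "sets N = sets borel" by (simp add: N_def)
    show "AE x in N. x \<in> unit_sphere (Suc d)" unfolding N_def
    proof (subst AE_distr_iff)
      show "AE x in \<mu>. inv T x \<in> unit_sphere (Suc d)" using AEH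
      proof eventually_elim
        case (elim x)
        then have x: "inv T x \<in> euclid (Suc d)" using mem_H by auto
        have "inv T x \<in> unit_sphere p" using elim orth_map_unit_sphere[OF orth_map_inv[OF T]] by blast
        then show ?case using x dot_truncate[OF x dp, of "inv T x"] by (simp add: mem_unit_sphere)
      qed
    qed auto
    fix v assume v: "v \<in> euclid (Suc d)"
    let ?S = "reflect (Suc d) v" and ?R = "\<lambda>x. T (reflect (Suc d) v (inv T x))"
    have RR: "?R (?R x) = x" for x using T by (simp add: reflect_reflect)
    have RH: "?R x \<in> H" if "x \<in> H" for x
      using that mem_H reflect_euclid[OF v] T by simp
    have rot: "rotation_of p H ?R" unfolding rotation_of_def
    proof (intro conjI ballI)
      show "linear ?R"
        using linear_compose[OF linear_compose[OF orth_map_props(6) linear_reflect] orth_map_props(1)] by (simp add: o_def)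
      show "?R ` H = H" using RH RR by (auto simp: image_iff) metis
      fix x assume "x \<in> H"
      then have x: "inv T x \<in> euclid (Suc d)" by (simp add: mem_H)
      have "dot p (?R x) (?R x) = dot (Suc d) (?S (inv T x)) (?S (inv T x))"
        using dot_truncate[OF reflect_euclid[OF v x] dp] by (simp add: orth_map_props)
      also have "\<dots> = dot (Suc d) (inv T x) (inv T x)" by (rule dot_reflect_reflect)
      also have "\<dots> = dot p (inv T x) (inv T x)" using dot_truncate[OF x dp] by simp
      also have "\<dots> = dot p x x" using orth_map_inv[OF T] by (simp add: orth_map_def)
      finally show "L2_set (?R x) {..<p} = L2_set x {..<p}" by (simp add: L2_set_dot)
    qed
    show "distr N borel ?S = N"
    proof (rule measure_eqI)
      fix B assume "B \<in> sets (distr N borel ?S)"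
      then have B [measurable]: "B \<in> sets borel" by simp
      \<comment> \<open>Invariance is assumed only for sets inside \<open>H\<close>; cutting down to
        the set \<open>H \<inter> unit_sphere p\<close> of full measure makes it applicable.\<close>
      let ?A = "{x \<in> H \<inter> unit_sphere p. inv T x \<in> B}"
      have "?A = (H \<inter> unit_sphere p) \<inter> (inv T -` B \<inter> space \<mu>)" by (auto simp: sp)
      then have A: "?A \<in> sets \<mu>" using H_sphere_sets \<mu>(2) measurable_sets[OF Tm B] by simp
      have img: "?R ` ?A = {x \<in> H \<inter> unit_sphere p. ?S (inv T x) \<in> B}"
      proof -
        have sph: "?R x \<in> unit_sphere p" if "x \<in> H \<inter> unit_sphere p" for x
          using that RH[of x] rot H_subset by (auto simp: rotation_of_def mem_unit_sphere L2_set_dot)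
        show ?thesis
        proof safe
          fix x assume "x \<in> H" "x \<in> unit_sphere p" "?S (inv T x) \<in> B"
          then have "?R x \<in> ?A" using RH sph T by auto
          then show "x \<in> ?R ` ?A" using RR by (metis (no_types, lifting) image_eqI)
        qed (use RH sph T in \<open>auto simp: reflect_reflect\<close>)
      qed
      have "emeasure (distr N borel ?S) B = emeasure \<mu> {x \<in> space \<mu>. ?S (inv T x) \<in> B}"
        unfolding N_def by (subst distr_distr, measurable, subst emeasure_distr) (auto simp: o_def intro!: arg_cong[where f="emeasure \<mu>"])
      also have "\<dots> = emeasure \<mu> (?R ` ?A)"
        unfolding img
      proof (rule emeasure_eq_AE)
        have "{x \<in> H \<inter> unit_sphere p. ?S (inv T x) \<in> B} = (H \<inter> unit_sphere p) \<inter> {x \<in> space \<mu>. ?S (inv T x) \<in> B}"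
          by (auto simp: sp)
        moreover have "{x \<in> space \<mu>. ?S (inv T x) \<in> B} \<in> sets \<mu>" by measurable
        ultimately show "{x \<in> H \<inter> unit_sphere p. ?S (inv T x) \<in> B} \<in> sets \<mu>"
          using H_sphere_sets \<mu>(2) by auto
        show "AE x in \<mu>. x \<in> {x \<in> space \<mu>. ?S (inv T x) \<in> B} \<longleftrightarrow> x \<in> {x \<in> H \<inter> unit_sphere p. ?S (inv T x) \<in> B}"
          using AEH by eventually_elim (auto simp: sp)
      qed measurable
      also have "\<dots> = emeasure \<mu> ?A" by (rule inv[OF rot A]) auto
      also have "\<dots> = emeasure \<mu> {x \<in> space \<mu>. inv T x \<in> B}"
      proof (rule emeasure_eq_AE)
        show "AE x in \<mu>. x \<in> ?A \<longleftrightarrow> x \<in> {x \<in> space \<mu>. inv T x \<in> B}"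
          using AEH by eventually_elim (auto simp: sp)
      qed (use A in measurable)
      also have "\<dots> = emeasure N B"
        unfolding N_def by (subst emeasure_distr) (auto intro!: arg_cong[where f="emeasure \<mu>"])
      finally show "emeasure (distr N borel ?S) B = emeasure N B" .
    qed (simp add: N_def)
  qed
  show ?thesis
  proof (rule measure_eqI)
    fix A assume A: "A \<in> sets \<mu>"
    then have A': "A \<in> sets borel" "A \<subseteq> unit_sphere p" by (auto simp: \<mu>(2) mem_sets_sphere_space)
    have "emeasure image_unif A = emeasure N (T -` A)"
      using A by (simp add: emeasure_image_unif \<mu>(2) N)
    also have "\<dots> = emeasure \<mu> (inv T -` T -` A \<inter> space \<mu>)"
      unfolding N_def using measurable_sets[OF orth_map_props(3) A'(1)] by (subst emeasure_distr) auto
    also have "inv T -` T -` A \<inter> space \<mu> = A" using A'(2) T by (auto simp: sp)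
    finally show "emeasure \<mu> A = emeasure image_unif A" ..
  qed (simp add: \<mu>(2) sets_image_unif)
qed

lemma unif_sphere_image_unif: "unif_sphere p H = image_unif"
  unfolding unif_sphere_def
  by (rule the_equality, rule is_unif_sphere_image_unif, erule is_unif_sphere_unique)

text \<open>The interface to the definite description: everything later uses
  \<open>unif_sphere\<close> only through these facts.\<close>

lemma unif_sphere_props:
  shows "prob_space (unif_sphere p H)" "sets (unif_sphere p H) = sets (sphere_space p)"
    and "h \<in> borel_measurable borel \<Longrightarrow> (\<integral>\<^sup>+ x. h x \<partial>unif_sphere p H) = (\<integral>\<^sup>+ x. h (T x) \<partial>sphere_unif d)"
proof -
  show "prob_space (unif_sphere p H)" "sets (unif_sphere p H) = sets (sphere_space p)"
    unfolding unif_sphere_image_unif by (rule prob_space_image_unif sets_image_unif)+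
  assume [measurable]: "h \<in> borel_measurable borel"
  note [measurable] = orth_map_props(3)
  have "(\<integral>\<^sup>+ x. h x \<partial>unif_sphere p H) = (\<integral>\<^sup>+ x. h x * indicator (unit_sphere p) x \<partial>distr (sphere_unif d) borel T)"
    unfolding unif_sphere_image_unif image_unif_def by (rule nn_integral_restrict_space) simp
  also have "\<dots> = (\<integral>\<^sup>+ x. h (T x) * indicator (unit_sphere p) (T x) \<partial>sphere_unif d)"
    by (rule nn_integral_distr) simp_all
  also have "\<dots> = (\<integral>\<^sup>+ x. h (T x) \<partial>sphere_unif d)"
  proof (rule nn_integral_cong_AE)
    show "AE x in sphere_unif d. h (T x) * indicator (unit_sphere p) (T x) = h (T x)"
      using AE_T_sphere by eventually_elim simp
  qed
  finally show "(\<integral>\<^sup>+ x. h x \<partial>unif_sphere p H) = (\<integral>\<^sup>+ x. h (T x) \<partial>sphere_unif d)" .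
qed

end

subsection \<open>Averaging over random rotations\<close>

definition unitv :: "nat \<Rightarrow> nat \<Rightarrow> real" where
  "unitv i = (\<lambda>l. if l = i then 1 else 0)"

lemma dot_unitv: "i < p \<Longrightarrow> dot p (unitv i) x = x i" "i < p \<Longrightarrow> dot p x (unitv i) = x i"
  by (simp_all add: dot_def unitv_def if_distrib[of "\<lambda>u. u * _"] if_distrib[of "\<lambda>u. _ * u"] cong: if_cong)

lemma unitv_euclid: "i < p \<Longrightarrow> unitv i \<in> euclid p"
  by (simp add: euclid_def unitv_def)

lemma reflect_unitv: "i < p \<Longrightarrow> v i = 0 \<Longrightarrow> reflect p v (unitv i) = unitv i"
  by (simp add: reflect_def dot_unitv)

lemma orth_map_adjoint: "orth_map p S \<Longrightarrow> dot p t (S x) = dot p (inv S t) x"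
  using orth_map_inv[of p S] orth_map_inv_simps(2)[of p S x] by (metis orth_map_def)

lemma orth_map_fix_coord:
  assumes "orth_map p S" "S (unitv i) = unitv i" "i < p"
  shows "inv S (unitv i) = unitv i" "S x i = x i" "inv S x i = x i"
proof -
  show *: "inv S (unitv i) = unitv i" using assms by (metis orth_map_inv_simps(2))
  show "S x i = x i"
    using orth_map_adjoint[OF assms(1), of "unitv i" x] assms(3) by (simp add: * dot_unitv)
  have "dot p (unitv i) (inv S x) = dot p (S (unitv i)) (S (inv S x))"
    using assms(1) by (simp add: orth_map_def)
  then show "inv S x i = x i" using assms by (simp add: dot_unitv)
qed

definition shift :: "nat \<Rightarrow> (nat \<Rightarrow> real) \<Rightarrow> nat \<Rightarrow> real" where
  "shift j y = (\<lambda>i. if i < j then 0 else y (i - j))"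

text \<open>The uniform law on the unit vectors orthogonal to \<open>unitv 0\<close>, ...,
  \<open>unitv (j - 1)\<close>. They form the sphere of a space of dimension \<open>p - j\<close>,
  hence the index \<open>p - Suc j\<close>.\<close>

definition tail_unif :: "nat \<Rightarrow> nat \<Rightarrow> (nat \<Rightarrow> real) measure" where
  "tail_unif p j = distr (sphere_unif (p - Suc j)) borel (shift j)"

lemma measurable_shift [measurable]: "shift j \<in> borel_measurable borel"
  unfolding shift_def by (subst measurable_fun_iff) auto

lemma sets_tail_unif [measurable_cong, simp]: "sets (tail_unif p j) = sets borel"
  by (simp add: tail_unif_def)

lemma space_tail_unif [simp]: "space (tail_unif p j) = UNIV"
  by (simp add: tail_unif_def)

lemma prob_space_tail_unif: "prob_space (tail_unif p j)"
proof -
  interpret prob_space "sphere_unif (p - Suc j)" by (rule prob_space_sphere_unif)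
  show ?thesis unfolding tail_unif_def by (rule prob_space_distr) simp
qed

lemma tail_unif_0: "tail_unif (Suc d) 0 = sphere_unif d"
proof -
  have "shift 0 = (\<lambda>x. x)" by (simp add: shift_def fun_eq_iff)
  then show ?thesis by (simp add: tail_unif_def distr_id2)
qed

lemma dot_split: "j \<le> p \<Longrightarrow> dot p t x = dot j t x + dot (p - j) (\<lambda>i. t (i + j)) (\<lambda>i. x (i + j))"
  using sum.atLeastLessThan_concat[of 0 j p "\<lambda>i. t i * x i"] sum.shift_bounds_nat_ivl[of "\<lambda>i. t i * x i" 0 j "p - j"]
  by (simp add: dot_def lessThan_atLeast0)

lemma dot_shift: "j \<le> p \<Longrightarrow> dot p t (shift j y) = dot (p - j) (\<lambda>i. t (i + j)) y"
proof -
  assume "j \<le> p"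
  moreover have "dot j t (shift j y) = 0" by (simp add: dot_def shift_def)
  moreover have "(\<lambda>i. shift j y (i + j)) = y" by (simp add: shift_def)
  ultimately show ?thesis using dot_split[of j p t "shift j y"] by simp
qed

lemma AE_tail_unif:
  assumes "j < p"
  shows "AE v in tail_unif p j. v \<in> unit_sphere p \<and> (\<forall>i<j. v i = 0)"
proof -
  have 1: "Suc (p - Suc j) = p - j" using assms by simp
  have ae: "AE y in sphere_unif (p - Suc j). shift j y \<in> unit_sphere p \<and> (\<forall>i<j. shift j y i = 0)"
    using AE_sphere_unif[of "p - Suc j"] unfolding 1
  proof eventually_elim
    case (elim y)
    have "dot p (shift j y) (shift j y) = dot (p - j) y y"
      using assms by (simp add: dot_shift) (simp add: shift_def)
    moreover have "shift j y \<in> euclid p"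
      using elim by (simp add: mem_unit_sphere euclid_def shift_def)
    ultimately show ?case using elim by (simp add: mem_unit_sphere shift_def)
  qed
  show ?thesis unfolding tail_unif_def
    by (subst AE_distr_iff) (use ae in auto)
qed

text \<open>The Laplace transform of \<open>tail_unif p j\<close> depends only on the length of the
  part of \<open>t\<close> from coordinate \<open>j\<close> on. \<open>inv S\<close> preserves the
  full length and the leading \<open>j\<close> coordinates, hence also the length of that
  part.\<close>

lemma tail_unif_orth_map:
  assumes S: "orth_map p S" and j: "j < p" and fix_S: "\<And>i. i < j \<Longrightarrow> S (unitv i) = unitv i"
  shows "distr (tail_unif p j) borel S = tail_unif p j"
proof (rule measure_eqI_laplace[of _ _ p])
  have [measurable]: "S \<in> borel_measurable borel" using S by (simp add: orth_map_def)
  interpret prob_space "tail_unif p j" by (rule prob_space_tail_unif)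
  show "prob_space (distr (tail_unif p j) borel S)" by (rule prob_space_distr) simp
  show ae: "AE x in tail_unif p j. x \<in> unit_sphere p" using AE_tail_unif[OF j] by eventually_elim simp
  show "AE x in distr (tail_unif p j) borel S. x \<in> unit_sphere p"
  proof (subst AE_distr_iff)
    show "AE x in tail_unif p j. S x \<in> unit_sphere p"
      using ae by eventually_elim (rule orth_map_unit_sphere[OF S])
  qed auto
  fix t
  have 1: "Suc (p - Suc j) = p - j" using j by simp
  have L: "(LINT x|tail_unif p j. exp (dot p t x)) = (LINT y|sphere_unif (p - Suc j). exp (dot (p - j) (\<lambda>i. t (i + j)) y))" for t
    unfolding tail_unif_def using j by (subst integral_distr) (auto simp: dot_shift)
  have "dot p (inv S t) (inv S t) = dot p t t" using orth_map_inv[OF S] by (simp add: orth_map_def)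
  moreover have "dot j (inv S t) (inv S t) = dot j t t"
    unfolding dot_def by (rule sum.cong) (use orth_map_fix_coord(3)[OF S fix_S] j in auto)
  ultimately have eq: "dot (p - j) (\<lambda>i. inv S t (i + j)) (\<lambda>i. inv S t (i + j)) = dot (p - j) (\<lambda>i. t (i + j)) (\<lambda>i. t (i + j))"
    using dot_split[of j p t t] dot_split[of j p "inv S t" "inv S t"] j by simp
  have "(LINT x|distr (tail_unif p j) borel S. exp (dot p t x)) = (LINT x|tail_unif p j. exp (dot p (inv S t) x))"
    by (subst integral_distr) (auto simp: orth_map_adjoint[OF S])
  also have "\<dots> = (LINT x|tail_unif p j. exp (dot p t x))"
    unfolding L by (rule laplace_sphere_unif_radial[of "p - Suc j", unfolded 1, OF eq])
  finally show "(LINT x|distr (tail_unif p j) borel S. exp (dot p t x)) = (LINT x|tail_unif p j. exp (dot p t x))" .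
qed (auto intro: prob_space_tail_unif)

section \<open>Haar averages of functions of a sample\<close>

abbreviation tuples :: "nat \<Rightarrow> (nat \<Rightarrow> nat \<Rightarrow> real) measure" where
  "tuples n \<equiv> Pi\<^sub>M {..<n} (\<lambda>_. borel)"

definition map_tuple :: "nat \<Rightarrow> ((nat \<Rightarrow> real) \<Rightarrow> nat \<Rightarrow> real) \<Rightarrow> (nat \<Rightarrow> nat \<Rightarrow> real) \<Rightarrow> nat \<Rightarrow> nat \<Rightarrow> real" where
  "map_tuple n T x = (\<lambda>i\<in>{..<n}. T (x i))"

lemma map_tuple_map_tuple: "map_tuple n S (map_tuple n T x) = map_tuple n (\<lambda>y. S (T y)) x"
  by (auto simp: map_tuple_def)

lemma map_tuple_PiE: "(\<And>y. y \<in> A \<Longrightarrow> T y \<in> B) \<Longrightarrow> x \<in> PiE {..<n} (\<lambda>_. A) \<Longrightarrow> map_tuple n T x \<in> PiE {..<n} (\<lambda>_. B)"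
  by (auto simp: map_tuple_def)

lemma measurable_map_tuple [measurable (raw)]:
  assumes [measurable]: "(\<lambda>(z, y). T z y) \<in> borel_measurable (M \<Otimes>\<^sub>M borel)" "f \<in> M \<rightarrow>\<^sub>M tuples n"
  shows "(\<lambda>z. map_tuple n (T z) (f z)) \<in> M \<rightarrow>\<^sub>M tuples n"
proof -
  have "(\<lambda>z. T z (f z i)) \<in> borel_measurable M" if "i < n" for i
  proof -
    from that have i [measurable]: "i \<in> {..<n}" by simp
    have "(\<lambda>z. (z, f z i)) \<in> M \<rightarrow>\<^sub>M M \<Otimes>\<^sub>M borel" by measurable
    from measurable_compose[OF this assms(1)] show ?thesis by simp
  qed
  then show ?thesis unfolding map_tuple_def by (intro measurable_restrict) auto
qed

definition swap_reflect :: "nat \<Rightarrow> nat \<Rightarrow> (nat \<Rightarrow> real) \<Rightarrow> (nat \<Rightarrow> real) \<Rightarrow> nat \<Rightarrow> real" where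
  "swap_reflect p j v = reflect p (\<lambda>i. unitv j i - v i)"

lemma measurable_swap_reflect [measurable (raw)]:
  assumes [measurable]: "f \<in> borel_measurable M" "g \<in> borel_measurable M"
  shows "(\<lambda>x. swap_reflect p j (f x) (g x)) \<in> borel_measurable M"
proof -
  note assms(1)[THEN measurable_product_then_coordinatewise, measurable]
  have [measurable]: "(\<lambda>x. (\<lambda>i. unitv j i - f x i)) \<in> borel_measurable M"
    by (subst measurable_fun_iff) auto
  show ?thesis unfolding swap_reflect_def by measurable
qed

lemma orth_map_swap_reflect: "j < p \<Longrightarrow> v \<in> euclid p \<Longrightarrow> orth_map p (swap_reflect p j v)"
  unfolding swap_reflect_def by (rule orth_map_reflect) (use unitv_euclid[of j p] in \<open>auto simp: euclid_def\<close>)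

lemma swap_reflect_unitv:
  assumes "j < p" "v \<in> unit_sphere p"
  shows "swap_reflect p j v (unitv j) = v"
  unfolding swap_reflect_def
  by (rule reflect_swap) (use assms unitv_euclid in \<open>auto simp: mem_unit_sphere dot_unitv\<close>, simp add: unitv_def)

lemma swap_reflect_self:
  assumes "j < p" "v \<in> unit_sphere p"
  shows "swap_reflect p j v v = unitv j"
  using swap_reflect_unitv[OF assms] reflect_reflect by (metis swap_reflect_def)

lemma swap_reflect_fix:
  assumes "i < j" "j < p" "v i = 0"
  shows "swap_reflect p j v (unitv i) = unitv i"
  unfolding swap_reflect_def by (rule reflect_unitv) (use assms in \<open>auto simp: unitv_def\<close>)

text \<open>The subgroup algorithm: a Haar distributed rotation is the product of reflections exchanging
  \<open>unitv j\<close> with a uniform unit vector orthogonal to \<open>unitv 0, \<dots>, unitv (j - 1)\<close>.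
  \<open>haar_avg n p m\<close> averages over the reflections with \<open>p - m \<le> j < p\<close>.\<close>

primrec haar_avg :: "nat \<Rightarrow> nat \<Rightarrow> nat \<Rightarrow> ((nat \<Rightarrow> nat \<Rightarrow> real) \<Rightarrow> ennreal) \<Rightarrow> (nat \<Rightarrow> nat \<Rightarrow> real) \<Rightarrow> ennreal" where
  "haar_avg n p 0 f x = f x"
| "haar_avg n p (Suc m) f x = (\<integral>\<^sup>+ v. haar_avg n p m f (map_tuple n (swap_reflect p (p - Suc m) v) x) \<partial>tail_unif p (p - Suc m))"

lemma measurable_haar_avg:
  assumes [measurable]: "f \<in> borel_measurable (tuples n)"
  shows "haar_avg n p m f \<in> borel_measurable (tuples n)"
proof (induction m)
  case (Suc m)
  note [measurable] = Suc
  interpret prob_space "tail_unif p (p - Suc m)" by (rule prob_space_tail_unif)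
  show ?case unfolding haar_avg.simps[abs_def] by measurable
qed (simp add: assms)

text \<open>Put \<open>w = inv S v\<close>, which is distributed like \<open>v\<close>. Applying
  \<open>S\<close> and then the swap at \<open>v\<close> equals applying the swap at
  \<open>w\<close> and then a map that fixes one more basis vector, and the induction hypothesis
  absorbs that map. At \<open>m = 0\<close> every basis vector is fixed and only the identity on
  \<open>euclid p\<close> is left.\<close>

lemma haar_avg_invariant:
  assumes m: "m \<le> p" and S: "orth_map p S" and fix_S: "\<And>i. i < p - m \<Longrightarrow> S (unitv i) = unitv i"
    and f [measurable]: "f \<in> borel_measurable (tuples n)" and x: "x \<in> PiE {..<n} (\<lambda>_. euclid p)"
  shows "haar_avg n p m f (map_tuple n S x) = haar_avg n p m f x"
  using m S fix_S x
proof (induction m arbitrary: S x)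
  case 0
  have "S y = y" if "y \<in> euclid p" for y
    by (rule euclid_eqI[of _ p]) (use that 0 orth_map_euclid orth_map_fix_coord(2) in auto)
  then have "map_tuple n S x = x" using 0 by (intro ext) (auto simp: map_tuple_def PiE_iff extensional_def)
  then show ?case by simp
next
  case (Suc m)
  define j where "j = p - Suc m"
  have j: "j < p" "p - m = Suc j" using Suc.prems by (auto simp: j_def)
  note S = \<open>orth_map p S\<close>
  note [measurable] = measurable_haar_avg[OF f, of p m]
  have [measurable]: "inv S \<in> borel_measurable borel" using S by (simp add: orth_map_def)
  have inv_fix: "inv S (unitv i) = unitv i" if "i < j" for i
    using orth_map_fix_coord(1)[OF S Suc.prems(3)] that j by (simp add: j_def)
  define G where "G v = haar_avg n p m f (map_tuple n (swap_reflect p j v) x)" for v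
  have xs: "x \<in> space (tuples n)" using Suc.prems(4) by (auto simp: space_PiM)
  have G [measurable]: "G \<in> borel_measurable borel"
    unfolding G_def using xs by measurable
  have "haar_avg n p (Suc m) f (map_tuple n S x) = (\<integral>\<^sup>+ v. haar_avg n p m f (map_tuple n (\<lambda>y. swap_reflect p j v (S y)) x) \<partial>tail_unif p j)"
    by (simp add: j_def map_tuple_map_tuple)
  also have "\<dots> = (\<integral>\<^sup>+ v. G (inv S v) \<partial>tail_unif p j)"
  proof (rule nn_integral_cong_AE)
    show "AE v in tail_unif p j. haar_avg n p m f (map_tuple n (\<lambda>y. swap_reflect p j v (S y)) x) = G (inv S v)"
      using AE_tail_unif[OF j(1)]
    proof eventually_elim
      case (elim v)
      let ?w = "inv S v"
      have v: "v \<in> unit_sphere p" "v \<in> euclid p" using elim by (auto simp: mem_unit_sphere)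
      have w: "?w \<in> unit_sphere p" "?w \<in> euclid p"
        using v orth_map_unit_sphere[OF orth_map_inv[OF S]] orth_map_euclid[OF orth_map_inv[OF S]] by auto
      have w0: "?w i = 0" if "i < j" for i
        using orth_map_fix_coord(3)[OF S Suc.prems(3)] that elim j by (simp add: j_def)
      \<comment> \<open>This map sends \<open>unitv j\<close> to \<open>?w\<close>, then to
        \<open>v\<close>, then back to \<open>unitv j\<close>.\<close>
      let ?S = "\<lambda>y. swap_reflect p j v (S (swap_reflect p j ?w y))"
      have S': "orth_map p ?S"
        by (rule orth_map_compose[OF orth_map_swap_reflect[OF j(1) v(2)] orth_map_compose[OF S orth_map_swap_reflect[OF j(1) w(2)]]])
      have fixS': "?S (unitv i) = unitv i" if "i < p - m" for i
      proof (cases "i = j")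
        case True
        then show ?thesis using S by (simp add: swap_reflect_unitv[OF j(1) w(1)] swap_reflect_self[OF j(1) v(1)])
      next
        case False
        then have i: "i < j" using that j by simp
        then show ?thesis using Suc.prems(3)[of i, folded j_def] elim w0 j(1)
          by (simp add: swap_reflect_fix)
      qed
      have eq: "map_tuple n (\<lambda>y. swap_reflect p j v (S y)) x = map_tuple n ?S (map_tuple n (swap_reflect p j ?w) x)"
        unfolding map_tuple_map_tuple by (simp add: swap_reflect_def reflect_reflect)
      show ?case
        unfolding G_def eq
      proof (rule Suc.IH[OF _ S' fixS'])
        show "map_tuple n (swap_reflect p j ?w) x \<in> {..<n} \<rightarrow>\<^sub>E euclid p"
          using orth_map_euclid[OF orth_map_swap_reflect[OF j(1) w(2)]] Suc.prems(4) by (rule map_tuple_PiE)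
      qed (use Suc.prems in auto)
    qed
  qed
  also have "\<dots> = (\<integral>\<^sup>+ v. G v \<partial>distr (tail_unif p j) borel (inv S))"
    by (subst nn_integral_distr) auto
  also have "\<dots> = (\<integral>\<^sup>+ v. G v \<partial>tail_unif p j)"
    using tail_unif_orth_map[OF orth_map_inv[OF S] j(1) inv_fix] by simp
  also have "\<dots> = haar_avg n p (Suc m) f x" by (simp add: G_def j_def)
  finally show ?case .
qed

text \<open>An average over rotations is at most the worst rotation, by Fubini. The additional
  \<open>T\<close> collects the reflections already drawn, which the induction needs.\<close>

lemma nn_integral_haar_avg_le:
  assumes P: "prob_space P" and sP: "sets P = sets (tuples n)"
    and f [measurable]: "f \<in> borel_measurable (tuples n)"
    and le: "\<And>T. orth_map p T \<Longrightarrow> (\<integral>\<^sup>+ x. f (map_tuple n T x) \<partial>P) \<le> B"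
    and m: "m \<le> p" and T: "orth_map p T"
  shows "(\<integral>\<^sup>+ x. haar_avg n p m f (map_tuple n T x) \<partial>P) \<le> B"
  using m T
proof (induction m arbitrary: T)
  case (Suc m)
  define j where "j = p - Suc m"
  have j: "j < p" using Suc.prems by (auto simp: j_def)
  note [measurable] = measurable_haar_avg[OF f, of p m]
  note [measurable_cong] = sP
  have [measurable]: "T \<in> borel_measurable borel" using Suc.prems by (simp add: orth_map_def)
  interpret Q: prob_space P by fact
  interpret V: prob_space "tail_unif p j" by (rule prob_space_tail_unif)
  interpret PV: pair_prob_space P "tail_unif p j" ..
  have "(\<integral>\<^sup>+ x. haar_avg n p (Suc m) f (map_tuple n T x) \<partial>P) =
    (\<integral>\<^sup>+ x. \<integral>\<^sup>+ v. haar_avg n p m f (map_tuple n (\<lambda>y. swap_reflect p j v (T y)) x) \<partial>tail_unif p j \<partial>P)"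
    by (simp add: j_def map_tuple_map_tuple)
  also have "\<dots> = (\<integral>\<^sup>+ v. \<integral>\<^sup>+ x. haar_avg n p m f (map_tuple n (\<lambda>y. swap_reflect p j v (T y)) x) \<partial>P \<partial>tail_unif p j)"
    by (rule PV.Fubini'[symmetric]) measurable
  also have "\<dots> \<le> (\<integral>\<^sup>+ v. B \<partial>tail_unif p j)"
  proof (rule nn_integral_mono_AE)
    show "AE v in tail_unif p j. (\<integral>\<^sup>+ x. haar_avg n p m f (map_tuple n (\<lambda>y. swap_reflect p j v (T y)) x) \<partial>P) \<le> B"
      using AE_tail_unif[OF j]
    proof eventually_elim
      case (elim v)
      then have "v \<in> euclid p" by (simp add: mem_unit_sphere)
      from orth_map_compose[OF orth_map_swap_reflect[OF j this] Suc.prems(2)] show ?case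
        using Suc.prems(1) by (intro Suc.IH) auto
    qed
  qed
  also have "\<dots> = B" by (simp add: V.emeasure_space_1[simplified])
  finally show ?case .
qed (simp add: le)

text \<open>Averaging turns the two indicators of a test into the acceptance and rejection
  probabilities of a randomized test.\<close>

lemma haar_avg_add_eq_1:
  assumes [measurable]: "f \<in> borel_measurable (tuples n)" "g \<in> borel_measurable (tuples n)"
    and 1: "\<And>x. f x + g x = 1"
    and x: "x \<in> space (tuples n)"
  shows "haar_avg n p m f x + haar_avg n p m g x = 1"
  using x
proof (induction m arbitrary: x)
  case (Suc m)
  define j where "j = p - Suc m"
  note [measurable] = measurable_haar_avg[OF assms(1), of p m] measurable_haar_avg[OF assms(2), of p m] Suc.prems
  interpret V: prob_space "tail_unif p j" by (rule prob_space_tail_unif)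
  have "map_tuple n T x \<in> space (tuples n)" for T by (simp add: map_tuple_def space_PiM)
  then have eq: "haar_avg n p m f (map_tuple n T x) + haar_avg n p m g (map_tuple n T x) = 1" for T by (rule Suc.IH)
  have "haar_avg n p (Suc m) f x + haar_avg n p (Suc m) g x =
     (\<integral>\<^sup>+ v. haar_avg n p m f (map_tuple n (swap_reflect p j v) x) + haar_avg n p m g (map_tuple n (swap_reflect p j v) x) \<partial>tail_unif p j)"
    unfolding haar_avg.simps j_def[symmetric] by (rule nn_integral_add[symmetric]) measurable
  also have "\<dots> = 1" unfolding eq by (simp add: V.emeasure_space_1[simplified])
  finally show ?case .
qed (simp add: 1)

subsection \<open>Reduction to triangular form\<close>

text \<open>Column \<open>i\<close> of the triangular factor for a unit vector \<open>x\<close>,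
  once the earlier columns are triangular: the leading \<open>i\<close> coordinates stay, and the
  remaining part is replaced by its length in position \<open>i\<close>.\<close>

definition tri_col :: "nat \<Rightarrow> (nat \<Rightarrow> real) \<Rightarrow> nat \<Rightarrow> real" where
  "tri_col i x = (\<lambda>l. if l < i then x l else if l = i then sqrt (1 - dot i x x) else 0)"

lemma dot_cong: "(\<And>i. i < p \<Longrightarrow> x i = x' i) \<Longrightarrow> (\<And>i. i < p \<Longrightarrow> y i = y' i) \<Longrightarrow> dot p x y = dot p x' y'"
  unfolding dot_def by (rule sum.cong) auto

lemma measurable_tri_col [measurable]: "tri_col i \<in> borel_measurable borel"
  unfolding tri_col_def by (subst measurable_fun_iff) auto

lemma tri_col_euclid: "i < p \<Longrightarrow> tri_col i x \<in> euclid p"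
  by (auto simp: tri_col_def euclid_def)

lemma dot_le_dot: "i \<le> p \<Longrightarrow> dot i x x \<le> dot p x x"
  unfolding dot_def by (rule sum_mono2) auto

lemma tri_col_unit_sphere:
  assumes "x \<in> unit_sphere p" "i < p"
  shows "tri_col i x \<in> unit_sphere p"
proof -
  have le: "dot i x x \<le> 1" using dot_le_dot[of i p x] assms by (simp add: mem_unit_sphere)
  have "tri_col i x \<in> euclid (Suc i)" by (rule tri_col_euclid) simp
  then have "dot p (tri_col i x) (tri_col i x) = dot (Suc i) (tri_col i x) (tri_col i x)"
    by (rule dot_truncate) (use assms in simp)
  also have "\<dots> = dot i (tri_col i x) (tri_col i x) + (1 - dot i x x)"
    using le by (simp add: dot_def tri_col_def)
  also have "dot i (tri_col i x) (tri_col i x) = dot i x x"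
    by (rule dot_cong) (auto simp: tri_col_def)
  finally show ?thesis using tri_col_euclid[OF assms(2)] by (simp add: mem_unit_sphere)
qed

text \<open>Triangularization stopped after the leading \<open>i\<close> columns, the intermediate
  stage of the induction.\<close>

definition tri_map :: "nat \<Rightarrow> nat \<Rightarrow> (nat \<Rightarrow> nat \<Rightarrow> real) \<Rightarrow> nat \<Rightarrow> nat \<Rightarrow> real" where
  "tri_map n i x = (\<lambda>k\<in>{..<n}. if k < i then tri_col k (x k) else x k)"

lemma measurable_tri_map [measurable]: "tri_map n i \<in> tuples n \<rightarrow>\<^sub>M tuples n"
proof -
  have "(\<lambda>x. if k < i then tri_col k (x k) else x k) \<in> borel_measurable (tuples n)" if "k < n" for k
  proof -
    from that have k [measurable]: "k \<in> {..<n}" by simp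
    show ?thesis by measurable
  qed
  then show ?thesis unfolding tri_map_def by (intro measurable_restrict) auto
qed

text \<open>With column \<open>i\<close> frozen at \<open>y\<close>, the reflection exchanging
  \<open>y\<close> and \<open>tri_col i y\<close> does not touch the leading \<open>i\<close>
  coordinates, so the earlier triangular columns are unaffected. \<open>F\<close> does not notice
  it, and the other columns are independent of \<open>y\<close> with a law that it
  preserves.\<close>

lemma tri_map_step:
  fixes F :: "(nat \<Rightarrow> nat \<Rightarrow> real) \<Rightarrow> ennreal"
  assumes F [measurable]: "F \<in> borel_measurable (tuples n)"
    and inv: "\<And>S x. orth_map p S \<Longrightarrow> x \<in> PiE {..<n} (\<lambda>_. euclid p) \<Longrightarrow> F (map_tuple n S x) = F x"
    and dp: "Suc d \<le> p" and i: "i < n" "i \<le> d" and n: "n \<le> p"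
  shows "(\<integral>\<^sup>+ x. F (tri_map n i x) \<partial>Pi\<^sub>M {..<n} (\<lambda>_. sphere_unif d)) =
    (\<integral>\<^sup>+ x. F (tri_map n (Suc i) x) \<partial>Pi\<^sub>M {..<n} (\<lambda>_. sphere_unif d))"
proof -
  define I where "I = {..<n} - {i}"
  define q where "q = Suc d"
  have I: "finite I" "i \<notin> I" "insert i I = {..<n}" using i by (auto simp: I_def)
  interpret s: prob_space "sphere_unif d" by (rule prob_space_sphere_unif)
  interpret product_prob_space "\<lambda>_. sphere_unif d" "{..<n}" ..
  have AEI: "AE x in Pi\<^sub>M I (\<lambda>_. sphere_unif d). \<forall>k\<in>I. x k \<in> unit_sphere q"
    using I(1) AE_sphere_unif[of d] prob_space_sphere_unif
    by (intro AE_finite_allI AE_PiM_component) (auto simp: q_def)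
  have euq: "x \<in> unit_sphere q \<Longrightarrow> x \<in> euclid p" for x
    using dp by (auto simp: mem_unit_sphere euclid_def q_def)
  have upd [measurable]: "(\<lambda>x. x(i := y)) \<in> Pi\<^sub>M I (\<lambda>_. borel) \<rightarrow>\<^sub>M tuples n" for y :: "nat \<Rightarrow> real"
    by (rule measurable_fun_upd[where J=I]) (use I(3) in auto)
  have [measurable]: "tri_map n i \<in> Pi\<^sub>M {..<n} (\<lambda>_. sphere_unif d) \<rightarrow>\<^sub>M tuples n" for i
    using measurable_tri_map by (simp cong: measurable_cong_sets sets_PiM_cong)
  have split: "(\<integral>\<^sup>+ x. F (tri_map n m x) \<partial>Pi\<^sub>M {..<n} (\<lambda>_. sphere_unif d)) =
     (\<integral>\<^sup>+ y. \<integral>\<^sup>+ x. F (tri_map n m (x(i := y))) \<partial>Pi\<^sub>M I (\<lambda>_. sphere_unif d) \<partial>sphere_unif d)" for m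
    unfolding I(3)[symmetric]
    by (rule product_nn_integral_insert_rev[OF I(1,2)]) (simp add: I(3))
  show ?thesis
    unfolding split
  proof (rule nn_integral_cong_AE)
    show "AE y in sphere_unif d. (\<integral>\<^sup>+ x. F (tri_map n i (x(i := y))) \<partial>Pi\<^sub>M I (\<lambda>_. sphere_unif d)) =
       (\<integral>\<^sup>+ x. F (tri_map n (Suc i) (x(i := y))) \<partial>Pi\<^sub>M I (\<lambda>_. sphere_unif d))"
      using AE_sphere_unif[of d, folded q_def]
    proof eventually_elim
      case (elim y)
      define v where "v = (\<lambda>l. y l - tri_col i y l)"
      have v: "v \<in> euclid q" using elim tri_col_euclid[of i q y] i
        by (auto simp: v_def euclid_def q_def mem_unit_sphere)
      then have vp: "v \<in> euclid p" using dp by (auto simp: euclid_def q_def)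
      let ?S = "reflect q v"
      \<comment> \<open>Both forms are needed: invariance of \<open>F\<close> is about the ambient
        dimension \<open>p\<close>, invariance of \<open>sphere_unif d\<close> about dimension
        \<open>q\<close>. They agree because \<open>v\<close> lies in
        \<open>euclid q\<close>.\<close>
      have reflect_eq: "reflect p v = ?S"
      proof -
        have "dot p v z = dot q v z" for z
          using dot_truncate[OF v, of p z] dp by (simp add: q_def dot_commute)
        then show ?thesis by (simp add: reflect_def fun_eq_iff)
      qed
      have isoS: "orth_map p ?S" using orth_map_reflect[OF vp] unfolding reflect_eq .
      have isoq: "orth_map q ?S" by (rule orth_map_reflect[OF v])
      have Sy: "?S y = tri_col i y"
        unfolding v_def using elim tri_col_unit_sphere[OF elim, of i] i
        by (intro reflect_swap) (auto simp: mem_unit_sphere q_def)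
      have Sl: "?S z l = z l" if "l < i" for z l
        using that by (simp add: reflect_def v_def tri_col_def)
      have Sell: "?S (tri_col k z) = tri_col k z" if "k < i" for k z
      proof -
        have "dot q v (tri_col k z) = 0"
          unfolding dot_def by (rule sum.neutral) (use that in \<open>auto simp: v_def tri_col_def\<close>)
        then show ?thesis by (simp add: reflect_def)
      qed
      have ellS: "tri_col k (?S z) = tri_col k z" if "k < i" for k z
      proof -
        have "dot k (?S z) (?S z) = dot k z z" by (rule dot_cong) (use Sl that in auto)
        then show ?thesis unfolding tri_col_def using Sl that by auto
      qed
      have ptw: "F (tri_map n i (x(i := y))) = F (tri_map n (Suc i) ((\<lambda>k\<in>I. ?S (x k))(i := y)))"
        if x: "\<forall>k\<in>I. x k \<in> unit_sphere q" for x
      proof -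
        have "tri_map n i (x(i := y)) \<in> PiE {..<n} (\<lambda>_. euclid p)"
          using x euq elim n by (auto simp: tri_map_def I_def intro!: tri_col_euclid)
        from inv[OF isoS this] have "F (tri_map n i (x(i := y))) = F (map_tuple n ?S (tri_map n i (x(i := y))))" ..
        also have "map_tuple n ?S (tri_map n i (x(i := y))) = tri_map n (Suc i) ((\<lambda>k\<in>I. ?S (x k))(i := y))"
          by (auto simp: map_tuple_def tri_map_def fun_eq_iff Sy Sell ellS I_def less_Suc_eq)
        finally show ?thesis .
      qed
      have "(\<integral>\<^sup>+ x. F (tri_map n i (x(i := y))) \<partial>Pi\<^sub>M I (\<lambda>_. sphere_unif d)) =
         (\<integral>\<^sup>+ x. F (tri_map n (Suc i) ((\<lambda>k\<in>I. ?S (x k))(i := y))) \<partial>Pi\<^sub>M I (\<lambda>_. sphere_unif d))"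
        by (rule nn_integral_cong_AE) (use AEI in eventually_elim, rule ptw)
      also have "\<dots> = (\<integral>\<^sup>+ x. F (tri_map n (Suc i) ((\<lambda>k\<in>I. x k)(i := y))) * (\<Prod>k\<in>I. 1) \<partial>Pi\<^sub>M I (\<lambda>_. sphere_unif d))"
      \<comment> \<open>The reflection depends on \<open>y\<close> alone, so it can be removed from
        all the other columns at once with weights \<open>1\<close>.\<close>
      proof (rule nn_integral_PiM_swap[where K="\<lambda>_. borel" and h="\<lambda>x. F (tri_map n (Suc i) (x(i := y)))"])
        fix u :: "(nat \<Rightarrow> real) \<Rightarrow> ennreal" assume [measurable]: "u \<in> borel_measurable borel"
        have "distr (sphere_unif d) borel ?S = sphere_unif d"
          using tail_unif_orth_map[of q ?S 0] isoq by (simp add: q_def tail_unif_0)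
        then have "(\<integral>\<^sup>+ x. u x \<partial>sphere_unif d) = (\<integral>\<^sup>+ x. u x \<partial>distr (sphere_unif d) borel ?S)" by simp
        also have "\<dots> = (\<integral>\<^sup>+ x. u (?S x) \<partial>sphere_unif d)" by (subst nn_integral_distr) auto
        finally show "(\<integral>\<^sup>+ x. u (?S x) \<partial>sphere_unif d) = (\<integral>\<^sup>+ x. u x * 1 \<partial>sphere_unif d)" by simp
      next
        show "(\<lambda>x. F (tri_map n (Suc i) (x(i := y)))) \<in> borel_measurable (Pi\<^sub>M I (\<lambda>_. borel))"
          by (rule measurable_compose[OF measurable_compose[OF upd measurable_tri_map] F])
      qed (auto simp: I prob_space_sphere_unif)
      also have "\<dots> = (\<integral>\<^sup>+ x. F (tri_map n (Suc i) (x(i := y))) \<partial>Pi\<^sub>M I (\<lambda>_. sphere_unif d))"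
        by (intro nn_integral_cong) (auto simp: space_PiM PiE_iff extensional_restrict)
      finally show ?case .
    qed
  qed
qed

lemma tri_map_reduce:
  assumes F: "F \<in> borel_measurable (tuples n)"
    and inv: "\<And>S x. orth_map p S \<Longrightarrow> x \<in> PiE {..<n} (\<lambda>_. euclid p) \<Longrightarrow> F (map_tuple n S x) = F x"
    and dp: "Suc d \<le> p" and n: "n \<le> Suc d"
  shows "(\<integral>\<^sup>+ x. F x \<partial>Pi\<^sub>M {..<n} (\<lambda>_. sphere_unif d)) =
    (\<integral>\<^sup>+ x. F (\<lambda>k\<in>{..<n}. tri_col k (x k)) \<partial>Pi\<^sub>M {..<n} (\<lambda>_. sphere_unif d))"
proof -
  have "i \<le> n \<Longrightarrow> (\<integral>\<^sup>+ x. F (tri_map n 0 x) \<partial>Pi\<^sub>M {..<n} (\<lambda>_. sphere_unif d)) =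
    (\<integral>\<^sup>+ x. F (tri_map n i x) \<partial>Pi\<^sub>M {..<n} (\<lambda>_. sphere_unif d))" for i
  proof (induction i)
    case (Suc i)
    then show ?case using tri_map_step[OF F inv dp, of i] n dp by simp
  qed simp
  from this[of n] have "(\<integral>\<^sup>+ x. F (tri_map n 0 x) \<partial>Pi\<^sub>M {..<n} (\<lambda>_. sphere_unif d)) =
    (\<integral>\<^sup>+ x. F (tri_map n n x) \<partial>Pi\<^sub>M {..<n} (\<lambda>_. sphere_unif d))" by simp
  moreover have "(\<integral>\<^sup>+ x. F (tri_map n 0 x) \<partial>Pi\<^sub>M {..<n} (\<lambda>_. sphere_unif d)) = (\<integral>\<^sup>+ x. F x \<partial>Pi\<^sub>M {..<n} (\<lambda>_. sphere_unif d))"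
    by (intro nn_integral_cong) (auto simp: tri_map_def space_PiM PiE_iff extensional_restrict)
  moreover have "tri_map n n x = (\<lambda>k\<in>{..<n}. tri_col k (x k))" for x
    by (auto simp: tri_map_def)
  ultimately show ?thesis by simp
qed

subsection \<open>Likelihood ratio of the leading coordinates\<close>

text \<open>\<open>(real d - real j) / 2\<close> is the parameter of the coordinate law met after
  \<open>j\<close> coordinates have been sliced off; each slice contributes its ratio of normalizing
  constants.\<close>

definition tilt_const :: "nat \<Rightarrow> nat \<Rightarrow> nat \<Rightarrow> real" where
  "tilt_const d i r = (\<Prod>j<i. Beta (1/2) ((real d - real j) / 2) / Beta (1/2) ((real d - real j) / 2 - real r))"

definition tilt :: "nat \<Rightarrow> nat \<Rightarrow> nat \<Rightarrow> (nat \<Rightarrow> real) \<Rightarrow> real" where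
  "tilt d i r x = tilt_const d i r * inverse (1 - dot i x x) ^ r"

definition trunc_coords :: "nat \<Rightarrow> (nat \<Rightarrow> real) \<Rightarrow> nat \<Rightarrow> real" where
  "trunc_coords i x = (\<lambda>l. if l < i then x l else 0)"

lemma measurable_trunc_coords [measurable]: "trunc_coords i \<in> borel_measurable borel"
  unfolding trunc_coords_def by (subst measurable_fun_iff) auto

lemma measurable_tilt [measurable (raw)]:
  assumes [measurable]: "f \<in> borel_measurable M"
  shows "(\<lambda>x. tilt d i r (f x)) \<in> borel_measurable M"
  unfolding tilt_def by measurable

lemma tri_col_trunc_coords: "tri_col i (trunc_coords i x) = tri_col i x"
proof -
  have "dot i (trunc_coords i x) (trunc_coords i x) = dot i x x" by (rule dot_cong) (auto simp: trunc_coords_def)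
  then show ?thesis by (auto simp: tri_col_def trunc_coords_def fun_eq_iff)
qed

lemma trunc_coords_attach: "trunc_coords (Suc i) (attach s y) = attach s (trunc_coords i y)"
  by (auto simp: trunc_coords_def attach_def fun_eq_iff split: nat.splits)

lemma tilt_const_pos:
  assumes "i + 2 * r \<le> d"
  shows "tilt_const d i r > 0"
  unfolding tilt_const_def
proof (rule prod_pos)
  fix j assume "j \<in> {..<i}"
  then have "real j + 2 * real r < real d" using assms by auto
  then show "0 < Beta (1/2) ((real d - real j) / 2) / Beta (1/2) ((real d - real j) / 2 - real r)"
    by (intro divide_pos_pos Beta_pos) (auto simp: field_simps)
qed

lemma tilt_const_Suc:
  "tilt_const (Suc d) (Suc i) r =
    Beta (1/2) ((real d + 1) / 2) / Beta (1/2) ((real d + 1) / 2 - real r) * tilt_const d i r"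
  unfolding tilt_const_def by (subst prod.lessThan_Suc_shift) (simp add: algebra_simps)

text \<open>Induction by slicing: the coordinate law and the smaller sphere are tilted separately
  and their density ratios multiply to the tilt of the larger sphere.\<close>

lemma sphere_unif_tilt:
  assumes "i + 2 * r \<le> d" and [measurable]: "u \<in> borel_measurable borel"
  shows "(\<integral>\<^sup>+ x. u (trunc_coords i x) \<partial>sphere_unif (d - 2 * r)) = (\<integral>\<^sup>+ x. u (trunc_coords i x) * ennreal (tilt d i r x) \<partial>sphere_unif d)"
  using assms
proof (induction i arbitrary: d u)
  case 0
  interpret a: prob_space "sphere_unif d" by (rule prob_space_sphere_unif)
  interpret b: prob_space "sphere_unif (d - 2 * r)" by (rule prob_space_sphere_unif)
  have "trunc_coords 0 x = (\<lambda>_. 0)" for x by (simp add: trunc_coords_def)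
  then show ?case
    using a.emeasure_space_1 b.emeasure_space_1 by (simp add: tilt_def tilt_const_def dot_def)
next
  case (Suc i)
  then obtain e where d: "d = Suc e" by (cases d) auto
  note [measurable] = Suc.prems(2)
  have e: "i + 2 * r \<le> e" using Suc.prems(1) d by simp
  have de: "d - 2 * r = Suc (e - 2 * r)" using Suc.prems(1) d by simp
  define a where "a = (real e + 1) / 2"
  have a: "real r < a" "(real (e - 2 * r) + 1) / 2 = a - real r"
    using e by (auto simp: a_def field_simps of_nat_diff)
  interpret s: prob_space "sphere_unif e" by (rule prob_space_sphere_unif)
  define h where "h s = (\<integral>\<^sup>+ y. u (attach s (trunc_coords i y)) * ennreal (tilt e i r y) \<partial>sphere_unif e)" for s
  have [measurable]: "h \<in> borel_measurable borel" unfolding h_def by measurable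
  define c where "c = Beta (1/2) a / Beta (1/2) (a - real r)"
  have c: "c > 0" unfolding c_def using a(1) by (intro divide_pos_pos Beta_pos) auto
  have "(\<integral>\<^sup>+ x. u (trunc_coords (Suc i) x) \<partial>sphere_unif (d - 2 * r)) =
    (\<integral>\<^sup>+ s. \<integral>\<^sup>+ y. u (attach s (trunc_coords i y)) \<partial>sphere_unif (e - 2 * r) \<partial>coord_law (a - real r))"
    unfolding de by (subst nn_integral_sphere_unif_Suc) (auto simp: a trunc_coords_attach)
  also have "\<dots> = (\<integral>\<^sup>+ s. h s \<partial>coord_law (a - real r))"
  proof (rule nn_integral_cong)
    fix s :: real
    show "(\<integral>\<^sup>+ y. u (attach s (trunc_coords i y)) \<partial>sphere_unif (e - 2 * r)) = h s"
      unfolding h_def using Suc.IH[OF e, of "\<lambda>z. u (attach s z)"] by simp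
  qed
  also have "\<dots> = (\<integral>\<^sup>+ s. h s * ennreal (c * inverse (1 - s\<^sup>2) ^ r) \<partial>coord_law a)"
    unfolding c_def by (rule nn_integral_coord_law_tilt[OF a(1)]) simp
  also have "\<dots> = (\<integral>\<^sup>+ s. \<integral>\<^sup>+ y. u (trunc_coords (Suc i) (attach s y)) * ennreal (tilt d (Suc i) r (attach s y)) \<partial>sphere_unif e \<partial>coord_law a)"
  proof (rule nn_integral_cong_AE)
    show "AE s in coord_law a. h s * ennreal (c * inverse (1 - s\<^sup>2) ^ r) =
      (\<integral>\<^sup>+ y. u (trunc_coords (Suc i) (attach s y)) * ennreal (tilt d (Suc i) r (attach s y)) \<partial>sphere_unif e)"
      using AE_coord_law
    proof eventually_elim
      case (elim s)
      then have p: "0 < 1 - s\<^sup>2" by (simp add: abs_square_less_1 abs_less_iff)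
      \<comment> \<open>The exponent \<open>r\<close> is the same for every slice because
        \<open>1 - |x|^2\<close> factors as \<open>(1 - s^2) * (1 - |y|^2)\<close> for
        \<open>x = attach s y\<close>.\<close>
      have t: "tilt d (Suc i) r (attach s y) = (c * inverse (1 - s\<^sup>2) ^ r) * tilt e i r y" for y
      proof -
        have "1 - dot (Suc i) (attach s y) (attach s y) = (1 - s\<^sup>2) * (1 - dot i y y)"
          using dot_attach_self[OF elim, of i y] by (simp add: algebra_simps)
        then show ?thesis
          by (simp add: tilt_def d tilt_const_Suc a_def[symmetric] c_def[symmetric] power_mult_distrib mult_ac)
      qed
      have "h s * ennreal (c * inverse (1 - s\<^sup>2) ^ r) =
        (\<integral>\<^sup>+ y. u (attach s (trunc_coords i y)) * ennreal (tilt e i r y) * ennreal (c * inverse (1 - s\<^sup>2) ^ r) \<partial>sphere_unif e)"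
        unfolding h_def by (rule nn_integral_multc[symmetric]) measurable
      also have "\<dots> = (\<integral>\<^sup>+ y. u (trunc_coords (Suc i) (attach s y)) * ennreal (tilt d (Suc i) r (attach s y)) \<partial>sphere_unif e)"
      proof (intro nn_integral_cong)
        fix y
        have "ennreal (tilt d (Suc i) r (attach s y)) = ennreal (c * inverse (1 - s\<^sup>2) ^ r) * ennreal (tilt e i r y)"
          unfolding t by (rule ennreal_mult') (use p c in simp)
        then show "u (attach s (trunc_coords i y)) * ennreal (tilt e i r y) * ennreal (c * inverse (1 - s\<^sup>2) ^ r) =
          u (trunc_coords (Suc i) (attach s y)) * ennreal (tilt d (Suc i) r (attach s y))"
          unfolding trunc_coords_attach by (simp only: mult_ac)
      qed
      finally show ?case .
    qed
  qed
  also have "\<dots> = (\<integral>\<^sup>+ x. u (trunc_coords (Suc i) x) * ennreal (tilt d (Suc i) r x) \<partial>sphere_unif d)"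
    unfolding d by (subst nn_integral_sphere_unif_Suc) (auto simp: a_def)
  finally show ?case .
qed

lemma tilt_integral_1:
  assumes "i + 2 * r \<le> d"
  shows "(\<integral>\<^sup>+ x. ennreal (tilt d i r x) \<partial>sphere_unif d) = 1"
proof -
  interpret prob_space "sphere_unif (d - 2 * r)" by (rule prob_space_sphere_unif)
  show ?thesis using sphere_unif_tilt[OF assms, of "\<lambda>_. 1"] emeasure_space_1 by simp
qed

text \<open>Up to constants the square of the tilt by \<open>r\<close> is the tilt by
  \<open>2 * r\<close>, whose integral is \<open>1\<close>; this is where \<open>4 * r\<close>
  dimensions must be available.\<close>

lemma tilt_second_moment:
  assumes i: "i + 4 * r \<le> d"
  shows "(\<integral>\<^sup>+ x. (ennreal (tilt d i r x))\<^sup>2 \<partial>sphere_unif d) \<le> ennreal ((tilt_const d i r)\<^sup>2 / tilt_const d i (2 * r))"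
proof -
  have p: "tilt_const d i r > 0" "tilt_const d i (2 * r) > 0" using i by (auto intro!: tilt_const_pos)
  have "(ennreal (tilt d i r x))\<^sup>2 \<le> ennreal ((tilt_const d i r)\<^sup>2 / tilt_const d i (2 * r)) * ennreal (tilt d i (2 * r) x)" for x
  proof -
    \<comment> \<open>Only an inequality holds here: outside the unit ball the tilt can be negative,
      and \<open>ennreal\<close> then sends it to \<open>0\<close>.\<close>
    have "(ennreal (tilt d i r x))\<^sup>2 \<le> ennreal ((tilt d i r x)\<^sup>2)"
      by (cases "tilt d i r x \<ge> 0") (auto simp: ennreal_power ennreal_neg)
    also have "(tilt d i r x)\<^sup>2 = (tilt_const d i r)\<^sup>2 / tilt_const d i (2 * r) * tilt d i (2 * r) x"
      using p by (simp add: tilt_def power_mult_distrib power_even_eq)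
    finally show ?thesis by (subst (asm) ennreal_mult') (use p in auto)
  qed
  then have "(\<integral>\<^sup>+ x. (ennreal (tilt d i r x))\<^sup>2 \<partial>sphere_unif d) \<le>
     (\<integral>\<^sup>+ x. ennreal ((tilt_const d i r)\<^sup>2 / tilt_const d i (2 * r)) * ennreal (tilt d i (2 * r) x) \<partial>sphere_unif d)"
    by (intro nn_integral_mono)
  also have "\<dots> = ennreal ((tilt_const d i r)\<^sup>2 / tilt_const d i (2 * r))"
    using i by (subst nn_integral_cmult) (auto simp: tilt_integral_1)
  finally show ?thesis .
qed

text \<open>Repeated use of the recurrence of the Beta function in its second argument; the integer
  shift makes the product finite.\<close>

lemma Beta_half_ratio:
  fixes a :: real
  assumes "a > real r"
  shows "Beta (1/2) a / Beta (1/2) (a - real r) = (\<Prod>t<r. (a - real t - 1) / (a - real t - 1/2))"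
  using assms
proof (induction r arbitrary: a)
  case 0
  then show ?case using Beta_pos[of "1/2" a] by simp
next
  case (Suc r)
  have p: "Beta (1/2) (a - 1) > 0" "Beta (1/2) (a - 1 - real r) > 0" using Suc.prems by (auto intro!: Beta_pos)
  have "a - 1 \<notin> \<int>\<^sub>\<le>\<^sub>0" using Suc.prems by (auto elim!: nonpos_Ints_cases)
  then have "(1/2 + (a - 1)) * Beta (1/2) (a - 1 + 1) = (a - 1) * Beta (1/2) (a - 1)"
    by (rule Beta_plus1_right)
  then have "Beta (1/2) a = (a - 1) / (a - 1/2) * Beta (1/2) (a - 1)"
    using Suc.prems by (simp add: field_simps)
  then have "Beta (1/2) a / Beta (1/2) (a - real (Suc r)) =
     (a - 1) / (a - 1/2) * (Beta (1/2) (a - 1) / Beta (1/2) (a - 1 - real r))"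
    by (simp add: algebra_simps)
  also have "\<dots> = (a - 1) / (a - 1/2) * (\<Prod>t<r. (a - 1 - real t - 1) / (a - 1 - real t - 1/2))"
    using Suc.prems by (subst Suc.IH) auto
  also have "\<dots> = (\<Prod>t<Suc r. (a - real t - 1) / (a - real t - 1/2))"
    by (subst prod.lessThan_Suc_shift) (simp add: algebra_simps)
  finally show ?case .
qed

text \<open>A multiplicative second difference over the points \<open>a\<close>,
  \<open>a - r\<close> and \<open>a - 2 * r\<close>. Pairing the factors of the two first
  differences cancels the leading effect, and each of the \<open>r\<close> quotients exceeds
  \<open>1\<close> by at most \<open>r / (2 * b^2)\<close>, where
  \<open>b = a - 2 * r\<close>.\<close>

lemma Beta_second_difference:
  fixes a :: real
  assumes a: "a > 2 * real r"
  shows "Beta (1/2) a * Beta (1/2) (a - 2 * real r) / (Beta (1/2) (a - real r))\<^sup>2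
    \<le> exp ((real r)\<^sup>2 / (2 * (a - 2 * real r)\<^sup>2))"
proof -
  define b where "b = a - 2 * real r"
  have b: "b > 0" using a by (simp add: b_def)
  have B: "Beta (1/2) a > 0" "Beta (1/2) (a - real r) > 0" "Beta (1/2) (a - 2 * real r) > 0"
    using a by (auto intro!: Beta_pos)
  have f: "((a - real t - 1) / (a - real t - 1/2)) / ((a - real r - real t - 1) / (a - real r - real t - 1/2))
     \<le> exp (real r / (2 * b\<^sup>2))"
    and f0: "0 < (a - real t - 1) / (a - real t - 1/2)"
    and f1: "0 < (a - real r - real t - 1) / (a - real r - real t - 1/2)" if "t < r" for t
  proof -
    \<comment> \<open>The numerator of the lower factor. It is at least \<open>b\<close> because
      \<open>t + 1\<close> is at most \<open>r\<close>.\<close>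
    define c where "c = a - real r - real t - 1"
    have rt: "real t + 1 \<le> real r" using that by simp
    have c: "c \<ge> b" using rt by (simp add: c_def b_def)
    then have c0: "c > 0" using b by simp
    have e: "a - real t - 1 = c + real r" "a - real t - 1/2 = c + real r + 1/2"
      "a - real r - real t - 1 = c" "a - real r - real t - 1/2 = c + 1/2"
      by (auto simp: c_def)
    show "0 < (a - real t - 1) / (a - real t - 1/2)" "0 < (a - real r - real t - 1) / (a - real r - real t - 1/2)"
      unfolding e using c0 by auto
    have "((c + real r) / (c + real r + 1/2)) / (c / (c + 1/2)) = 1 + (real r / 2) / ((c + real r + 1/2) * c)"
    proof -
      have "(c + real r) * (c + 1/2) = (c + real r + 1/2) * c + real r / 2" by (simp add: algebra_simps)
      then have "(c + real r) * (c + 1/2) / ((c + real r + 1/2) * c) = 1 + (real r / 2) / ((c + real r + 1/2) * c)"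
        using c0 by (simp only: add_divide_distrib) simp
      then show ?thesis by simp
    qed
    also have "\<dots> \<le> 1 + (real r / 2) / (b * b)"
      using c b c0 by (intro add_left_mono divide_left_mono mult_mono) auto
    also have "\<dots> \<le> exp ((real r / 2) / (b * b))" by (rule exp_ge_add_one_self)
    finally show "((a - real t - 1) / (a - real t - 1/2)) / ((a - real r - real t - 1) / (a - real r - real t - 1/2))
     \<le> exp (real r / (2 * b\<^sup>2))"
      unfolding e by (simp add: power2_eq_square)
  qed
  have 1: "Beta (1/2) a / Beta (1/2) (a - real r) = (\<Prod>t<r. (a - real t - 1) / (a - real t - 1/2))"
    by (rule Beta_half_ratio) (use a in simp)
  have 2: "Beta (1/2) (a - real r) / Beta (1/2) (a - 2 * real r) = (\<Prod>t<r. (a - real r - real t - 1) / (a - real r - real t - 1/2))"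
    using Beta_half_ratio[of r "a - real r"] a by (simp add: algebra_simps)
  have "Beta (1/2) a * Beta (1/2) (a - 2 * real r) / (Beta (1/2) (a - real r))\<^sup>2 =
     (Beta (1/2) a / Beta (1/2) (a - real r)) / (Beta (1/2) (a - real r) / Beta (1/2) (a - 2 * real r))"
    using B by (simp add: power2_eq_square field_simps)
  also have "\<dots> = (\<Prod>t<r. ((a - real t - 1) / (a - real t - 1/2)) / ((a - real r - real t - 1) / (a - real r - real t - 1/2)))"
    unfolding 1 2 by (rule prod_dividef[symmetric])
  also have "\<dots> \<le> (\<Prod>t<r. exp (real r / (2 * b\<^sup>2)))"
    by (intro prod_mono conjI divide_nonneg_nonneg less_imp_le[OF f0] less_imp_le[OF f1] f) simp_all
  also have "\<dots> = exp ((real r)\<^sup>2 / (2 * b\<^sup>2))"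
    by (simp add: exp_of_nat_mult[symmetric] power2_eq_square)
  finally show ?thesis by (simp add: b_def)
qed

text \<open>One second difference for each of the \<open>i\<close> coordinates; \<open>b\<close> is
  a common lower bound for all the shifted parameters \<open>a - 2 * r\<close>.\<close>

lemma tilt_const_ratio:
  assumes b: "b > 0" and bd: "2 * b + real i + 4 * real r \<le> real d"
  shows "(tilt_const d i r)\<^sup>2 / tilt_const d i (2 * r) \<le> exp (real i * ((real r)\<^sup>2 / (2 * b\<^sup>2)))"
proof -
  have "(tilt_const d i r)\<^sup>2 / tilt_const d i (2 * r) =
    (\<Prod>j<i. (Beta (1/2) ((real d - real j) / 2) / Beta (1/2) ((real d - real j) / 2 - real r))\<^sup>2 /
      (Beta (1/2) ((real d - real j) / 2) / Beta (1/2) ((real d - real j) / 2 - real (2 * r))))"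
    unfolding tilt_const_def by (simp only: prod_dividef power_divide prod_power_distrib)
  also have "\<dots> \<le> (\<Prod>j<i. exp ((real r)\<^sup>2 / (2 * b\<^sup>2)))"
  proof (rule prod_mono, safe)
    fix j assume "j < i"
    define a where "a = (real d - real j) / 2"
    have a: "b \<le> a - 2 * real r" using bd \<open>j < i\<close> by (simp add: a_def field_simps)
    have B: "Beta (1/2) a > 0" "Beta (1/2) (a - real r) > 0" "Beta (1/2) (a - 2 * real r) > 0"
      using a b by (auto intro!: Beta_pos)
    have eq: "(Beta (1/2) a / Beta (1/2) (a - real r))\<^sup>2 / (Beta (1/2) a / Beta (1/2) (a - real (2 * r))) =
      Beta (1/2) a * Beta (1/2) (a - 2 * real r) / (Beta (1/2) (a - real r))\<^sup>2"
      using B by (simp add: power2_eq_square field_simps)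
    have "Beta (1/2) a * Beta (1/2) (a - 2 * real r) / (Beta (1/2) (a - real r))\<^sup>2 \<le> exp ((real r)\<^sup>2 / (2 * (a - 2 * real r)\<^sup>2))"
      by (rule Beta_second_difference) (use a b in simp)
    also have "\<dots> \<le> exp ((real r)\<^sup>2 / (2 * b\<^sup>2))"
      using a b by (auto intro!: divide_left_mono mult_mono power_mono mult_pos_pos)
    finally show "(Beta (1/2) ((real d - real j) / 2) / Beta (1/2) ((real d - real j) / 2 - real r))\<^sup>2 /
      (Beta (1/2) ((real d - real j) / 2) / Beta (1/2) ((real d - real j) / 2 - real (2 * r))) \<le> exp ((real r)\<^sup>2 / (2 * b\<^sup>2))"
      unfolding a_def[symmetric] eq .
    show "0 \<le> (Beta (1/2) ((real d - real j) / 2) / Beta (1/2) ((real d - real j) / 2 - real r))\<^sup>2 /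
      (Beta (1/2) ((real d - real j) / 2) / Beta (1/2) ((real d - real j) / 2 - real (2 * r)))"
      unfolding a_def[symmetric] eq using B by auto
  qed
  also have "\<dots> = exp (real i * ((real r)\<^sup>2 / (2 * b\<^sup>2)))"
    unfolding exp_of_nat_mult by simp
  finally show ?thesis .
qed

subsection \<open>The testing bound\<close>

text \<open>Tests are measurable on the sphere only, whereas the integrals run over all sequences.
  Points off the sphere are sent to an arbitrary point of it, so that every test extends to a Borel
  function of the sample.\<close>

definition into_sphere :: "nat \<Rightarrow> (nat \<Rightarrow> real) \<Rightarrow> nat \<Rightarrow> real" where
  "into_sphere p x = (if x \<in> unit_sphere p then x else unitv 0)"

lemma measurable_into_sphere:
  assumes "0 < p"
  shows "into_sphere p \<in> borel \<rightarrow>\<^sub>M sphere_space p"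
  unfolding sphere_space_def
proof (rule measurable_restrict_space2)
  show "into_sphere p \<in> space borel \<rightarrow> unit_sphere p"
    using assms by (auto simp: into_sphere_def mem_unit_sphere unitv_euclid dot_unitv) (auto simp: unitv_def)
  show "into_sphere p \<in> borel_measurable borel" unfolding into_sphere_def by measurable
qed

definition verdict :: "nat \<Rightarrow> nat \<Rightarrow> ((nat \<Rightarrow> nat \<Rightarrow> real) \<Rightarrow> nat) \<Rightarrow> nat \<Rightarrow> (nat \<Rightarrow> nat \<Rightarrow> real) \<Rightarrow> ennreal" where
  "verdict n p \<phi> b x = indicator {b} (\<phi> (\<lambda>i\<in>{..<n}. into_sphere p (x i)))"

lemma measurable_verdict:
  assumes \<phi>: "\<phi> \<in> tests n p" and p: "0 < p"
  shows "verdict n p \<phi> b \<in> borel_measurable (tuples n)"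
proof -
  note [measurable] = measurable_into_sphere[OF p]
  have [measurable]: "\<phi> \<in> Pi\<^sub>M {..<n} (\<lambda>_. sphere_space p) \<rightarrow>\<^sub>M count_space {0, 1}"
    using \<phi> by (simp add: tests_def)
  have "(\<lambda>x. \<phi> (\<lambda>i\<in>{..<n}. into_sphere p (x i))) \<in> tuples n \<rightarrow>\<^sub>M count_space {0, 1}"
    by measurable
  then show ?thesis
    unfolding verdict_def[abs_def] by (rule measurable_compose) simp
qed

lemma verdict_add:
  assumes \<phi>: "\<phi> \<in> tests n p" and p: "0 < p"
  shows "verdict n p \<phi> 1 x + verdict n p \<phi> 0 x = 1"
proof -
  have "into_sphere p y \<in> unit_sphere p" for y
    using measurable_space[OF measurable_into_sphere[OF p], of y] by (simp add: space_sphere_space)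
  then have "(\<lambda>i\<in>{..<n}. into_sphere p (x i)) \<in> space (Pi\<^sub>M {..<n} (\<lambda>_. sphere_space p))"
    by (simp add: space_PiM space_sphere_space)
  then have "\<phi> (\<lambda>i\<in>{..<n}. into_sphere p (x i)) \<in> {0, 1}"
    using measurable_space[of \<phi>] \<phi> by (fastforce simp: tests_def)
  then show ?thesis by (auto simp: verdict_def)
qed

text \<open>The subspace moves from the law of the sample into the argument of the test, where it
  can be averaged over.\<close>

lemma test_prob_unif_sphere:
  assumes \<phi>: "\<phi> \<in> tests n p" and T: "orth_map p T" and e: "Suc e \<le> p"
  shows "test_prob n (unif_sphere p (T ` euclid (Suc e))) \<phi> b =
    (\<integral>\<^sup>+ x. verdict n p \<phi> b (map_tuple n T x) \<partial>Pi\<^sub>M {..<n} (\<lambda>_. sphere_unif e))"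
proof -
  define \<mu> where "\<mu> = unif_sphere p (T ` euclid (Suc e))"
  note \<mu> = unif_sphere_props[OF T e refl, folded \<mu>_def]
  have p: "0 < p" using e by simp
  have space_\<mu>: "space \<mu> = unit_sphere p"
    using sets_eq_imp_space_eq[OF \<mu>(2)] by (simp add: space_sphere_space)
  have sets_PiM: "sets (Pi\<^sub>M {..<n} (\<lambda>_. \<mu>)) = sets (Pi\<^sub>M {..<n} (\<lambda>_. sphere_space p))"
    by (rule sets_PiM_cong) (auto simp: \<mu>(2))
  have \<phi>m [measurable]: "\<phi> \<in> Pi\<^sub>M {..<n} (\<lambda>_. \<mu>) \<rightarrow>\<^sub>M count_space {0, 1}"
    using \<phi> unfolding tests_def measurable_cong_sets[OF sets_PiM refl] by simp
  have set: "{X \<in> space (Pi\<^sub>M {..<n} (\<lambda>_. \<mu>)). \<phi> X = b} \<in> sets (Pi\<^sub>M {..<n} (\<lambda>_. \<mu>))"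
  proof -
    have "{X \<in> space (Pi\<^sub>M {..<n} (\<lambda>_. \<mu>)). \<phi> X = b} = \<phi> -` ({b} \<inter> {0, 1}) \<inter> space (Pi\<^sub>M {..<n} (\<lambda>_. \<mu>))"
      using measurable_space[OF \<phi>m] by auto
    also have "\<dots> \<in> sets (Pi\<^sub>M {..<n} (\<lambda>_. \<mu>))" by (rule measurable_sets[OF \<phi>m]) simp
    finally show ?thesis .
  qed
  have "test_prob n \<mu> \<phi> b = (\<integral>\<^sup>+ X. indicator {X \<in> space (Pi\<^sub>M {..<n} (\<lambda>_. \<mu>)). \<phi> X = b} X \<partial>Pi\<^sub>M {..<n} (\<lambda>_. \<mu>))"
    unfolding test_prob_def using set by (rule nn_integral_indicator[symmetric])
  also have "\<dots> = (\<integral>\<^sup>+ X. verdict n p \<phi> b (\<lambda>i\<in>{..<n}. X i) \<partial>Pi\<^sub>M {..<n} (\<lambda>_. \<mu>))"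
  proof (rule nn_integral_cong)
    fix X assume X: "X \<in> space (Pi\<^sub>M {..<n} (\<lambda>_. \<mu>))"
    then have "(\<lambda>i\<in>{..<n}. into_sphere p ((\<lambda>i\<in>{..<n}. X i) i)) = X"
      by (auto simp: space_PiM space_\<mu> into_sphere_def PiE_iff extensional_def fun_eq_iff)
    then show "indicator {X \<in> space (Pi\<^sub>M {..<n} (\<lambda>_. \<mu>)). \<phi> X = b} X = verdict n p \<phi> b (\<lambda>i\<in>{..<n}. X i)"
      using X unfolding verdict_def by (simp split: split_indicator)
  qed
  also have "\<dots> = (\<integral>\<^sup>+ x. verdict n p \<phi> b (\<lambda>i\<in>{..<n}. T (x i)) * (\<Prod>i\<in>{..<n}. 1) \<partial>Pi\<^sub>M {..<n} (\<lambda>_. sphere_unif e))"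
  proof (rule nn_integral_PiM_swap[where K="\<lambda>_. borel" and h="verdict n p \<phi> b" and M="\<lambda>_. \<mu>"
        and N="\<lambda>_. sphere_unif e" and g="\<lambda>_ x. x" and g'="\<lambda>_. T" and w="\<lambda>_ _. 1"])
    show "(\<lambda>x. x) \<in> \<mu> \<rightarrow>\<^sub>M borel"
      unfolding measurable_cong_sets[OF \<mu>(2) refl] sphere_space_def
      by (rule measurable_restrict_space1) simp
    show "T \<in> sphere_unif e \<rightarrow>\<^sub>M borel"
      using T unfolding measurable_cong_sets[OF sets_sphere_unif refl] by (simp add: orth_map_def)
  qed (use \<mu> measurable_verdict[OF \<phi> p] prob_space_sphere_unif in auto)
  finally show ?thesis by (simp add: \<mu>_def map_tuple_def)
qed

text \<open>With \<open>G = 1 - F\<close> the difference of the two sides is \<open>z\<^sup>2 + G z + 1/4\<close> for \<open>z = W - 1\<close>.\<close>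

lemma chi_square_pointwise:
  fixes F G W :: ennreal
  assumes FG: "F + G = 1" and W: "W < \<top>"
  shows "1 + 2 * W \<le> F + G * W + W\<^sup>2 + ennreal (5/4)"
proof -
  have fin: "F \<noteq> \<top>" "G \<noteq> \<top>" "W \<noteq> \<top>" using FG W by auto
  obtain f where f: "F = ennreal f" "0 \<le> f" using fin(1) by (cases F) auto
  obtain g where g: "G = ennreal g" "0 \<le> g" using fin(2) by (cases G) auto
  obtain w where w: "W = ennreal w" "0 \<le> w" using fin(3) by (cases W) auto
  have fg: "f = 1 - g" "g \<le> 1" using FG f g by (auto simp: ennreal_plus[symmetric] simp del: ennreal_plus)
  have "g * (w - 1) + (w - 1)\<^sup>2 + 1/4 \<ge> 0"
  proof -
    have "0 \<le> (w - 1 + g / 2)\<^sup>2" by simp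
    moreover have "g\<^sup>2 \<le> 1" using fg g by (simp add: abs_square_le_1)
    ultimately show ?thesis by (simp add: power2_eq_square algebra_simps)
  qed
  then have "1 + 2 * w \<le> f + g * w + w\<^sup>2 + 5/4"
    unfolding fg(1) by (simp add: power2_eq_square algebra_simps)
  then have "ennreal (1 + 2 * w) \<le> ennreal (f + g * w + w\<^sup>2 + 5/4)" by (rule ennreal_leI)
  also have "ennreal (1 + 2 * w) = 1 + 2 * W"
    using w by (simp add: ennreal_mult')
  also have "ennreal (f + g * w + w\<^sup>2 + 5/4) = F + G * W + W\<^sup>2 + ennreal (5/4)"
    using f g w by (simp add: ennreal_mult' ennreal_power)
  finally show ?thesis .
qed

text \<open>The integrals of the averaged verdicts \<open>A 1\<close> and \<open>A 0\<close> are
  lower bounds for the two errors. Being rotation invariant, these verdicts may be evaluated on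
  triangular samples, whose columns are independent under both laws with likelihood ratio
  \<open>W\<close>. Everything becomes one integral over the null sample. \<open>B\<close> stands
  for the supremum, of which only the rotated copies of one coordinate subspace are used.\<close>

lemma testing_lower_bound:
  assumes \<phi>: "\<phi> \<in> tests n p" and p: "p = Suc d" and n: "n + 4 * r \<le> d"
    and b: "b > 0" "2 * b + real n + 4 * real r \<le> real d" "(real n)\<^sup>2 * ((real r)\<^sup>2 / (2 * b\<^sup>2)) \<le> 1 / 4"
    and B: "\<And>T. orth_map p T \<Longrightarrow> test_prob n (unif_sphere p (T ` euclid (p - 2 * r))) \<phi> 0 \<le> B"
  shows "1 / 4 \<le> test_prob n (null_dist p) \<phi> 1 + B"
proof -
  define P0 where "P0 = test_prob n (null_dist p) \<phi> 1"
  define e where "e = d - 2 * r"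
  have e: "Suc e = p - 2 * r" "Suc e \<le> p" "n \<le> Suc e" using n p by (auto simp: e_def)
  have p0: "0 < p" using p by simp
  have dp: "Suc d \<le> p" using p by simp
  let ?Pd = "Pi\<^sub>M {..<n} (\<lambda>_. sphere_unif d)" and ?Pe = "Pi\<^sub>M {..<n} (\<lambda>_. sphere_unif e)"
  have prob: "prob_space ?Pd" "prob_space ?Pe"
    by (auto intro!: prob_space_PiM prob_space_sphere_unif)
  have sets_P: "sets ?Pd = sets (tuples n)" "sets ?Pe = sets (tuples n)"
    by (auto intro!: sets_PiM_cong)
  interpret Pd: prob_space ?Pd by (rule prob)
  interpret product_sigma_finite "\<lambda>_. sphere_unif d"
    by (rule product_sigma_finite.intro) (simp add: prob_space_sphere_unif prob_space_imp_sigma_finite)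
  define A where "A b = haar_avg n p p (verdict n p \<phi> b)" for b
  note vm = measurable_verdict[OF \<phi> p0]
  have Am [measurable]: "A b \<in> borel_measurable (tuples n)" for b
    unfolding A_def by (rule measurable_haar_avg[OF vm])
  have map_tuple_id: "map_tuple n (\<lambda>x. x) x = x" if "x \<in> space (tuples n)" for x
    using that by (auto simp: map_tuple_def space_PiM PiE_iff extensional_restrict)
  have inv: "A b (map_tuple n S x) = A b x" if "orth_map p S" "x \<in> PiE {..<n} (\<lambda>_. euclid p)" for S x b
    unfolding A_def by (rule haar_avg_invariant[OF _ that(1) _ vm that(2)]) auto
  have null: "(\<integral>\<^sup>+ x. A 1 x \<partial>?Pd) \<le> P0"
  proof -
    have "(\<integral>\<^sup>+ x. haar_avg n p p (verdict n p \<phi> 1) (map_tuple n (\<lambda>x. x) x) \<partial>?Pd) \<le> P0"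
    proof (rule nn_integral_haar_avg_le[OF prob(1) sets_P(1) vm])
      fix T assume T: "orth_map p T"
      \<comment> \<open>Every rotation maps the full space to itself, so averaging leaves the null
        law unchanged.\<close>
      then have "T ` euclid (Suc d) = euclid p" by (simp add: orth_map_def p)
      then show "(\<integral>\<^sup>+ x. verdict n p \<phi> 1 (map_tuple n T x) \<partial>?Pd) \<le> P0"
        using test_prob_unif_sphere[OF \<phi> T dp, of 1] by (simp add: P0_def null_dist_def)
    qed (auto intro: orth_map_id)
    also have "(\<integral>\<^sup>+ x. haar_avg n p p (verdict n p \<phi> 1) (map_tuple n (\<lambda>x. x) x) \<partial>?Pd) = (\<integral>\<^sup>+ x. A 1 x \<partial>?Pd)"
      by (intro nn_integral_cong) (simp add: map_tuple_id A_def sets_eq_imp_space_eq[OF sets_P(1)])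
    finally show ?thesis .
  qed
  have alt: "(\<integral>\<^sup>+ x. A 0 x \<partial>?Pe) \<le> B"
  proof -
    have "(\<integral>\<^sup>+ x. haar_avg n p p (verdict n p \<phi> 0) (map_tuple n (\<lambda>x. x) x) \<partial>?Pe) \<le> B"
    proof (rule nn_integral_haar_avg_le[OF prob(2) sets_P(2) vm])
      fix T assume T: "orth_map p T"
      show "(\<integral>\<^sup>+ x. verdict n p \<phi> 0 (map_tuple n T x) \<partial>?Pe) \<le> B"
        using B[OF T] test_prob_unif_sphere[OF \<phi> T e(2), of 0] by (simp add: e(1))
    qed (auto intro: orth_map_id)
    also have "(\<integral>\<^sup>+ x. haar_avg n p p (verdict n p \<phi> 0) (map_tuple n (\<lambda>x. x) x) \<partial>?Pe) = (\<integral>\<^sup>+ x. A 0 x \<partial>?Pe)"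
      by (intro nn_integral_cong) (simp add: map_tuple_id A_def sets_eq_imp_space_eq[OF sets_P(2)])
    finally show ?thesis .
  qed
  define E where "E x = (\<lambda>k\<in>{..<n}. tri_col k (x k))" for x :: "nat \<Rightarrow> nat \<Rightarrow> real"
  define w where "w i x = ennreal (tilt d i r x)" for i and x :: "nat \<Rightarrow> real"
  define W where "W x = (\<Prod>i\<in>{..<n}. w i (x i))" for x :: "nat \<Rightarrow> nat \<Rightarrow> real"
  have Em: "E \<in> tuples n \<rightarrow>\<^sub>M tuples n"
    using measurable_tri_map[of n n] unfolding E_def tri_map_def by (simp cong: restrict_cong)
  have AEm [measurable]: "(\<lambda>x. A b (E x)) \<in> borel_measurable ?Pd" for b
    using measurable_compose[OF Em Am] by (simp cong: measurable_cong_sets add: sets_P)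
  have wm [measurable]: "w i \<in> borel_measurable borel" for i unfolding w_def by measurable
  have Wm [measurable]: "W \<in> borel_measurable ?Pd" unfolding W_def by measurable
  have null': "(\<integral>\<^sup>+ x. A 1 (E x) \<partial>?Pd) \<le> P0"
  proof -
    have "(\<integral>\<^sup>+ x. A 1 x \<partial>?Pd) = (\<integral>\<^sup>+ x. A 1 (E x) \<partial>?Pd)"
      unfolding E_def by (rule tri_map_reduce[OF Am inv dp]) (use n in auto)
    then show ?thesis using null by simp
  qed
  have alt': "(\<integral>\<^sup>+ x. A 0 (E x) * W x \<partial>?Pd) \<le> B"
  proof -
    have "(\<integral>\<^sup>+ x. A 0 x \<partial>?Pe) = (\<integral>\<^sup>+ x. A 0 (E x) \<partial>?Pe)"
      unfolding E_def by (rule tri_map_reduce[OF Am inv e(2,3)])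
    also have "\<dots> = (\<integral>\<^sup>+ x. A 0 (E x) * W x \<partial>?Pd)"
      unfolding E_def W_def
    proof (rule nn_integral_PiM_swap[where K="\<lambda>_. borel" and h="A 0" and M="\<lambda>_. sphere_unif e"
          and N="\<lambda>_. sphere_unif d" and g=tri_col and g'=tri_col and w=w])
      fix i and u :: "(nat \<Rightarrow> real) \<Rightarrow> ennreal"
      assume i: "i \<in> {..<n}" and [measurable]: "u \<in> borel_measurable borel"
      \<comment> \<open>\<open>tri_col i\<close> reads only the leading \<open>i\<close>
        coordinates, so truncation brings the integrand into the form covered by
        \<open>sphere_unif_tilt\<close>.\<close>
      have "(\<integral>\<^sup>+ x. u (tri_col i (trunc_coords i x)) \<partial>sphere_unif (d - 2 * r)) =
        (\<integral>\<^sup>+ x. u (tri_col i (trunc_coords i x)) * ennreal (tilt d i r x) \<partial>sphere_unif d)"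
        using i n by (intro sphere_unif_tilt) auto
      then show "(\<integral>\<^sup>+ x. u (tri_col i x) \<partial>sphere_unif e) = (\<integral>\<^sup>+ x. u (tri_col i x) * w i x \<partial>sphere_unif d)"
        by (simp add: tri_col_trunc_coords e_def w_def)
    qed (auto simp: prob_space_sphere_unif)
    finally show ?thesis using alt by simp
  qed
  have W1: "(\<integral>\<^sup>+ x. W x \<partial>?Pd) = 1"
  proof -
    have "(\<integral>\<^sup>+ x. w i x \<partial>sphere_unif d) = 1" if "i < n" for i
      unfolding w_def by (rule tilt_integral_1) (use n that in simp)
    then show ?thesis unfolding W_def by (subst product_nn_integral_prod) auto
  qed
  have W2: "(\<integral>\<^sup>+ x. (W x)\<^sup>2 \<partial>?Pd) \<le> ennreal (3/2)"
  proof -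
    let ?c = "(real r)\<^sup>2 / (2 * b\<^sup>2)"
    have "(\<integral>\<^sup>+ x. (W x)\<^sup>2 \<partial>?Pd) = (\<integral>\<^sup>+ x. (\<Prod>i\<in>{..<n}. (w i (x i))\<^sup>2) \<partial>?Pd)"
      unfolding W_def by (simp add: prod_power_distrib)
    also have "\<dots> = (\<Prod>i\<in>{..<n}. \<integral>\<^sup>+ x. (w i x)\<^sup>2 \<partial>sphere_unif d)"
      by (rule product_nn_integral_prod) auto
    also have "\<dots> \<le> (\<Prod>i\<in>{..<n}. ennreal (exp (real n * ?c)))"
    proof (rule prod_mono_ennreal)
      fix i assume "i \<in> {..<n}"
      then have i: "i < n" by simp
      have "(\<integral>\<^sup>+ x. (w i x)\<^sup>2 \<partial>sphere_unif d) \<le> ennreal ((tilt_const d i r)\<^sup>2 / tilt_const d i (2 * r))"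
        unfolding w_def by (rule tilt_second_moment) (use i n in simp)
      also have "\<dots> \<le> ennreal (exp (real i * ?c))"
        by (intro ennreal_leI tilt_const_ratio) (use b i in auto)
      also have "\<dots> \<le> ennreal (exp (real n * ?c))"
      proof (intro ennreal_leI)
        have "real i * ?c \<le> real n * ?c" using i by (intro mult_right_mono) auto
        then show "exp (real i * ?c) \<le> exp (real n * ?c)" by simp
      qed
      finally show "(\<integral>\<^sup>+ x. (w i x)\<^sup>2 \<partial>sphere_unif d) \<le> ennreal (exp (real n * ?c))" .
    qed
    also have "\<dots> = ennreal (exp (real n * (real n * ?c)))"
      unfolding exp_of_nat_mult[of n "real n * ?c"] by (simp add: ennreal_power)
    also have "\<dots> \<le> ennreal (3/2)"
    proof (rule ennreal_leI)
      \<comment> \<open>The quadratic bound gives \<open>21/16\<close>, comfortably below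
        \<open>3/2\<close>.\<close>
      have "exp (real n * (real n * ?c)) \<le> exp (1/4)" using b(3) by (simp add: power2_eq_square mult.assoc)
      also have "\<dots> \<le> 1 + 1/4 + (1/4)\<^sup>2" by (rule exp_bound) auto
      finally show "exp (real n * (real n * ?c)) \<le> 3/2" by (simp add: power2_eq_square)
    qed
    finally show ?thesis .
  qed
  have pointwise: "1 + 2 * W x \<le> A 1 (E x) + A 0 (E x) * W x + (W x)\<^sup>2 + ennreal (5/4)" for x
  proof (rule chi_square_pointwise)
    show "A 1 (E x) + A 0 (E x) = 1"
      unfolding A_def
      by (rule haar_avg_add_eq_1[OF vm vm verdict_add[OF \<phi> p0]]) (simp add: E_def space_PiM)
    show "W x < \<top>" unfolding W_def by (auto simp: w_def less_top[symmetric] ennreal_prod_eq_top)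
  qed
  \<comment> \<open>The pointwise inequality is arranged without subtraction, which would truncate
    at \<open>0\<close>. Since \<open>W\<close> has integral \<open>1\<close>, it yields
    \<open>3\<close> as a lower bound for the two errors plus \<open>3/2 + 5/4\<close>, and
    \<open>1/4\<close> is the difference.\<close>
  have "ennreal 3 = (\<integral>\<^sup>+ x. 1 + 2 * W x \<partial>?Pd)"
    by (subst nn_integral_add) (auto simp: nn_integral_cmult W1 Pd.emeasure_space_1)
  also have "\<dots> \<le> (\<integral>\<^sup>+ x. A 1 (E x) + A 0 (E x) * W x + (W x)\<^sup>2 + ennreal (5/4) \<partial>?Pd)"
    by (rule nn_integral_mono) (rule pointwise)
  also have "\<dots> = (\<integral>\<^sup>+ x. A 1 (E x) \<partial>?Pd) + (\<integral>\<^sup>+ x. A 0 (E x) * W x \<partial>?Pd) + (\<integral>\<^sup>+ x. (W x)\<^sup>2 \<partial>?Pd) + ennreal (5/4)"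
    by (simp add: nn_integral_add Pd.emeasure_space_1)
  also have "\<dots> \<le> P0 + B + ennreal (3/2) + ennreal (5/4)"
    by (intro add_mono null' alt' W2 order_refl)
  finally have main: "ennreal 3 \<le> (P0 + B) + ennreal (11/4)"
    by (simp add: add.assoc ennreal_plus[symmetric] del: ennreal_plus)
  show ?thesis
  proof (cases "P0 + B")
    case (real s)
    then have "ennreal 3 \<le> ennreal (s + 11/4)" using main by (simp add: ennreal_plus)
    then have "1/4 \<le> s" using real by (subst (asm) ennreal_le_iff) auto
    then have "ennreal (1/4) \<le> ennreal s" by (rule ennreal_leI)
    then show ?thesis using real by (simp add: P0_def ennreal_divide_numeral[symmetric])
  next
    case top
    then show ?thesis unfolding P0_def[symmetric] by (simp only: top_greatest)
  qed
qed

section \<open>Dimension of the rotated subspaces and choice of the parameters\<close>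

lemma subspace_euclid: "subspace (euclid k)"
  by (auto simp: subspace_def euclid_def scaleR_fun_def)

lemma euclid_sum_unitv:
  "x \<in> euclid k \<Longrightarrow> x = (\<Sum>i<k. x i *\<^sub>R unitv i)"
proof
  fix l assume x: "x \<in> euclid k"
  have "(\<Sum>i<m. x i *\<^sub>R unitv i) l = (\<Sum>i<m. if l = i then x i else 0)" for m
    by (induction m) (auto simp: scaleR_fun_def unitv_def)
  then show "x l = (\<Sum>i<k. x i *\<^sub>R unitv i) l"
    using x by (simp add: euclid_def)
qed

lemma dim_orth_map_euclid:
  assumes T: "orth_map p T"
  shows "subspace (T ` euclid k)" "dim (T ` euclid k) = k"
proof -
  have lin: "linear T" and inj: "inj T" using T by (auto simp: orth_map_def bij_is_inj)
  show "subspace (T ` euclid k)" using lin subspace_euclid by (rule linear_subspace_image)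
  have inju: "inj_on unitv {..<k}"
    by (rule inj_onI) (metis unitv_def zero_neq_one)
  let ?U = "unitv ` {..<k}"
  have U: "?U \<subseteq> euclid k" by (auto simp: unitv_euclid)
  have spanU: "euclid k \<subseteq> span ?U"
  proof
    fix x assume "x \<in> euclid k"
    then have "x = (\<Sum>i<k. x i *\<^sub>R unitv i)" by (rule euclid_sum_unitv)
    also have "\<dots> \<in> span ?U" by (intro span_sum span_scale span_base) auto
    finally show "x \<in> span ?U" .
  qed
  have ind: "independent ?U"
  proof (rule independent_if_scalars_zero)
    fix f x assume 0: "(\<Sum>x\<in>?U. f x *\<^sub>R x) = 0" and "x \<in> ?U"
    then obtain j where j: "j < k" "x = unitv j" by auto
    have "(\<Sum>i<m. f (unitv i) *\<^sub>R unitv i) j = (\<Sum>i<m. if j = i then f (unitv i) else 0)" for m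
      by (induction m) (auto simp: scaleR_fun_def unitv_def)
    from this[of k] have "(\<Sum>i<k. f (unitv i) *\<^sub>R unitv i) j = f x" using j by simp
    moreover have "(\<Sum>i<k. f (unitv i) *\<^sub>R unitv i) = 0"
      using 0 by (simp add: sum.reindex[OF inju])
    ultimately show "f x = 0" by simp
  qed simp
  have "card (T ` ?U) = k"
    using card_image[OF inj_on_subset[OF inj]] card_image[OF inju] by simp
  moreover have "independent (T ` ?U)"
    using linear_independent_injective_image[OF lin ind] inj by (simp add: inj_on_subset)
  moreover have "T ` euclid k \<subseteq> span (T ` ?U)"
    using spanU linear_span_image[OF lin, of ?U] by auto
  ultimately show "dim (T ` euclid k) = k"
    using U by (intro dim_unique[of "T ` ?U"]) auto
qed

theorem theorem4:
  fixes p :: "nat \<Rightarrow> nat"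
  assumes "filterlim (\<lambda>n. real (p n) / real n) at_top sequentially"
  shows "\<exists>\<epsilon>::real. \<epsilon> > 0 \<and>
    liminf (\<lambda>n. INF \<phi>\<in>tests n (p n).
      test_prob n (null_dist (p n)) \<phi> 1 +
      (SUP \<mu>\<in>alternatives n (p n) \<epsilon>. test_prob n \<mu> \<phi> 0)) \<ge> 1 / 4"
proof (intro exI[of _ "1/4"] conjI)
  \<comment> \<open>Rounding in the choice of \<open>r\<close> costs at most \<open>n\<close>, that
    is at most \<open>P / 100\<close>, so \<open>r * n\<close> stays below
    \<open>(1/8 + 1/100) * P\<close>, which is \<open>27 / 200 * P\<close>.\<close>
  have ev1: "eventually (\<lambda>n. 100 \<le> real (p n) / real n) sequentially"
    using assms by (simp add: filterlim_at_top)
  \<comment> \<open>A lower bound on \<open>n\<close> converts the bound on \<open>r * n\<close>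
    into one on \<open>r\<close>, so that \<open>n + 4 * r\<close> uses up only a small part of the
    dimension.\<close>
  have ev2: "eventually (\<lambda>n::nat. 10 \<le> n) sequentially" by (rule eventually_ge_at_top)
  show "1 / 4 \<le> liminf (\<lambda>n. INF \<phi>\<in>tests n (p n).
      test_prob n (null_dist (p n)) \<phi> 1 +
      (SUP \<mu>\<in>alternatives n (p n) (1/4). test_prob n \<mu> \<phi> 0))"
  proof (rule Liminf_bounded)
    show "\<forall>\<^sub>F n in sequentially. 1 / 4 \<le> (INF \<phi>\<in>tests n (p n).
      test_prob n (null_dist (p n)) \<phi> 1 +
      (SUP \<mu>\<in>alternatives n (p n) (1/4). test_prob n \<mu> \<phi> 0))"
      using ev1 ev2
    proof eventually_elim
      case (elim n)
      define P where "P = real (p n)"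
      have n: "real n \<ge> 10" using elim(2) by simp
      have Pn: "P \<ge> 100 * real n" using elim n by (simp add: P_def field_simps)
      \<comment> \<open>Rounding up guarantees that \<open>r * n\<close> is at least
        \<open>P / 8\<close>. Codimension \<open>2 * r\<close> has separation
        \<open>2 * r * n / P\<close>, hence the value \<open>1/4\<close> for the separation
        constant.\<close>
      define r where "r = nat \<lceil>P / (8 * real n)\<rceil>"
      have r_ge: "real r \<ge> P / (8 * real n)" unfolding r_def by linarith
      have "P / (8 * real n) \<ge> 0" using Pn n by simp
      then have "real r \<le> P / (8 * real n) + 1" unfolding r_def by linarith
      then have "real r * real n \<le> (P / (8 * real n) + 1) * real n"
        using n by (intro mult_right_mono) auto
      also have "\<dots> = P / 8 + real n" using n by (simp add: field_simps)
      also have "\<dots> \<le> 27 / 200 * P" using Pn by simp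
      finally have rn: "real r * real n \<le> 27 / 200 * P" .
      have "real r * 10 \<le> real r * real n" using n by (intro mult_left_mono) auto
      then have r10: "real r \<le> 27 / 2000 * P" using rn by linarith
      have "0 < P / (8 * real n)" using Pn n by simp
      then have r1: "0 < r" using r_ge by linarith
      obtain d where d: "p n = Suc d" using Pn n by (cases "p n") (auto simp: P_def)
      have dP: "real d = P - 1" using d by (simp add: P_def)
      \<comment> \<open>Small enough that \<open>2 * b\<close> fits beside \<open>n + 4 * r\<close>
        into \<open>d\<close>, large enough for \<open>b3\<close>, which for this \<open>b\<close>
        asks that \<open>(r * n)^2\<close> be at most \<open>P^2 / 32\<close>;
        \<open>(27 / 200)^2\<close> is below \<open>1/32\<close>.\<close>
      define b where "b = P / 4"
      have b: "b > 0" "2 * b + real n + 4 * real r \<le> real d"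
        using Pn n r10 by (auto simp: b_def dP)
      have b3: "(real n)\<^sup>2 * ((real r)\<^sup>2 / (2 * b\<^sup>2)) \<le> 1 / 4"
      proof -
        have "(real r * real n)\<^sup>2 \<le> (27 / 200 * P)\<^sup>2" using rn by (intro power_mono) auto
        also have "\<dots> \<le> P\<^sup>2 / 32" by (simp add: power_mult_distrib power2_eq_square)
        finally have "(real r * real n)\<^sup>2 \<le> P\<^sup>2 / 32" .
        moreover have "P > 0" using Pn n by simp
        ultimately show ?thesis by (simp add: b_def field_simps power_mult_distrib)
      qed
      have nr: "n + 4 * r \<le> d"
      using b of_nat_le_iff[of "n + 4 * r" d, where 'a=real] by simp
      show ?case
      proof (rule INF_greatest)
        fix \<phi> assume \<phi>: "\<phi> \<in> tests n (p n)"
        show "1 / 4 \<le> test_prob n (null_dist (p n)) \<phi> 1 +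
          (SUP \<mu>\<in>alternatives n (p n) (1/4). test_prob n \<mu> \<phi> 0)"
        proof (rule testing_lower_bound[OF \<phi> d nr b b3])
          fix T assume T: "orth_map (p n) T"
          let ?k = "p n - 2 * r"
          have k: "?k \<in> {1..p n - 1}" using r1 nr d by auto
          have "T ` euclid ?k \<subseteq> euclid (p n)"
            using orth_map_euclid[OF T] by (force simp: euclid_def)
          moreover have "delta n (p n) ?k \<ge> 1/4"
          proof -
            have "real ?k = P - 2 * real r" using nr d by (simp add: P_def of_nat_diff)
            then have "delta n (p n) ?k = (1 - (P - 2 * real r) / P) * real n"
              unfolding delta_def P_def[symmetric] by simp
            also have "\<dots> = 2 * real r * real n / P"
              using Pn n by (simp add: field_simps)
            finally have "delta n (p n) ?k = 2 * real r * real n / P" .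
            moreover have "P / 8 \<le> real r * real n" using r_ge n by (simp add: field_simps)
            then have "1 / 4 \<le> 2 * real r * real n / P" using Pn n by (simp add: field_simps)
            ultimately show ?thesis by simp
          qed
          ultimately have "unif_sphere (p n) (T ` euclid ?k) \<in> alternatives n (p n) (1/4)"
            unfolding alternatives_def using k dim_orth_map_euclid[OF T] by blast
          then show "test_prob n (unif_sphere (p n) (T ` euclid ?k)) \<phi> 0 \<le>
            (SUP \<mu>\<in>alternatives n (p n) (1/4). test_prob n \<mu> \<phi> 0)"
            by (rule SUP_upper)
        qed
      qed
    qed
  qed
qed simp

end
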